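(* Let $\Phi$ be a root system of affine type, not of type $A^{(2)}_{2k}$, and let $c$ be a Coxeter element. For $\alpha\in\Phi_c$ the following are equivalent: (1) $(\alpha\|\delta)_c=1=(\delta\|\alpha)_c$; (2) there exists $\beta\in\Phi_c$ such that the pair $\{\alpha,\beta\}$ is $c$-exchangeable with $\delta$. When these conditions hold, $\alpha$ lies in the $\tau_c$-orbit of a negative simple root $-\alpha_j$ such that some automorphism of the Dynkin diagram takes $\alpha_j$ to $\alpha_{\mathrm{aff}}$.
   Context: $A=[a_{ij}]$ is an $n\times n$ symmetrizable Cartan matrix of affine type with symmetrizing constants $d_i$; type $A^{(2)}_{2k}$ is in Kac's notation. $V$ has basis of simple roots $\Pi=\{\alpha_1,\dots,\alpha_n\}$, co-roots $\alpha_i^\vee=d_i^{-1}\alpha_i$, symmetric form $K(\alpha_i^\vee,\alpha_j)=a_{ij}$, reflections $s_i(v)=v-K(\alpha_i^\vee,v)\alpha_i$. $\Phi$ is the root system, $\Phi^+$ the positive roots; $[v:\alpha_i]$, $[v:\alpha_i^\vee]$ coordinates in root and co-root bases; $[x]_+=\max(x,0)$; $\beta^\vee=\frac2{K(\beta,\beta)}\beta$ for real roots, $(-\alpha_i)^\vee=-\alpha_i^\vee$; $\delta$ is the positive imaginary root closest to $0$ and $\delta^\vee$ the positive imaginary root closest to $0$ of the dual root system (Cartan matrix $A^T$). $\alpha_{\mathrm{aff}}$ is the affine simple root (the node added to the finite Dynkin diagram in Kac's classification), $V_{\mathrm{fin}}$ the span of the other simple roots, $\Phi_{\mathrm{fin}}=\Phi\cap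 V_{\mathrm{fin}}$. A diagram automorphism is a permutation $\pi$ of $\{1,\dots,n\}$ with $a_{\pi(i)\pi(j)}=a_{ij}$. The Coxeter element is indexed $c=s_1\cdots s_n$; $\sigma_i(\alpha)=\alpha$ for $\alpha\in-\Pi\setminus\{-\alpha_i\}$ and $s_i\alpha$ otherwise; $\tau_c=\sigma_1\cdots\sigma_n$. $\gamma_c\in V_{\mathrm{fin}}$ is unique with $c\gamma_c=\gamma_c+\delta$, $U_c=\{v:K(\gamma_c,v)=0\}$, $\Upsilon_c=\Phi\cap U_c$, $\Upsilon^{\mathrm{re}}_c$ the positive real roots in $U_c$ whose $c$-orbit contains a root of $\Phi_{\mathrm{fin}}$, $\Phi_c=-\Pi\cup(\Phi^+\setminus U_c)\cup\Upsilon^{\mathrm{re}}_c\cup\{\delta\}$. Real roots of $\Upsilon_c$ form a root system with irreducible components of affine type A; $\Pi_c$ is the unique minimal subset of $\Upsilon_c\cap\Phi^+$ whose nonnegative span contains $\Upsilon_c\cap\Phi^+$. Tube support $\mathrm{Supp}_{\Pi_c}(\beta)$: elements of $\Pi_c$ with nonzero coefficient in the unique expansion of $\beta$ in simple roots of its component; union for sets; component-full: containing all simple roots of some component. $\mathrm{adj}(\alpha,\beta)$ counts elements $\beta_j$ of $\mathrm{Supp}_{\Pi_c}(\beta)$ with $\beta_j\in\mathrm{Supp}_{\Pi_c}(c\alpha)\cup\mathrm{Supp}_{\Pi_c}(c^{-1}\alpha)$ and $\beta_j\notin\mathrm{Supp}_{\Pi_c}(\alpha)$. $(\alpha\|\beta)_c^{\to}=-\sum_{i}[\alpha^\vee:\alpha_i^\vee][\beta:\alpha_i]-\sum_{j<i}a_{ij}[\alpha^\vee:\alpha_i^\vee]_+[\beta:\alpha_j]_+$,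 $(\alpha\|\beta)_c^{\leftarrow}=-\sum_{i}[\alpha^\vee:\alpha_i^\vee][\beta:\alpha_i]-\sum_{i<j}a_{ij}[\alpha^\vee:\alpha_i^\vee]_+[\beta:\alpha_j]_+$; $(\alpha\|\beta)_c=\mathrm{adj}(\alpha,\beta)$ if $\alpha,\beta\in\Upsilon^{\mathrm{re}}_c$ and $\{\alpha,\beta\}$ is component-full, otherwise the maximum of these two. Distinct roots are $c$-compatible if their degree is $0$; a $c$-cluster is a maximal set of pairwise $c$-compatible roots in $\Phi_c$. A pair $\{\alpha,\beta\}$ is $c$-exchangeable with $\delta$ if there exist a $c$-cluster $C$ with $\delta\in C$ and a $c$-cluster $C'$ with $\alpha,\beta\in C'$ such that $C\setminus\{\delta\}=C'\setminus\{\alpha,\beta\}$. *)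

theory Defs
  imports Complex_Main
begin

text \<open>Vectors of V are coordinate functions in the basis of simple roots:
  v k = [v : alpha_k], for indices k < n (simple roots indexed 0..n-1, so that
  the Coxeter element is c = s_0 s_1 ... s_(n-1)).  A Cartan matrix is an integer
  function on index pairs.\<close>

type_synonym vec = "nat \<Rightarrow> real"
type_synonym cmat = "nat \<Rightarrow> nat \<Rightarrow> int"

definition simple :: "nat \<Rightarrow> vec" where
  "simple i = (\<lambda>k. if k = i then 1 else 0)"

definition nsimple :: "nat \<Rightarrow> vec" where
  "nsimple i = (\<lambda>k. if k = i then -1 else 0)"

definition neg :: "vec \<Rightarrow> vec" where
  "neg v = (\<lambda>k. - v k)"

definition supported :: "nat \<Rightarrow> vec \<Rightarrow> bool" where
  "supported n v \<longleftrightarrow> (\<forall>k\<ge>n. v k = 0)"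

definition height :: "nat \<Rightarrow> vec \<Rightarrow> real" where
  "height n v = (\<Sum>i<n. v i)"

definition transp :: "cmat \<Rightarrow> cmat" where
  "transp A = (\<lambda>i j. A j i)"

definition gcm :: "cmat \<Rightarrow> nat \<Rightarrow> bool" where
  "gcm A n \<longleftrightarrow> (\<forall>i<n. A i i = 2) \<and>
     (\<forall>i<n. \<forall>j<n. i \<noteq> j \<longrightarrow> A i j \<le> 0) \<and>
     (\<forall>i<n. \<forall>j<n. A i j = 0 \<longleftrightarrow> A j i = 0)"

definition dynkin_connected :: "cmat \<Rightarrow> nat set \<Rightarrow> bool" where
  "dynkin_connected A S \<longleftrightarrow> S \<noteq> {} \<and>
     (\<forall>T. T \<subseteq> S \<and> T \<noteq> {} \<and> T \<noteq> S \<longrightarrow> (\<exists>i\<in>T. \<exists>j\<in>S - T. A i j \<noteq> 0))"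

definition matvec :: "cmat \<Rightarrow> nat \<Rightarrow> vec \<Rightarrow> nat \<Rightarrow> real" where
  "matvec A n v i = (\<Sum>j<n. of_int (A i j) * v j)"

text \<open>Affine type in the sense of Kac (condition (Aff)): indecomposable GCM, corank 1
  with a positive null vector u, and Av \<ge> 0 implies Av = 0.\<close>
definition affine_type :: "cmat \<Rightarrow> nat \<Rightarrow> bool" where
  "affine_type A n \<longleftrightarrow> gcm A n \<and> dynkin_connected A {..<n} \<and>
     (\<exists>u. (\<forall>i<n. u i > 0) \<and> (\<forall>i<n. matvec A n u i = 0) \<and>
          (\<forall>v. (\<forall>i<n. matvec A n v i = 0) \<longrightarrow> (\<exists>t. \<forall>i<n. v i = t * u i))) \<and>
     (\<forall>v. (\<forall>i<n. matvec A n v i \<ge> 0) \<longrightarrow> (\<forall>i<n. matvec A n v i = 0))"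

definition symmetrizing :: "cmat \<Rightarrow> (nat \<Rightarrow> real) \<Rightarrow> nat \<Rightarrow> bool" where
  "symmetrizing A d n \<longleftrightarrow> (\<forall>i<n. d i > 0) \<and>
     (\<forall>i<n. \<forall>j<n. d i * of_int (A i j) = d j * of_int (A j i))"

text \<open>The affine Cartan matrix of type A_{2k}^{(2)} (k \<ge> 1), nodes 0..k (Kac's tables;
  this family is closed under transposition up to relabelling).\<close>
definition a2k2 :: "nat \<Rightarrow> cmat" where
  "a2k2 k i j =
     (if i = j then 2
      else if k = 1 then (if (i, j) = (0, 1) then -4 else -1)
      else if (i, j) = (0, 1) then -2
      else if (i, j) = (k - 1, k) then -2
      else if i = j + 1 \<or> j = i + 1 then -1 else 0)"

definition type_A2k2 :: "cmat \<Rightarrow> nat \<Rightarrow> bool" where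
  "type_A2k2 A n \<longleftrightarrow> (\<exists>k\<ge>1. n = k + 1 \<and>
     (\<exists>\<sigma>. bij_betw \<sigma> {..<n} {..<n} \<and> (\<forall>i<n. \<forall>j<n. A (\<sigma> i) (\<sigma> j) = a2k2 k i j)))"

definition diagram_aut :: "cmat \<Rightarrow> nat \<Rightarrow> (nat \<Rightarrow> nat) \<Rightarrow> bool" where
  "diagram_aut A n \<pi> \<longleftrightarrow> bij_betw \<pi> {..<n} {..<n} \<and> (\<forall>i<n. \<forall>j<n. A (\<pi> i) (\<pi> j) = A i j)"

text \<open>Symmetric form: K(alpha_i, alpha_j) = d_i a_ij, i.e. K(alpha_i^vee, alpha_j) = a_ij.\<close>
definition Kform :: "cmat \<Rightarrow> (nat \<Rightarrow> real) \<Rightarrow> nat \<Rightarrow> vec \<Rightarrow> vec \<Rightarrow> real" where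
  "Kform A d n u v = (\<Sum>i<n. \<Sum>j<n. d i * of_int (A i j) * u i * v j)"

definition refl :: "cmat \<Rightarrow> nat \<Rightarrow> nat \<Rightarrow> vec \<Rightarrow> vec" where
  "refl A n i v = (\<lambda>k. v k - (if k = i then matvec A n v i else 0))"

definition weyl_word :: "cmat \<Rightarrow> nat \<Rightarrow> nat list \<Rightarrow> vec \<Rightarrow> vec" where
  "weyl_word A n ws v = foldr (refl A n) ws v"

definition real_roots :: "cmat \<Rightarrow> nat \<Rightarrow> vec set" where
  "real_roots A n = {weyl_word A n ws (simple i) | ws i. set ws \<subseteq> {..<n} \<and> i < n}"

definition kac_K :: "cmat \<Rightarrow> nat \<Rightarrow> vec set" where
  "kac_K A n = {\<alpha>. supported n \<alpha> \<and> (\<forall>i<n. \<alpha> i \<in> \<int> \<and> \<alpha> i \<ge> 0) \<and>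
      dynkin_connected A {i. i < n \<and> \<alpha> i \<noteq> 0} \<and> (\<forall>i<n. matvec A n \<alpha> i \<le> 0)}"

definition pos_imag_roots :: "cmat \<Rightarrow> nat \<Rightarrow> vec set" where
  "pos_imag_roots A n = {weyl_word A n ws \<alpha> | ws \<alpha>. set ws \<subseteq> {..<n} \<and> \<alpha> \<in> kac_K A n}"

definition roots :: "cmat \<Rightarrow> nat \<Rightarrow> vec set" where
  "roots A n = real_roots A n \<union> pos_imag_roots A n \<union> neg ` pos_imag_roots A n"

definition positive_roots :: "cmat \<Rightarrow> nat \<Rightarrow> vec set" where
  "positive_roots A n = {\<beta> \<in> roots A n. \<forall>i<n. \<beta> i \<ge> 0}"

definition delta :: "cmat \<Rightarrow> nat \<Rightarrow> vec" where
  "delta A n = (THE \<beta>. \<beta> \<in> pos_imag_roots A n \<and>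
                  (\<forall>\<gamma>\<in>pos_imag_roots A n. height n \<beta> \<le> height n \<gamma>))"

text \<open>delta^vee: the same for the dual root system (Cartan matrix A^T), given by its
  coordinates in the basis of simple co-roots.\<close>
definition delta_vee :: "cmat \<Rightarrow> nat \<Rightarrow> vec" where
  "delta_vee A n = delta (transp A) n"

text \<open>Coordinates [alpha^vee : alpha_i^vee] of the co-root of alpha
  (real roots: alpha^vee = 2 alpha / K(alpha,alpha); delta: delta^vee).\<close>
definition corootc :: "cmat \<Rightarrow> (nat \<Rightarrow> real) \<Rightarrow> nat \<Rightarrow> vec \<Rightarrow> nat \<Rightarrow> real" where
  "corootc A d n \<alpha> i =
     (if \<alpha> \<in> real_roots A n then 2 * d i * \<alpha> i / Kform A d n \<alpha> \<alpha>
      else if \<alpha> = delta A n then delta_vee A n i else 0)"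

text \<open>The affine node: Kac's alpha_0 has coefficient 1 in both delta and delta^vee
  (for all types other than A_{2k}^{(2)}); the nodes with this property form exactly the
  orbit of Kac's affine node under diagram automorphisms.\<close>
definition is_affine_node :: "cmat \<Rightarrow> nat \<Rightarrow> nat \<Rightarrow> bool" where
  "is_affine_node A n i \<longleftrightarrow> i < n \<and> delta A n i = 1 \<and> delta_vee A n i = 1"

definition cox :: "cmat \<Rightarrow> nat \<Rightarrow> vec \<Rightarrow> vec" where
  "cox A n v = foldr (refl A n) [0..<n] v"

definition coxinv :: "cmat \<Rightarrow> nat \<Rightarrow> vec \<Rightarrow> vec" where
  "coxinv A n v = foldl (\<lambda>w i. refl A n i w) v [0..<n]"

definition cox_pow :: "cmat \<Rightarrow> nat \<Rightarrow> int \<Rightarrow> vec \<Rightarrow> vec" where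
  "cox_pow A n m v = (if 0 \<le> m then (cox A n ^^ nat m) v else (coxinv A n ^^ nat (- m)) v)"

definition sigma :: "cmat \<Rightarrow> nat \<Rightarrow> nat \<Rightarrow> vec \<Rightarrow> vec" where
  "sigma A n i \<alpha> = (if (\<exists>j<n. \<alpha> = nsimple j) \<and> \<alpha> \<noteq> nsimple i then \<alpha> else refl A n i \<alpha>)"

definition tau :: "cmat \<Rightarrow> nat \<Rightarrow> vec \<Rightarrow> vec" where
  "tau A n \<alpha> = foldr (sigma A n) [0..<n] \<alpha>"

definition roots_fin :: "cmat \<Rightarrow> nat \<Rightarrow> nat \<Rightarrow> vec set" where
  "roots_fin A n aff = {\<beta> \<in> roots A n. \<beta> aff = 0}"

definition gamma_c :: "cmat \<Rightarrow> nat \<Rightarrow> nat \<Rightarrow> vec" where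
  "gamma_c A n aff = (THE \<gamma>. supported n \<gamma> \<and> \<gamma> aff = 0 \<and>
                        cox A n \<gamma> = (\<lambda>k. \<gamma> k + delta A n k))"

definition in_U :: "cmat \<Rightarrow> (nat \<Rightarrow> real) \<Rightarrow> nat \<Rightarrow> nat \<Rightarrow> vec \<Rightarrow> bool" where
  "in_U A d n aff v \<longleftrightarrow> Kform A d n (gamma_c A n aff) v = 0"

definition Upsilon :: "cmat \<Rightarrow> (nat \<Rightarrow> real) \<Rightarrow> nat \<Rightarrow> nat \<Rightarrow> vec set" where
  "Upsilon A d n aff = {\<beta> \<in> roots A n. in_U A d n aff \<beta>}"

definition Upsilon_re :: "cmat \<Rightarrow> (nat \<Rightarrow> real) \<Rightarrow> nat \<Rightarrow> nat \<Rightarrow> vec set" where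
  "Upsilon_re A d n aff = {\<beta> \<in> positive_roots A n \<inter> real_roots A n. in_U A d n aff \<beta> \<and>
      (\<exists>m::int. cox_pow A n m \<beta> \<in> roots_fin A n aff)}"

definition Phi_c :: "cmat \<Rightarrow> (nat \<Rightarrow> real) \<Rightarrow> nat \<Rightarrow> nat \<Rightarrow> vec set" where
  "Phi_c A d n aff = nsimple ` {..<n} \<union> {\<beta> \<in> positive_roots A n. \<not> in_U A d n aff \<beta>}
      \<union> Upsilon_re A d n aff \<union> {delta A n}"

definition nonneg_span :: "vec set \<Rightarrow> vec set" where
  "nonneg_span P = {(\<lambda>k. \<Sum>x\<in>F. c x * x k) | F c. finite F \<and> F \<subseteq> P \<and> (\<forall>x\<in>F. c x \<ge> 0)}"

definition Pi_c :: "cmat \<Rightarrow> (nat \<Rightarrow> real) \<Rightarrow> nat \<Rightarrow> nat \<Rightarrow> vec set" where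
  "Pi_c A d n aff = (THE P. P \<subseteq> Upsilon A d n aff \<inter> positive_roots A n \<and>
       Upsilon A d n aff \<inter> positive_roots A n \<subseteq> nonneg_span P \<and>
       (\<forall>Q. Q \<subset> P \<longrightarrow> \<not> (Upsilon A d n aff \<inter> positive_roots A n \<subseteq> nonneg_span Q)))"

text \<open>Sets of simple roots of the irreducible components of the root system Upsilon_c
  (connected components of the diagram on Pi_c).\<close>
definition tube_comps :: "cmat \<Rightarrow> (nat \<Rightarrow> real) \<Rightarrow> nat \<Rightarrow> nat \<Rightarrow> vec set set" where
  "tube_comps A d n aff = {C. C \<subseteq> Pi_c A d n aff \<and> C \<noteq> {} \<and>
      (\<forall>T. T \<subseteq> C \<and> T \<noteq> {} \<and> T \<noteq> C \<longrightarrow> (\<exists>p\<in>T. \<exists>q\<in>C - T. Kform A d n p q \<noteq> 0)) \<and>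
      (\<forall>p\<in>C. \<forall>q\<in>Pi_c A d n aff - C. Kform A d n p q = 0)}"

text \<open>Tube support: simple roots with nonzero coefficient in the (unique) expansion of beta
  in the simple roots of its component.\<close>
definition tsupp :: "cmat \<Rightarrow> (nat \<Rightarrow> real) \<Rightarrow> nat \<Rightarrow> nat \<Rightarrow> vec \<Rightarrow> vec set" where
  "tsupp A d n aff \<beta> = {p. \<exists>C\<in>tube_comps A d n aff. \<exists>x. finite C \<and>
      \<beta> = (\<lambda>k. \<Sum>q\<in>C. x q * q k) \<and> p \<in> C \<and> x p \<noteq> 0}"

definition comp_full :: "cmat \<Rightarrow> (nat \<Rightarrow> real) \<Rightarrow> nat \<Rightarrow> nat \<Rightarrow> vec \<Rightarrow> vec \<Rightarrow> bool" where
  "comp_full A d n aff \<alpha> \<beta> \<longleftrightarrow>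
     (\<exists>C\<in>tube_comps A d n aff. C \<subseteq> tsupp A d n aff \<alpha> \<union> tsupp A d n aff \<beta>)"

definition adj :: "cmat \<Rightarrow> (nat \<Rightarrow> real) \<Rightarrow> nat \<Rightarrow> nat \<Rightarrow> vec \<Rightarrow> vec \<Rightarrow> nat" where
  "adj A d n aff \<alpha> \<beta> = card {b \<in> tsupp A d n aff \<beta>.
      b \<in> tsupp A d n aff (cox A n \<alpha>) \<union> tsupp A d n aff (coxinv A n \<alpha>) \<and>
      b \<notin> tsupp A d n aff \<alpha>}"

definition posp :: "real \<Rightarrow> real" where
  "posp x = max x 0"

definition deg_right :: "cmat \<Rightarrow> (nat \<Rightarrow> real) \<Rightarrow> nat \<Rightarrow> vec \<Rightarrow> vec \<Rightarrow> real" where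
  "deg_right A d n \<alpha> \<beta> = - (\<Sum>i<n. corootc A d n \<alpha> i * \<beta> i)
     - (\<Sum>i<n. \<Sum>j<n. if j < i then of_int (A i j) * posp (corootc A d n \<alpha> i) * posp (\<beta> j) else 0)"

definition deg_left :: "cmat \<Rightarrow> (nat \<Rightarrow> real) \<Rightarrow> nat \<Rightarrow> vec \<Rightarrow> vec \<Rightarrow> real" where
  "deg_left A d n \<alpha> \<beta> = - (\<Sum>i<n. corootc A d n \<alpha> i * \<beta> i)
     - (\<Sum>i<n. \<Sum>j<n. if i < j then of_int (A i j) * posp (corootc A d n \<alpha> i) * posp (\<beta> j) else 0)"

definition cdeg :: "cmat \<Rightarrow> (nat \<Rightarrow> real) \<Rightarrow> nat \<Rightarrow> nat \<Rightarrow> vec \<Rightarrow> vec \<Rightarrow> real" where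
  "cdeg A d n aff \<alpha> \<beta> =
     (if \<alpha> \<in> Upsilon_re A d n aff \<and> \<beta> \<in> Upsilon_re A d n aff \<and> comp_full A d n aff \<alpha> \<beta>
      then real (adj A d n aff \<alpha> \<beta>)
      else max (deg_right A d n \<alpha> \<beta>) (deg_left A d n \<alpha> \<beta>))"

definition c_compatible :: "cmat \<Rightarrow> (nat \<Rightarrow> real) \<Rightarrow> nat \<Rightarrow> nat \<Rightarrow> vec \<Rightarrow> vec \<Rightarrow> bool" where
  "c_compatible A d n aff \<alpha> \<beta> \<longleftrightarrow> \<alpha> \<noteq> \<beta> \<and> cdeg A d n aff \<alpha> \<beta> = 0"

definition pairwise_compatible :: "cmat \<Rightarrow> (nat \<Rightarrow> real) \<Rightarrow> nat \<Rightarrow> nat \<Rightarrow> vec set \<Rightarrow> bool" where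
  "pairwise_compatible A d n aff C \<longleftrightarrow>
     (\<forall>\<alpha>\<in>C. \<forall>\<beta>\<in>C. \<alpha> \<noteq> \<beta> \<longrightarrow> c_compatible A d n aff \<alpha> \<beta>)"

definition c_cluster :: "cmat \<Rightarrow> (nat \<Rightarrow> real) \<Rightarrow> nat \<Rightarrow> nat \<Rightarrow> vec set \<Rightarrow> bool" where
  "c_cluster A d n aff C \<longleftrightarrow> C \<subseteq> Phi_c A d n aff \<and> pairwise_compatible A d n aff C \<and>
     (\<forall>D. C \<subset> D \<and> D \<subseteq> Phi_c A d n aff \<longrightarrow> \<not> pairwise_compatible A d n aff D)"

definition exchangeable_with_delta :: "cmat \<Rightarrow> (nat \<Rightarrow> real) \<Rightarrow> nat \<Rightarrow> nat \<Rightarrow> vec \<Rightarrow> vec \<Rightarrow> bool" where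
  "exchangeable_with_delta A d n aff \<alpha> \<beta> \<longleftrightarrow> \<alpha> \<noteq> \<beta> \<and>
     (\<exists>C C'. c_cluster A d n aff C \<and> delta A n \<in> C \<and> c_cluster A d n aff C' \<and>
        \<alpha> \<in> C' \<and> \<beta> \<in> C' \<and> C - {delta A n} = C' - {\<alpha>, \<beta>})"

definition in_tau_orbit :: "cmat \<Rightarrow> nat \<Rightarrow> vec \<Rightarrow> vec \<Rightarrow> bool" where
  "in_tau_orbit A n \<alpha> \<beta> \<longleftrightarrow> (\<exists>k. (tau A n ^^ k) \<beta> = \<alpha> \<or> (tau A n ^^ k) \<alpha> = \<beta>)"

end

theory Submission
  imports Defs "HOL-Library.Function_Algebras"
begin

text \<open>
  Let \<open>E\<close> be the Euler form of \<open>c\<close>, so that \<open>K(a, b) = E(a, b) + E(b, a)\<close> and \<open>E(a, c b) = - E(b, a)\<close>.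
  Compatibility degrees of positive roots are normalized values of \<open>- E\<close>, and \<open>U\<close> is the kernel of
  \<open>E(\<cdot>, \<delta>)\<close>. Up to sign and a shift by \<open>c\<close>, each root \<open>w\<close> of \<open>\<Phi>\<^sub>c\<close> outside \<open>U\<close> corresponds to a real
  root \<open>x\<close> with \<open>E(x, \<delta>) > 0\<close>; then \<open>E(x, \<cdot>)\<close> is nonnegative on the positive roots of \<open>U\<close>, and \<open>w\<close> is
  compatible with such a root \<open>q\<close> if and only if \<open>E(x, q) = 0\<close>.

  Modulo \<open>\<delta>\<close> the Coxeter element is a product of reflections in roots of \<open>U\<close>, since it lies in a finite
  Weyl group and fixes \<open>\<gamma>\<^sub>c\<close>. Hence these roots span \<open>U\<close>, the tubes are the \<open>c\<close>-orbits of the simple roots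
  of \<open>U\<close>, and the roots in \<open>\<Upsilon>\<^sub>c\<^sup>r\<^sup>e\<close> are the proper arcs of these orbits. Both degrees of \<open>w\<close> with \<open>\<delta>\<close> are
  one if and only if \<open>E(x, \<cdot>)\<close> is nonzero at exactly one simple root of each tube, which is the same as
  \<open>w\<close> being compatible with a maximal compatible set of arcs. The roots outside \<open>U\<close> compatible with
  this set correspond to \<open>x + m\<delta>\<close>, and two of them are compatible if and only if the values of \<open>m\<close> differ
  by one, so the cluster through \<open>w\<close> is completed by the root for \<open>x + \<delta>\<close>.
\<close>

section \<open>Vectors\<close>

text \<open>What shapes the proof is that the cyclic structure of each tube has to be extracted from
  the form itself. The lever is the affine node: its coefficient 1 in \<delta> and in the dual
  imaginary root lets projection modulo \<delta> onto the finite part preserve real roots, so that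
  finiteness and finite Weyl group arguments apply; and the root \<open>y\<close> with
  \<open>E y v = d aff * v aff\<close> has the smallest possible positive value \<open>d aff\<close>
  at \<delta>. For roots \<open>z\<close> of that kind (\<open>Z\<close>), the values of
  \<open>E z\<close> on an orbit of tube simple roots are nonnegative with total
  \<open>mu p * d aff\<close>, while integrality and connectedness of the orbit bound every nonzero
  value below by the same number; so \<open>E z\<close> is concentrated at one root of the orbit.
  Comparing \<open>z\<close> with its reflection in that root then computes \<open>E\<close> on the
  whole orbit. Positivity of \<open>E\<close> has another source: a positive real root with positive
  value at \<delta> is carried by powers of \<open>c\<close> to one of the roots that
  \<open>c\<close> makes negative, and pairing with such a root is reading off a coordinate.
  Integrality of a root and of its co-root replaces words in the reflections by arithmetic.\<close>

definition sm :: "real \<Rightarrow> vec \<Rightarrow> vec" (infixr "\<odot>" 75) where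
  "a \<odot> v = (\<lambda>k. a * v k)"

lemma sm_apply [simp]: "(a \<odot> v) k = a * v k"
  by (simp add: sm_def)

lemma sum_vec_apply: "sum f S k = (\<Sum>x\<in>S. (f x :: vec) k)"
  by (induction S rule: infinite_finite_induct) auto

lemma sm_simps [simp]:
  "0 \<odot> v = 0" "1 \<odot> v = v" "a \<odot> 0 = 0" "a \<odot> b \<odot> v = (a * b) \<odot> v"
  by (auto simp: fun_eq_iff)

lemma sm_distribs:
  "(a + b) \<odot> v = a \<odot> v + b \<odot> v" "a \<odot> (v + w) = a \<odot> v + a \<odot> w"
  "(a - b) \<odot> v = a \<odot> v - b \<odot> v" "a \<odot> (v - w) = a \<odot> v - a \<odot> w"
  by (auto simp: fun_eq_iff algebra_simps)

lemma sm_minus: "(- a) \<odot> v = - (a \<odot> v)" "a \<odot> (- v) = - (a \<odot> v)"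
  by (auto simp: fun_eq_iff)

lemma sm_sum: "a \<odot> (\<Sum>x\<in>S. f x) = (\<Sum>x\<in>S. a \<odot> f x)"
  by (auto simp: fun_eq_iff sum_vec_apply sum_distrib_left)

lemma simple_apply: "simple i k = (if k = i then 1 else 0)"
  by (simp add: simple_def)

lemma nsimple_eq: "nsimple i = - simple i"
  by (auto simp: nsimple_def simple_def fun_eq_iff)

lemma neg_eq: "neg v = - v"
  by (auto simp: neg_def fun_eq_iff)

lemma supportedD: "supported n v \<Longrightarrow> \<not> k < n \<Longrightarrow> v k = 0"
  by (auto simp: supported_def)

lemma supported_simps [simp, intro]:
  "supported n 0" "i < n \<Longrightarrow> supported n (simple i)"
  "supported n u \<Longrightarrow> supported n v \<Longrightarrow> supported n (u + v)"
  "supported n u \<Longrightarrow> supported n v \<Longrightarrow> supported n (u - v)"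
  "supported n u \<Longrightarrow> supported n (- u)"
  "supported n u \<Longrightarrow> supported n (a \<odot> u)"
  by (auto simp: supported_def simple_def)

lemma supported_sum: "(\<And>x. x \<in> S \<Longrightarrow> supported n (f x)) \<Longrightarrow> supported n (\<Sum>x\<in>S. f x)"
  by (auto simp: supported_def sum_vec_apply)

definition pos :: "vec \<Rightarrow> bool" where "pos v \<longleftrightarrow> (\<forall>i. v i \<ge> 0)"

lemma posD: "pos v \<Longrightarrow> v i \<ge> 0"
  by (simp add: pos_def)

lemma pos_add: "pos u \<Longrightarrow> pos v \<Longrightarrow> pos (u + v)"
  by (simp add: pos_def)

lemma pos_sm: "a \<ge> 0 \<Longrightarrow> pos v \<Longrightarrow> pos (a \<odot> v)"
  by (simp add: pos_def)

lemma pos_simple [simp]: "pos (simple i)"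
  by (simp add: pos_def simple_def)

lemma pos_neg_eq_0: "pos v \<Longrightarrow> pos (- v) \<Longrightarrow> v = 0"
  by (auto simp: pos_def fun_eq_iff intro: antisym)

lemma height_linear: "height n (u + v) = height n u + height n v"
  "height n (u - v) = height n u - height n v"
  "height n (a \<odot> u) = a * height n u"
  by (auto simp: height_def sum.distrib sum_subtractf sum_distrib_left)

lemma height_pos: "pos v \<Longrightarrow> supported n v \<Longrightarrow> v \<noteq> 0 \<Longrightarrow> height n v > 0"
proof -
  assume a: "pos v" "supported n v" "v \<noteq> 0"
  then obtain k where k: "v k \<noteq> 0" "k < n" by (auto simp: fun_eq_iff supported_def) (metis not_le)
  then have "v k > 0" using a(1) by (metis posD less_eq_real_def)
  also have "v k \<le> (\<Sum>i<n. v i)" using k a(1) by (intro member_le_sum) (auto simp: pos_def)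
  finally show ?thesis by (simp add: height_def)
qed

section \<open>The Euler form\<close>

text \<open>Here \<delta> is a parameter pinned down by its properties; \<open>affine_sysI\<close>
  supplies the actual root. The last assumption is integrality of the dual imaginary root,
  normalized to coefficient 1 at \<open>aff\<close>.\<close>

locale affine_data =
  fixes A :: cmat and d :: "nat \<Rightarrow> real" and n aff :: nat and \<delta> :: vec
  assumes gcm: "gcm A n"
    and conn: "dynkin_connected A {..<n}"
    and d_pos: "i < n \<Longrightarrow> d i > 0"
    and d_sym: "i < n \<Longrightarrow> j < n \<Longrightarrow> d i * of_int (A i j) = d j * of_int (A j i)"
    and delta_supp [simp]: "supported n \<delta>"
    and delta_int: "\<delta> i \<in> \<int>"
    and delta_pos: "i < n \<Longrightarrow> \<delta> i > 0"
    and delta_null: "i < n \<Longrightarrow> matvec A n \<delta> i = 0"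
    and aff_less [simp]: "aff < n"
    and delta_aff [simp]: "\<delta> aff = 1"
    and delta_vee_int: "i < n \<Longrightarrow> d i * \<delta> i / d aff \<in> \<int>"
begin

lemma A_diag: "i < n \<Longrightarrow> A i i = 2"
  and A_off: "i < n \<Longrightarrow> j < n \<Longrightarrow> i \<noteq> j \<Longrightarrow> A i j \<le> 0"
  using gcm by (auto simp: gcm_def)

lemma pos_delta: "pos \<delta>"
  unfolding pos_def using delta_pos supportedD[OF delta_supp] by (metis less_eq_real_def)

text \<open>Upper triangular half of the matrix \<open>d i * A i j\<close> of \<open>K\<close>, for
  the order of the factors of \<open>c\<close>, with the diagonal entry \<open>2 * d i\<close>
  halved. So \<open>E v v\<close> is half of \<open>K v v\<close>, and it serves as the norm
  throughout.\<close>

definition eul :: "nat \<Rightarrow> nat \<Rightarrow> real" where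
  "eul i j = (if i = j then d i else if i < j then d i * of_int (A i j) else 0)"

definition E :: "vec \<Rightarrow> vec \<Rightarrow> real" where
  "E u v = (\<Sum>i<n. \<Sum>j<n. eul i j * u i * v j)"

definition K :: "vec \<Rightarrow> vec \<Rightarrow> real" where
  "K u v = E u v + E v u"

lemma E_linear:
  "E (u + v) w = E u w + E v w" "E w (u + v) = E w u + E w v"
  "E (u - v) w = E u w - E v w" "E w (u - v) = E w u - E w v"
  "E (a \<odot> u) w = a * E u w" "E w (a \<odot> u) = a * E w u"
  "E (- u) w = - E u w" "E w (- u) = - E w u" "E 0 w = 0" "E w 0 = 0"
  by (simp_all add: E_def algebra_simps sum.distrib sum_subtractf sum_distrib_left sum_negf)

lemma K_linear:
  "K (u + v) w = K u w + K v w" "K w (u + v) = K w u + K w v"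
  "K (u - v) w = K u w - K v w" "K w (u - v) = K w u - K w v"
  "K (a \<odot> u) w = a * K u w" "K w (a \<odot> u) = a * K w u"
  "K (- u) w = - K u w" "K w (- u) = - K w u" "K 0 w = 0" "K w 0 = 0"
  by (simp_all add: K_def E_linear algebra_simps)

lemma E_sum: "E (\<Sum>x\<in>S. f x) w = (\<Sum>x\<in>S. E (f x) w)" "E w (\<Sum>x\<in>S. f x) = (\<Sum>x\<in>S. E w (f x))"
  by (induction S rule: infinite_finite_induct;
      simp only: sum.infinite sum.empty sum.insert E_linear not_False_eq_True)+

lemma K_sum: "K (\<Sum>x\<in>S. f x) w = (\<Sum>x\<in>S. K (f x) w)" "K w (\<Sum>x\<in>S. f x) = (\<Sum>x\<in>S. K w (f x))"
  by (induction S rule: infinite_finite_induct;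
      simp only: sum.infinite sum.empty sum.insert K_linear not_False_eq_True)+

lemma K_sym: "K u v = K v u"
  by (simp add: K_def)

lemma K_self: "K v v = 2 * E v v"
  by (simp add: K_def)

lemma eul_sym: "i < n \<Longrightarrow> j < n \<Longrightarrow> eul i j + eul j i = d i * of_int (A i j)"
  using d_sym[of i j] A_diag[of i] by (auto simp: eul_def)

lemma K_Kform: "K u v = Kform A d n u v"
proof -
  have "K u v = (\<Sum>i<n. \<Sum>j<n. eul i j * u i * v j) + (\<Sum>j<n. \<Sum>i<n. eul j i * v j * u i)"
    by (simp add: K_def E_def)
  also have "(\<Sum>j<n. \<Sum>i<n. eul j i * v j * u i) = (\<Sum>i<n. \<Sum>j<n. eul j i * v j * u i)"
    by (rule sum.swap)
  also have "(\<Sum>i<n. \<Sum>j<n. eul i j * u i * v j) + \<dots> = (\<Sum>i<n. \<Sum>j<n. (eul i j + eul j i) * u i * v j)"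
    by (simp add: sum.distrib algebra_simps)
  also have "\<dots> = Kform A d n u v" unfolding Kform_def
    by (intro sum.cong refl) (simp add: eul_sym)
  finally show ?thesis .
qed

lemma E_simple_left: "i < n \<Longrightarrow> E (simple i) v = (\<Sum>j<n. eul i j * v j)"
proof -
  assume i: "i < n"
  have "E (simple i) v = (\<Sum>i'<n. if i' = i then (\<Sum>j<n. eul i j * v j) else 0)"
    unfolding E_def by (intro sum.cong refl) (auto simp: simple_apply)
  then show ?thesis using i by simp
qed

lemma E_simple_right: "i < n \<Longrightarrow> E v (simple i) = (\<Sum>j<n. eul j i * v j)"
proof -
  assume i: "i < n"
  have "E v (simple i) = (\<Sum>j<n. \<Sum>i'<n. if i' = i then eul j i * v j else 0)"
    unfolding E_def by (intro sum.cong refl) (auto simp: simple_apply)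
  then show ?thesis using i by simp
qed

lemma K_simple: "i < n \<Longrightarrow> K (simple i) v = d i * matvec A n v i"
proof -
  assume i: "i < n"
  have "K (simple i) v = (\<Sum>j<n. (eul i j + eul j i) * v j)"
    using i by (simp add: K_def E_simple_left E_simple_right sum.distrib distrib_right)
  also have "\<dots> = (\<Sum>j<n. d i * (of_int (A i j) * v j))"
    using i by (intro sum.cong refl) (simp add: eul_sym)
  finally show ?thesis by (simp add: matvec_def sum_distrib_left)
qed

lemma E_simple_simple [simp]: "i < n \<Longrightarrow> E (simple i) (simple i) = d i"
proof -
  assume i: "i < n"
  have "E (simple i) (simple i) = (\<Sum>j<n. if j = i then d i else 0)"
    unfolding E_simple_left[OF i] by (intro sum.cong refl) (auto simp: simple_apply eul_def)
  then show ?thesis using i by simp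
qed

lemma E_expand_left: "E u v = (\<Sum>i<n. u i * E (simple i) v)"
proof -
  have "(\<Sum>i<n. u i * E (simple i) v) = (\<Sum>i<n. \<Sum>j<n. eul i j * u i * v j)"
    by (intro sum.cong refl) (simp add: E_simple_left sum_distrib_left mult_ac)
  then show ?thesis by (simp add: E_def)
qed

lemma K_expand_left: "K u v = (\<Sum>i<n. u i * (d i * matvec A n v i))"
  unfolding K_Kform Kform_def matvec_def
  by (intro sum.cong refl) (simp add: sum_distrib_left mult_ac)

lemma K_delta [simp]: "K \<delta> v = 0" "K v \<delta> = 0"
proof -
  show "K v \<delta> = 0" by (simp add: K_expand_left delta_null)
  then show "K \<delta> v = 0" by (simp add: K_sym)
qed

lemma E_delta_left: "E \<delta> v = - E v \<delta>"
  using K_delta(1)[of v] by (simp add: K_def)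

lemma E_delta_delta [simp]: "E \<delta> \<delta> = 0"
  using E_delta_left[of \<delta>] by simp

text \<open>The form is a negative combination of squares of differences of the coordinates
  relative to \<open>\<delta>\<close>, so it is positive semidefinite with kernel spanned by \<open>\<delta>\<close>.\<close>

lemma E_squares:
  "E v v = (\<Sum>i<n. \<Sum>j<n. (if i = j then 0 else - (d i * of_int (A i j)) * \<delta> i * \<delta> j / 4) *
     (v i / \<delta> i - v j / \<delta> j)\<^sup>2)"
proof -
  define w where "w i j = d i * of_int (A i j) * \<delta> i * \<delta> j" for i j
  define x where "x i = v i / \<delta> i" for i
  have vx: "v i = \<delta> i * x i" if "i < n" for i using delta_pos[OF that] by (simp add: x_def)
  have w_sym: "w i j = w j i" if "i < n" "j < n" for i j using d_sym[OF that] by (simp add: w_def)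
  have w_row: "(\<Sum>j<n. w i j) = 0" if "i < n" for i
  proof -
    have "(\<Sum>j<n. w i j) = d i * \<delta> i * matvec A n \<delta> i"
      by (simp add: w_def matvec_def sum_distrib_left mult_ac)
    then show ?thesis using that by (simp add: delta_null)
  qed
  have w_col: "(\<Sum>i<n. w i j) = 0" if "j < n" for j
    using w_row[OF that] w_sym[OF that] by simp
  have "K v v = (\<Sum>i<n. \<Sum>j<n. w i j * x i * x j)"
    unfolding K_Kform Kform_def w_def by (intro sum.cong refl) (simp add: vx)
  moreover have "(\<Sum>i<n. \<Sum>j<n. w i j * (x i - x j)\<^sup>2)
      = (\<Sum>i<n. \<Sum>j<n. w i j * (x i)\<^sup>2) + (\<Sum>i<n. \<Sum>j<n. w i j * (x j)\<^sup>2) - 2 * (\<Sum>i<n. \<Sum>j<n. w i j * x i * x j)"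
    by (simp add: power2_diff algebra_simps sum.distrib sum_subtractf sum_distrib_left)
  moreover have "(\<Sum>i<n. \<Sum>j<n. w i j * (x i)\<^sup>2) = 0"
    by (simp add: sum_distrib_right[symmetric] w_row)
  moreover have "(\<Sum>i<n. \<Sum>j<n. w i j * (x j)\<^sup>2) = 0"
    by (subst sum.swap) (simp add: sum_distrib_right[symmetric] w_col)
  ultimately have "4 * E v v = - (\<Sum>i<n. \<Sum>j<n. w i j * (x i - x j)\<^sup>2)"
    by (simp add: K_self)
  then have "E v v = (\<Sum>i<n. \<Sum>j<n. - (w i j / 4) * (x i - x j)\<^sup>2)"
    by (simp add: sum_negf flip: sum_divide_distrib)
  also have "\<dots> = (\<Sum>i<n. \<Sum>j<n. (if i = j then 0 else - (d i * of_int (A i j)) * \<delta> i * \<delta> j / 4) *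
     (v i / \<delta> i - v j / \<delta> j)\<^sup>2)"
    by (intro sum.cong refl) (auto simp: w_def x_def)
  finally show ?thesis .
qed

lemma weight_nonneg:
  "i < n \<Longrightarrow> j < n \<Longrightarrow> (if i = j then 0 else - (d i * of_int (A i j)) * \<delta> i * \<delta> j / 4) \<ge> 0"
  using d_pos[of i] A_off[of i j] delta_pos[of i] delta_pos[of j]
  by (auto simp: mult_le_0_iff zero_le_mult_iff)

lemma E_psd: "E v v \<ge> 0"
  unfolding E_squares by (intro sum_nonneg mult_nonneg_nonneg weight_nonneg) auto

lemma E_edge_bound:
  assumes "i < n" "j < n" "i \<noteq> j" "A i j \<noteq> 0"
  shows "- (d i * of_int (A i j)) * \<delta> i * \<delta> j / 4 * (v i / \<delta> i - v j / \<delta> j)\<^sup>2 \<le> E v v"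
proof -
  let ?t = "\<lambda>i j. (if i = j then 0 else - (d i * of_int (A i j)) * \<delta> i * \<delta> j / 4) *
     (v i / \<delta> i - v j / \<delta> j)\<^sup>2"
  have nn: "?t i j \<ge> 0" if "i < n" "j < n" for i j
    using weight_nonneg[OF that] by (intro mult_nonneg_nonneg) auto
  have "?t i j \<le> (\<Sum>j<n. ?t i j)" using assms nn by (intro member_le_sum) auto
  also have "\<dots> \<le> (\<Sum>i<n. \<Sum>j<n. ?t i j)" using assms nn
    by (intro member_le_sum[of i _ "\<lambda>i. \<Sum>j<n. ?t i j"] sum_nonneg) auto
  finally show ?thesis using assms by (simp add: E_squares)
qed

lemma edge_weight_pos:
  assumes "i < n" "j < n" "i \<noteq> j" "A i j \<noteq> 0"
  shows "- (d i * of_int (A i j)) * \<delta> i * \<delta> j / 4 > 0"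
proof -
  have "A i j < 0" using A_off[OF assms(1-3)] assms(4) by simp
  then have "d i * of_int (A i j) < 0" using d_pos[OF assms(1)] by (simp add: mult_less_0_iff)
  then show ?thesis using delta_pos[OF assms(1)] delta_pos[OF assms(2)]
    by (simp add: mult_less_0_iff zero_less_mult_iff)
qed

text \<open>A set closed along edges and missing a node would be cut off from its complement.
  Statements are spread in this way from \<open>aff\<close>, where coordinates are
  normalized.\<close>

lemma conn_induct:
  assumes "aff \<in> T" and step: "\<And>i j. i \<in> T \<Longrightarrow> i < n \<Longrightarrow> j < n \<Longrightarrow> i \<noteq> j \<Longrightarrow> A i j \<noteq> 0 \<Longrightarrow> j \<in> T"
    and "i < n"
  shows "i \<in> T"
proof (rule ccontr)
  assume "i \<notin> T"
  let ?T = "T \<inter> {..<n}"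
  have "?T \<subseteq> {..<n}" "?T \<noteq> {}" "?T \<noteq> {..<n}" using assms \<open>i \<notin> T\<close> by auto
  then obtain a b where "a \<in> ?T" "b \<in> {..<n} - ?T" "A a b \<noteq> 0"
    using conn unfolding dynkin_connected_def by (metis (no_types, lifting))
  then show False using step[of a b] by auto
qed

text \<open>All squares in \<open>E_squares\<close> vanish, so the ratio
  \<open>v i / \<delta> i\<close> is constant along edges; at \<open>aff\<close> it is
  \<open>v aff\<close>.\<close>

lemma E_zero_imp:
  assumes "supported n v" "E v v = 0"
  shows "v = v aff \<odot> \<delta>"
proof -
  have "i \<in> {i. v i / \<delta> i = v aff}" if "i < n" for i
  proof (rule conn_induct[OF _ _ that])
    show "aff \<in> {i. v i / \<delta> i = v aff}" by simp
  next
    fix i j assume *: "i \<in> {i. v i / \<delta> i = v aff}" "i < n" "j < n" "i \<noteq> j" "A i j \<noteq> 0"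
    define w where "w = - (d i * of_int (A i j)) * \<delta> i * \<delta> j / 4"
    define x where "x = v i / \<delta> i - v j / \<delta> j"
    have "w * x\<^sup>2 \<le> 0" "w > 0"
      using E_edge_bound[OF *(2-5), of v] edge_weight_pos[OF *(2-5)] assms(2) by (auto simp: w_def x_def)
    then have "x = 0" by (simp add: mult_le_0_iff)
    then show "j \<in> {i. v i / \<delta> i = v aff}" using *(1) by (simp add: x_def)
  qed
  note ratio = this
  have *: "v i = v aff * \<delta> i" if "i < n" for i
  proof -
    have "v i / \<delta> i = v aff" "\<delta> i \<noteq> 0"
      using ratio[OF that] delta_pos[OF that] by auto
    then show ?thesis by (simp add: divide_eq_eq)
  qed
  show ?thesis
  proof
    fix i show "v i = (v aff \<odot> \<delta>) i"
      using *[of i] supportedD[OF assms(1), of i] supportedD[OF delta_supp, of i] by (cases "i < n") simp_all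
  qed
qed

lemma E_pos:
  assumes "supported n v" "\<nexists>t. v = t \<odot> \<delta>"
  shows "E v v > 0"
proof (rule ccontr)
  assume "\<not> E v v > 0"
  then have "E v v = 0" using E_psd[of v] by simp
  from E_zero_imp[OF assms(1) this] show False using assms(2) by blast
qed

lemma E_delta_shift: "E (v + m \<odot> \<delta>) (v + m \<odot> \<delta>) = E v v"
  by (simp add: E_linear E_delta_left[of v] algebra_simps)

section \<open>Real roots\<close>

text \<open>Since \<open>E \<beta> \<beta>\<close> is half of \<open>K \<beta> \<beta>\<close>, the
  coefficient is the pairing with the co-root.\<close>

definition rf :: "vec \<Rightarrow> vec \<Rightarrow> vec" where
  "rf \<beta> x = x - (K \<beta> x / E \<beta> \<beta>) \<odot> \<beta>"

lemma refl_rf: "i < n \<Longrightarrow> refl A n i x = rf (simple i) x"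
  using d_pos[of i] by (auto simp: fun_eq_iff refl_def rf_def K_simple simple_apply)

lemma rf_linear: "rf b (x + y) = rf b x + rf b y" "rf b (x - y) = rf b x - rf b y"
  "rf b (- x) = - rf b x" "rf b (a \<odot> x) = a \<odot> rf b x"
  by (auto simp: rf_def K_linear fun_eq_iff algebra_simps add_divide_distrib diff_divide_distrib)

lemma rf_supported: "supported n b \<Longrightarrow> supported n x \<Longrightarrow> supported n (rf b x)"
  by (simp add: rf_def)

lemma rf_delta [simp]: "rf b \<delta> = \<delta>"
  by (simp add: rf_def)

lemma K_rf: "E b b \<noteq> 0 \<Longrightarrow> K (rf b x) (rf b y) = K x y"
  by (simp add: rf_def K_linear K_self K_sym[of x b] divide_simps)

lemma E_rf: "E b b \<noteq> 0 \<Longrightarrow> E (rf b x) (rf b x) = E x x"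
  using K_rf[of b x x] by (simp add: K_self)

lemma rf_self: "E b b \<noteq> 0 \<Longrightarrow> rf b b = - b"
  by (auto simp: rf_def K_self fun_eq_iff)

lemma rf_rf: "E b b \<noteq> 0 \<Longrightarrow> rf b (rf b x) = x"
  by (auto simp: rf_def K_linear K_self fun_eq_iff divide_simps algebra_simps)

lemma rf_conj: "E a a \<noteq> 0 \<Longrightarrow> rf (rf a b) (rf a x) = rf a (rf b x)"
  by (simp add: rf_def[of "rf a b"] rf_def[of b] K_rf E_rf rf_linear)

text \<open>Real roots, as integral vectors of positive norm whose co-root is integral too.\<close>

definition rr :: "vec \<Rightarrow> bool" where
  "rr \<beta> \<longleftrightarrow> supported n \<beta> \<and> (\<forall>i. \<beta> i \<in> \<int>) \<and> E \<beta> \<beta> > 0 \<and> (\<forall>i<n. d i * \<beta> i / E \<beta> \<beta> \<in> \<int>)"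

lemma rrD: assumes "rr b"
  shows "supported n b" "b i \<in> \<int>" "E b b > 0" "E b b \<noteq> 0" "i < n \<Longrightarrow> d i * b i / E b b \<in> \<int>" "b \<noteq> 0"
  using assms by (auto simp: rr_def E_linear)

text \<open>\<open>eul i j\<close> is \<open>d i\<close> times an integer, and the numbers
  \<open>d i * u i / t\<close> are co-root coordinates when \<open>t\<close> is the norm of
  \<open>u\<close>. A free \<open>t\<close> also covers \<delta>, with \<open>t = d aff\<close>, and
  the parts of a root.\<close>

lemma E_int_left:
  assumes "\<And>i. i < n \<Longrightarrow> d i * u i / t \<in> \<int>" "\<And>i. v i \<in> \<int>"
  shows "E u v / t \<in> \<int>"
proof -
  have *: "eul i j * u i * v j / t = (if i = j then 1 else if i < j then of_int (A i j) else 0) * (d i * u i / t) * v j"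
    for i j by (auto simp: eul_def)
  have "E u v / t = (\<Sum>i<n. \<Sum>j<n. eul i j * u i * v j / t)"
    by (simp add: E_def sum_divide_distrib)
  also have "\<dots> \<in> \<int>" unfolding * using assms by (intro Ints_sum Ints_mult) auto
  finally show ?thesis .
qed

lemma E_int_right:
  assumes "\<And>i. i < n \<Longrightarrow> d i * u i / t \<in> \<int>" "\<And>i. v i \<in> \<int>"
  shows "E v u / t \<in> \<int>"
proof -
  have *: "eul i j * v i * u j / t = (if i = j then 1 else if i < j then of_int (A j i) else 0) * (d j * u j / t) * v i"
    if "i < n" "j < n" for i j using d_sym[OF that] by (auto simp: eul_def)
  have "E v u / t = (\<Sum>i<n. \<Sum>j<n. eul i j * v i * u j / t)"
    by (simp add: E_def sum_divide_distrib)
  also have "\<dots> = (\<Sum>i<n. \<Sum>j<n. (if i = j then 1 else if i < j then of_int (A j i) else 0) * (d j * u j / t) * v i)"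
    by (intro sum.cong refl) (simp add: *)
  also have "\<dots> \<in> \<int>" using assms by (intro Ints_sum Ints_mult) auto
  finally show ?thesis .
qed

lemma rr_E_int: assumes "rr b" "\<And>i. v i \<in> \<int>"
  shows "E b v / E b b \<in> \<int>" "E v b / E b b \<in> \<int>" "K b v / E b b \<in> \<int>" "K v b / E b b \<in> \<int>"
proof -
  show 1: "E b v / E b b \<in> \<int>" "E v b / E b b \<in> \<int>"
    using E_int_left[of b "E b b" v] E_int_right[of b "E b b" v] assms rrD(5)[OF assms(1)] by auto
  show "K b v / E b b \<in> \<int>" "K v b / E b b \<in> \<int>"
    using 1 by (auto simp: K_def add_divide_distrib)
qed

lemma rr_rr_int: assumes "rr b" "rr x"
  shows "E b x / E b b \<in> \<int>" "E x b / E b b \<in> \<int>" "K b x / E b b \<in> \<int>" "K x b / E b b \<in> \<int>"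
  using rr_E_int[OF assms(1), of x] rrD(2)[OF assms(2)] by auto

lemma rr_uminus: "rr b \<Longrightarrow> rr (- b)"
  by (auto simp: rr_def E_linear)

lemma rr_simple: "i < n \<Longrightarrow> rr (simple i)"
  using d_pos[of i] by (auto simp: rr_def simple_apply)

lemma rr_rf: assumes "rr b" "rr x" shows "rr (rf b x)"
proof -
  have "rf b x i \<in> \<int>" for i
    using Ints_mult[OF rr_rr_int(3)[OF assms] rrD(2)[OF assms(1), of i]] rrD(2)[OF assms(2), of i]
    by (simp add: rf_def)
  moreover have "d i * rf b x i / E x x \<in> \<int>" if "i < n" for i
  proof -
    have "d i * rf b x i / E x x = d i * x i / E x x - (K b x / E x x) * (d i * b i / E b b)"
      by (simp add: rf_def algebra_simps diff_divide_distrib)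
    also have "\<dots> \<in> \<int>"
      using rr_rr_int(4)[OF assms(2,1)] rrD(5)[OF assms(1) that] rrD(5)[OF assms(2) that]
      by (intro Ints_diff Ints_mult) auto
    finally show ?thesis .
  qed
  ultimately show ?thesis using assms rrD[OF assms(1)] rrD[OF assms(2)]
    by (auto simp: rr_def E_rf rf_supported)
qed

text \<open>The positive and negative parts of a root \<open>\<beta>\<close> have norms that are multiples of the norm
  of \<open>\<beta>\<close>, because \<open>\<beta>\<close> and its co-root are both integral; and these norms add up to at most
  the norm of \<open>\<beta>\<close>.\<close>

lemma rr_pos_or_neg:
  assumes "rr b" shows "pos b \<or> pos (- b)"
proof (rule ccontr)
  assume nn: "\<not> (pos b \<or> pos (- b))"
  define P :: vec where "P = (\<lambda>i. max (b i) 0)"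
  define N :: vec where "N = (\<lambda>i. max (- b i) 0)"
  have supp: "supported n P" "supported n N"
    using rrD(1)[OF assms] by (auto simp: P_def N_def supported_def)
  have b: "b = P - N" by (auto simp: P_def N_def fun_eq_iff max_def)
  obtain k l where kl: "b k > 0" "b l < 0" using nn by (auto simp: pos_def not_le)
  then have kln: "k < n" "l < n" using supportedD[OF rrD(1)[OF assms]] by force+
  have PN: "K P N \<le> 0" unfolding K_Kform Kform_def
  proof (intro sum_nonpos)
    fix i j assume "i \<in> {..<n}" "j \<in> {..<n}"
    then have *: "d i * of_int (A i j) \<le> 0 \<or> i = j"
      using d_pos[of i] A_off[of i j] by (auto simp: mult_le_0_iff)
    have "P i \<ge> 0" "N j \<ge> 0" "i = j \<Longrightarrow> P i * N j = 0" by (auto simp: P_def N_def max_def)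
    then show "d i * of_int (A i j) * P i * N j \<le> 0"
      using * by (cases "i = j") (auto simp: mult_le_0_iff mult.assoc zero_le_mult_iff)
  qed
  have "E X X \<ge> E b b" if "X = P \<or> X = N" for X
  proof -
    have X: "supported n X" "\<exists>p<n. X p > 0" "\<exists>p<n. X p = 0" "\<And>i. X i \<in> \<int>"
      "\<And>i. i < n \<Longrightarrow> d i * X i / E b b \<in> \<int>"
    proof -
      have "P k > 0" "P l = 0" "N l > 0" "N k = 0" using kl by (auto simp: P_def N_def)
      then show "supported n X" "\<exists>p<n. X p > 0" "\<exists>p<n. X p = 0" using that kln supp by metis+
      show "X i \<in> \<int>" for i using that rrD(2)[OF assms, of i] by (auto simp: P_def N_def max_def)
      show "d i * X i / E b b \<in> \<int>" if "i < n" for i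
        using \<open>X = P \<or> X = N\<close> rrD(5)[OF assms that] by (auto simp: P_def N_def max_def)
    qed
    have "\<nexists>t. X = t \<odot> \<delta>"
    proof
      assume "\<exists>t. X = t \<odot> \<delta>"
      then obtain t where "X = t \<odot> \<delta>" by blast
      then show False using X(2,3) delta_pos by (metis less_irrefl mult_eq_0_iff sm_apply)
    qed
    then have "E X X > 0" using E_pos X(1) by blast
    then have 1: "E X X / E b b > 0" using rrD(3)[OF assms] by simp
    moreover have "E X X / E b b \<in> \<int>" using E_int_left X by blast
    ultimately have "E X X / E b b \<ge> 1" by (auto elim!: Ints_cases)
    then show ?thesis using rrD(3)[OF assms] by (simp add: divide_simps)
  qed
  then have "E P P \<ge> E b b" "E N N \<ge> E b b" by auto
  moreover have "E b b = E P P + E N N - K P N" by (simp add: b E_linear K_def)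
  ultimately show False using PN rrD(3)[OF assms] by linarith
qed

lemma rr_not_pos: "rr b \<Longrightarrow> \<not> pos b \<longleftrightarrow> pos (- b)"
  using rr_pos_or_neg pos_neg_eq_0 rrD(6) by blast

text \<open>The reflection alters only coordinate \<open>i\<close>, so the other coordinates of
  \<open>b\<close> vanish. The remaining one and its reciprocal, a co-root coordinate, are both
  integral, hence 1.\<close>

lemma rr_simple_neg:
  assumes "rr b" "pos b" "i < n" "\<not> pos (rf (simple i) b)"
  shows "b = simple i"
proof -
  have "pos (- rf (simple i) b)" using assms rr_rf rr_simple rr_not_pos by blast
  then have *: "b k = 0" if "k \<noteq> i" for k
    using posD[OF assms(2), of k] posD[of "- rf (simple i) b" k] that by (simp add: rf_def simple_apply)
  then have b: "b = b i \<odot> simple i" by (auto simp: fun_eq_iff simple_apply)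
  have e: "E b b = b i * b i * d i" by (subst (1 2) b) (simp add: E_linear assms(3))
  have nz: "b i > 0" using assms(1,2) b rrD(3)[OF assms(1)] posD[OF assms(2), of i] e by (cases "b i = 0") auto
  have "1 / b i = d i * b i / E b b" using nz d_pos[OF assms(3)] by (simp add: e)
  then have "1 / b i \<in> \<int>" using rrD(5)[OF assms(1,3)] by simp
  moreover have "b i \<in> \<int>" using rrD(2)[OF assms(1)] .
  ultimately obtain k l :: int where kl: "b i = of_int k" "1 / b i = of_int l" by (auto elim!: Ints_cases)
  then have "of_int (k * l) = (1::real)" using nz by (simp add: field_simps)
  then have "k * l = 1" by linarith
  then have "k = 1" using kl(1) nz by (auto simp: zmult_eq_1_iff)
  then show ?thesis using b kl by simp
qed

text \<open>\<open>K b b > 0\<close> is the combination of the numbers \<open>K (simple i) b\<close>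
  with the nonnegative coefficients \<open>b i\<close>.\<close>

lemma rr_descent:
  assumes "rr b" "pos b"
  shows "\<exists>i<n. b i > 0 \<and> K (simple i) b > 0"
proof (rule ccontr)
  assume *: "\<not> ?thesis"
  have "K b b = (\<Sum>i<n. b i * K (simple i) b)" 
    unfolding K_expand_left[of b] by (intro sum.cong refl) (simp add: K_simple)
  also have "\<dots> \<le> 0"
  proof (rule sum_nonpos)
    fix i assume "i \<in> {..<n}"
    then show "b i * K (simple i) b \<le> 0"
      using * posD[OF assms(2), of i] by (cases "b i = 0") (force simp: mult_le_0_iff)+
  qed
  finally show False using rrD(3)[OF assms(1)] by (simp add: K_self)
qed

section \<open>Words in the simple reflections\<close>

abbreviation W :: "nat list \<Rightarrow> vec \<Rightarrow> vec" where "W \<equiv> weyl_word A n"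

lemma W_Nil [simp]: "W [] x = x" and W_append: "W (us @ ws) x = W us (W ws x)"
  by (auto simp: weyl_word_def)

lemma W_Cons [simp]: "i < n \<Longrightarrow> W (i # ws) x = rf (simple i) (W ws x)"
  by (simp add: weyl_word_def refl_rf)

lemma simple_norm [simp]: "i < n \<Longrightarrow> E (simple i) (simple i) \<noteq> 0"
  using d_pos[of i] by simp

lemma W_facts:
  assumes "set ws \<subseteq> {..<n}"
  shows W_add: "W ws (x + y) = W ws x + W ws y" and W_sm: "W ws (t \<odot> x) = t \<odot> W ws x"
    and W_minus: "W ws (- x) = - W ws x" and W_delta: "W ws \<delta> = \<delta>"
    and K_W: "K (W ws x) (W ws y) = K x y" and E_W: "E (W ws x) (W ws x) = E x x"
    and rr_W: "rr x \<Longrightarrow> rr (W ws x)" and W_rev: "W (rev ws) (W ws x) = x"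
    and W_supp: "supported n x \<Longrightarrow> supported n (W ws x)"
    and W_conj: "W ws (rf b x) = rf (W ws b) (W ws x)"
  using assms
  by (induction ws arbitrary: x y)
    (simp_all add: rf_linear K_rf E_rf rr_rf rr_simple W_append rf_rf rf_supported rf_conj
      del: E_simple_simple)

lemma W_diff: "set ws \<subseteq> {..<n} \<Longrightarrow> W ws (x - y) = W ws x - W ws y"
  using W_add[of ws x "- y"] W_minus[of ws y] by simp

lemma W_rev': "set ws \<subseteq> {..<n} \<Longrightarrow> W ws (W (rev ws) x) = x"
  using W_rev[of "rev ws" x] by simp

text \<open>Descent on the height. The reflections used stay in the support of \<open>b\<close>;
  this bound on the letters later keeps the word of \<open>\<delta> - simple aff\<close> inside the
  finite diagram.\<close>

lemma rr_word:
  assumes "rr b" "pos b"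
  shows "\<exists>ws k. set ws \<subseteq> {i. i < n \<and> b i \<noteq> 0} \<and> k < n \<and> b k \<noteq> 0 \<and> b = W ws (simple k)"
proof -
  have "\<exists>ws k. set ws \<subseteq> {i. i < n \<and> b i \<noteq> 0} \<and> k < n \<and> b k \<noteq> 0 \<and> b = W ws (simple k)"
    if "rr b" "pos b" "height n b \<le> real N" for N b
    using that
  proof (induction N arbitrary: b)
    case 0
    then show ?case using height_pos[of b n] rrD(1,6)[of b] by simp
  next
    case (Suc N)
    obtain i where i: "i < n" "b i > 0" "K (simple i) b > 0" using rr_descent Suc.prems by blast
    let ?b = "rf (simple i) b"
    show ?case
    proof (cases "pos ?b")
      case False
      then have "b = simple i" using rr_simple_neg Suc.prems i by blast
      then show ?thesis using i by (intro exI[of _ "[]"] exI[of _ i]) auto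
    next
      case True
      have rb: "rr ?b" using rr_rf rr_simple i Suc.prems by blast
      have "K (simple i) b / d i \<in> \<int>" using rr_E_int(3)[OF rr_simple[OF i(1)], of b] rrD(2)[OF Suc.prems(1)] i by simp
      moreover have "K (simple i) b / d i > 0" using i d_pos by simp
      ultimately have ge: "K (simple i) b / d i \<ge> 1" by (auto elim!: Ints_cases)
      have hs: "height n (simple i) = 1" using i by (simp add: height_def simple_apply)
      have "height n ?b = height n b - K (simple i) b / d i"
        using i hs by (simp add: rf_def height_linear)
      then have "height n ?b \<le> real N" using ge Suc.prems by simp
      then obtain ws k where w: "set ws \<subseteq> {i. i < n \<and> ?b i \<noteq> 0}" "k < n" "?b k \<noteq> 0" "?b = W ws (simple k)"
        using Suc.IH[OF rb True] by blast
      have "b j \<noteq> 0" if "?b j \<noteq> 0" for j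
        using that i by (cases "j = i") (auto simp: rf_def simple_apply)
      moreover have "b = W (i # ws) (simple k)" using w(4) i by (simp flip: w(4)) (simp add: rf_rf del: E_simple_simple)
      ultimately show ?thesis using w i by (intro exI[of _ "i # ws"] exI[of _ k]) auto
    qed
  qed
  moreover obtain N :: nat where "height n b \<le> real N" using real_arch_simple by blast
  ultimately show ?thesis using assms by blast
qed

lemma rr_norm: assumes "rr b" shows "\<exists>k<n. E b b = d k"
proof -
  obtain b' where b': "rr b'" "pos b'" "E b' b' = E b b"
    using rr_pos_or_neg[OF assms] assms rr_uminus[OF assms] by (metis E_linear(7,8) minus_minus)
  obtain ws k where *: "set ws \<subseteq> {i. i < n \<and> b' i \<noteq> 0}" "k < n" "b' = W ws (simple k)"
    using rr_word[OF b'(1,2)] by blast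
  moreover have "set ws \<subseteq> {..<n}" using *(1) by auto
  ultimately show ?thesis using b'(3) E_W[of ws "simple k"] by auto
qed

lemma rr_real_roots: "real_roots A n = {b. rr b}"
proof
  show "real_roots A n \<subseteq> {b. rr b}"
    by (auto simp: real_roots_def intro: rr_W rr_simple)
  show "{b. rr b} \<subseteq> real_roots A n"
  proof
    fix b assume "b \<in> {b. rr b}"
    then have b: "rr b" by simp
    show "b \<in> real_roots A n"
    proof (cases "pos b")
      case True
      from rr_word[OF b True] show ?thesis unfolding real_roots_def by blast
    next
      case False
      then obtain ws k where w: "set ws \<subseteq> {i. i < n \<and> (- b) i \<noteq> 0}" "k < n" "- b = W ws (simple k)"
        using rr_word[of "- b"] rr_not_pos[OF b] rr_uminus[OF b] by blast
      then have ws: "set ws \<subseteq> {..<n}" by auto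
      have "b = - W ws (simple k)" using w(3) by (metis minus_minus)
      \<comment> \<open>One more letter \<open>k\<close> supplies the sign, since the reflection in
        \<open>simple k\<close> negates it.\<close>
      also have "\<dots> = W (ws @ [k]) (simple k)"
        using w(2) ws by (simp add: W_append rf_self W_minus del: E_simple_simple)
      finally show ?thesis using ws w(2) unfolding real_roots_def
        by (intro CollectI exI[of _ "ws @ [k]"] exI[of _ k]) auto
    qed
  qed
qed

text \<open>Carried to the line of a simple root by a word, the multiple becomes a positive root
  that the reflection in \<open>simple k\<close> makes negative, so \<open>rr_simple_neg\<close>
  applies.\<close>

lemma rr_multiple:
  assumes "rr b" "rr (t \<odot> b)" "pos b" "t \<ge> 0" shows "t = 1"
proof -
  obtain ws k where w: "set ws \<subseteq> {i. i < n \<and> b i \<noteq> 0}" "k < n" "b = W ws (simple k)"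
    using rr_word[OF assms(1,3)] by blast
  then have ws: "set ws \<subseteq> {..<n}" by auto
  then have "W (rev ws) (t \<odot> b) = t \<odot> simple k" using w(3) by (simp add: W_sm W_rev)
  then have r: "rr (t \<odot> simple k)" using rr_W[of "rev ws" "t \<odot> b"] ws assms(2) by simp
  have "t \<noteq> 0" using rrD(6)[OF assms(2)] by auto
  have "\<not> pos (rf (simple k) (t \<odot> simple k))"
    using w(2) assms(4) \<open>t \<noteq> 0\<close> by (auto simp: rf_linear rf_self pos_def simple_apply intro!: exI[of _ k] simp del: E_simple_simple)
  then have "t \<odot> simple k = simple k" using rr_simple_neg[OF r _ w(2)] assms(4) by (simp add: pos_sm)
  then have "(t \<odot> simple k) k = simple k k" by simp
  then show ?thesis by (simp add: simple_apply)
qed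

section \<open>Finiteness modulo the imaginary root\<close>

text \<open>The co-root of the sum is that of \<open>b\<close> plus \<open>m * d aff / E b b\<close>
  times the dual imaginary root, which is integral by \<open>delta_vee_int\<close>.\<close>

lemma rr_shift:
  assumes "rr b" "m \<in> \<int>" "m * d aff / E b b \<in> \<int>" shows "rr (b + m \<odot> \<delta>)"
proof -
  have "d i * (b + m \<odot> \<delta>) i / E b b \<in> \<int>" if "i < n" for i
  proof -
    have "d i * (b + m \<odot> \<delta>) i / E b b = d i * b i / E b b + (m * d aff / E b b) * (d i * \<delta> i / d aff)"
      using d_pos[of aff] rrD(3)[OF assms(1)] by (simp add: field_simps)
    also have "\<dots> \<in> \<int>" using rrD(5)[OF assms(1) that] assms(3) delta_vee_int[OF that] by (intro Ints_add Ints_mult)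
    finally show ?thesis .
  qed
  then show ?thesis using rrD[OF assms(1)] assms(2) delta_int by (auto simp: rr_def E_delta_shift)
qed

definition bar :: "vec \<Rightarrow> vec" where "bar b = b - b aff \<odot> \<delta>"

text \<open>The shift by \<open>- b aff\<close> is admissible because
  \<open>d aff * b aff / E b b\<close> is the co-root coordinate at \<open>aff\<close>.\<close>

lemma rr_bar: assumes "rr b" shows "rr (bar b)"
proof -
  have "rr (b + (- b aff) \<odot> \<delta>)"
  proof (rule rr_shift[OF assms])
    show "- b aff \<in> \<int>" using rrD(2)[OF assms] by simp
    have "- (d aff * b aff / E b b) \<in> \<int>" using rrD(5)[OF assms aff_less] by (simp only: Ints_minus)
    then show "- b aff * d aff / E b b \<in> \<int>" by (simp add: mult.commute)
  qed
  moreover have "b + (- b aff) \<odot> \<delta> = bar b" by (auto simp: bar_def fun_eq_iff)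
  ultimately show ?thesis by simp
qed

lemma bar_aff [simp]: "bar b aff = 0"
  by (simp add: bar_def)

text \<open>Bounds spread from \<open>aff\<close>, where the coordinate is 0: across an edge, the
  difference of the ratios \<open>v i / \<delta> i\<close> is controlled by one square in
  \<open>E_squares\<close>.\<close>

lemma coord_bound:
  assumes "i < n" shows "\<exists>c. \<forall>v. v aff = 0 \<and> E v v \<le> B \<longrightarrow> \<bar>v i\<bar> \<le> c"
proof -
  have "i \<in> {i. \<exists>c. \<forall>v. v aff = 0 \<and> E v v \<le> B \<longrightarrow> \<bar>v i / \<delta> i\<bar> \<le> c}"
  proof (rule conn_induct[OF _ _ assms])
    show "aff \<in> {i. \<exists>c. \<forall>v. v aff = 0 \<and> E v v \<le> B \<longrightarrow> \<bar>v i / \<delta> i\<bar> \<le> c}" by (auto intro!: exI[of _ 0])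
  next
    fix i j assume *: "i \<in> {i. \<exists>c. \<forall>v. v aff = 0 \<and> E v v \<le> B \<longrightarrow> \<bar>v i / \<delta> i\<bar> \<le> c}"
      "i < n" "j < n" "i \<noteq> j" "A i j \<noteq> 0"
    then obtain c where c: "\<And>v. v aff = 0 \<Longrightarrow> E v v \<le> B \<Longrightarrow> \<bar>v i / \<delta> i\<bar> \<le> c" by blast
    define w where "w = - (d i * of_int (A i j)) * \<delta> i * \<delta> j / 4"
    have w: "w > 0" using edge_weight_pos[OF *(2-5)] by (simp add: w_def)
    have "\<bar>v j / \<delta> j\<bar> \<le> c + sqrt (B / w)" if "v aff = 0" "E v v \<le> B" for v
    proof -
      have "w * (v i / \<delta> i - v j / \<delta> j)\<^sup>2 \<le> B"
        using E_edge_bound[OF *(2-5), of v] that(2) by (simp add: w_def)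
      then have "(v i / \<delta> i - v j / \<delta> j)\<^sup>2 \<le> B / w" using w by (simp add: field_simps)
      then have "\<bar>v i / \<delta> i - v j / \<delta> j\<bar> \<le> sqrt (B / w)" using real_le_rsqrt by fastforce
      then show ?thesis using c[OF that] by linarith
    qed
    then show "j \<in> {i. \<exists>c. \<forall>v. v aff = 0 \<and> E v v \<le> B \<longrightarrow> \<bar>v i / \<delta> i\<bar> \<le> c}" by blast
  qed
  then obtain c where c: "\<And>v. v aff = 0 \<Longrightarrow> E v v \<le> B \<Longrightarrow> \<bar>v i / \<delta> i\<bar> \<le> c" by blast
  have "\<bar>v i\<bar> \<le> c * \<delta> i" if "v aff = 0" "E v v \<le> B" for v
    using c[OF that] delta_pos[OF assms] by (simp add: divide_simps abs_divide)
  then show ?thesis by blast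
qed

lemma finite_rr_fin: "finite {b. rr b \<and> b aff = 0}"
proof -
  \<comment> \<open>By \<open>rr_norm\<close> every norm is some \<open>d k\<close>, so this bounds
    all of them.\<close>
  define B where "B = (\<Sum>i<n. d i)"
  have "\<forall>i. \<exists>c. i < n \<longrightarrow> (\<forall>v. v aff = 0 \<and> E v v \<le> B \<longrightarrow> \<bar>v i\<bar> \<le> c)"
    using coord_bound by blast
  then obtain c where c: "\<And>i v. i < n \<Longrightarrow> v aff = 0 \<Longrightarrow> E v v \<le> B \<Longrightarrow> \<bar>v i\<bar> \<le> c i" by metis
  define C where "C = Max (c ` {..<n})"
  have cC: "c i \<le> C" if "i < n" for i using that by (auto simp: C_def)
  have "{b. rr b \<and> b aff = 0} \<subseteq> {f. \<forall>x. (x \<in> {..<n} \<longrightarrow> f x \<in> {k \<in> \<int>. \<bar>k\<bar> \<le> C}) \<and> (x \<notin> {..<n} \<longrightarrow> f x = 0)}"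
  proof
    fix b assume "b \<in> {b. rr b \<and> b aff = 0}"
    then have b: "rr b" "b aff = 0" by auto
    obtain k where k: "k < n" "E b b = d k" using rr_norm[OF b(1)] by blast
    have "d k \<le> B" unfolding B_def using k d_pos by (intro member_le_sum) (auto intro: less_imp_le)
    then have "\<bar>b i\<bar> \<le> C" if "i < n" for i using c[of i b] b(2) cC[OF that] k that by force
    then show "b \<in> {f. \<forall>x. (x \<in> {..<n} \<longrightarrow> f x \<in> {k \<in> \<int>. \<bar>k\<bar> \<le> C}) \<and> (x \<notin> {..<n} \<longrightarrow> f x = 0)}"
      using rrD(1,2)[OF b(1)] by (auto simp: supported_def)
  qed
  moreover have "finite \<dots>" by (rule finite_set_of_finite_funs) (auto intro: finite_abs_int_segment)
  ultimately show ?thesis by (rule finite_subset)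
qed

section \<open>The Coxeter element\<close>

abbreviation c :: "vec \<Rightarrow> vec" where "c \<equiv> cox A n"
abbreviation ci :: "vec \<Rightarrow> vec" where "ci \<equiv> coxinv A n"

lemma cox_W: "c x = W [0..<n] x"
  by (simp add: cox_def weyl_word_def)

lemma coxinv_W: "ci x = W (rev [0..<n]) x"
  by (simp add: coxinv_def weyl_word_def foldr_conv_foldl)

lemma upt_sub [simp]: "set [0..<n] \<subseteq> {..<n}" "set (rev [0..<n]) \<subseteq> {..<n}"
  by auto

lemma c_ci [simp]: "c (ci x) = x" and ci_c [simp]: "ci (c x) = x"
  unfolding cox_W coxinv_W by (rule W_rev' W_rev, rule upt_sub)+

lemma c_linear: "c (x + y) = c x + c y" "c (x - y) = c x - c y" "c (- x) = - c x" "c (t \<odot> x) = t \<odot> c x"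
  unfolding cox_W by (rule W_add W_diff W_minus W_sm, rule upt_sub)+

lemma c_delta [simp]: "c \<delta> = \<delta>" and ci_delta [simp]: "ci \<delta> = \<delta>"
  unfolding cox_W coxinv_W by (rule W_delta, rule upt_sub)+

lemma rr_c: "rr x \<Longrightarrow> rr (c x)" and rr_ci: "rr x \<Longrightarrow> rr (ci x)"
  unfolding cox_W coxinv_W by (rule rr_W, rule upt_sub, assumption)+

lemma supp_c: "supported n x \<Longrightarrow> supported n (c x)"
  unfolding cox_W by (rule W_supp, rule upt_sub, assumption)

lemma W_other: "j \<notin> set ws \<Longrightarrow> W ws x j = x j"
  by (induction ws arbitrary: x) (auto simp: weyl_word_def refl_def)

lemma cox_tail:
  assumes "k \<le> j" "k \<le> n" shows "c x j = W [k..<n] x j"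
proof -
  have "[0..<n] = [0..<k] @ [k..<n]"
    using assms(2) by (metis le_add_diff_inverse plus_nat.add_0 upt_add_eq_append zero_le)
  then show ?thesis using assms(1) by (simp add: cox_W W_append W_other)
qed

text \<open>Only the factor \<open>k\<close> of \<open>c\<close> changes coordinate
  \<open>k\<close>. When it acts, the coordinates above \<open>k\<close> already have their final
  values, while those up to \<open>k\<close> are still the old ones.\<close>

lemma cox_coord:
  assumes "k < n"
  shows "c x k = x k - matvec A n (\<lambda>j. if j \<le> k then x j else c x j) k"
proof -
  let ?y = "W [Suc k..<n] x"
  have "c x k = W [k..<n] x k" using assms by (intro cox_tail) auto
  also have "\<dots> = ?y k - matvec A n ?y k"
    using assms by (simp add: upt_conv_Cons weyl_word_def refl_def)
  also have "?y k = x k" by (rule W_other) auto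
  also have "matvec A n ?y k = matvec A n (\<lambda>j. if j \<le> k then x j else c x j) k"
    unfolding matvec_def
  proof (intro sum.cong refl)
    fix j assume "j \<in> {..<n}"
    then show "real_of_int (A k j) * ?y j = real_of_int (A k j) * (if j \<le> k then x j else c x j)"
      using W_other[of j "[Suc k..<n]" x] cox_tail[of "Suc k" j x] assms by auto
  qed
  finally show ?thesis .
qed

text \<open>In \<open>cox_coord\<close> multiplied by \<open>d k\<close>, the new coordinates meet
  the entries \<open>eul k j\<close> and the old ones the entries \<open>eul j k\<close>: the
  factorization of \<open>c\<close> and the triangular splitting of \<open>K\<close> match.\<close>

lemma E_simple_cox: assumes k: "k < n" shows "E (simple k) (c x) = - E x (simple k)"
proof -
  let ?y = "\<lambda>j. if j \<le> k then x j else c x j"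
  have 1: "(\<Sum>j<n. eul k j * ?y j) = (\<Sum>j<n. eul k j * c x j) + d k * (x k - c x k)"
  proof -
    have "(\<Sum>j<n. eul k j * ?y j) = (\<Sum>j<n. eul k j * c x j + (if j = k then d k * (x k - c x k) else 0))"
      by (intro sum.cong refl) (auto simp: eul_def algebra_simps)
    then show ?thesis using k by (simp add: sum.distrib)
  qed
  have 2: "(\<Sum>j<n. eul j k * ?y j) = (\<Sum>j<n. eul j k * x j)"
    by (intro sum.cong refl) (auto simp: eul_def)
  have "d k * matvec A n ?y k = (\<Sum>j<n. (eul k j + eul j k) * ?y j)"
    unfolding matvec_def sum_distrib_left by (intro sum.cong refl) (simp add: eul_sym k)
  also have "\<dots> = (\<Sum>j<n. eul k j * ?y j) + (\<Sum>j<n. eul j k * ?y j)"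
    by (simp only: distrib_right sum.distrib)
  finally have "d k * matvec A n ?y k = (\<Sum>j<n. eul k j * c x j) + d k * (x k - c x k) + (\<Sum>j<n. eul j k * x j)"
    unfolding 1 2 .
  moreover have "d k * c x k = d k * x k - d k * matvec A n ?y k"
    using arg_cong[OF cox_coord[OF k, of x], of "(*) (d k)"] by (simp only: right_diff_distrib)
  ultimately show ?thesis by (simp add: E_simple_left E_simple_right k algebra_simps)
qed

lemma E_expand_right: "E v u = (\<Sum>i<n. u i * E v (simple i))"
proof -
  have "(\<Sum>i<n. u i * E v (simple i)) = (\<Sum>i<n. \<Sum>j<n. eul j i * v j * u i)"
    by (intro sum.cong refl) (simp add: E_simple_right sum_distrib_left mult_ac)
  also have "\<dots> = E v u" unfolding E_def by (rule sum.swap)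
  finally show ?thesis by simp
qed

lemma E_cox: "E a (c b) = - E b a"
  unfolding E_expand_left[of a] E_expand_right[of b a] sum_negf[symmetric]
  by (intro sum.cong refl) (simp add: E_simple_cox)

lemma E_c_c [simp]: "E (c a) (c b) = E a b"
  by (simp add: E_cox)

lemma E_ci_right: "E a (ci b) = E (c a) b"
  using E_c_c[of a "ci b"] by simp

lemma K_c: "K a b = E a b - E a (c b)"
  by (simp add: K_def E_cox)

lemma E_c_delta [simp]: "E (c a) \<delta> = E a \<delta>" "E (ci a) \<delta> = E a \<delta>"
  using E_c_c[of a \<delta>] E_c_c[of "ci a" \<delta>] by auto

text \<open>\<open>K_c\<close> turns invariance under \<open>c\<close> into
  \<open>K v v = 0\<close>.\<close>

lemma c_fixed: assumes "supported n v" "c v = v" shows "v = v aff \<odot> \<delta>"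
  using K_c[of v v] assms E_zero_imp[of v] by (simp add: K_self)

abbreviation cp :: "nat \<Rightarrow> vec \<Rightarrow> vec" where "cp i \<equiv> c ^^ i"

lemma cp_linear: "cp i (x + y) = cp i x + cp i y" "cp i (x - y) = cp i x - cp i y"
  "cp i (- x) = - cp i x" "cp i (t \<odot> x) = t \<odot> cp i x"
  by (induction i) (simp_all add: c_linear)

lemma cp_delta [simp]: "cp i \<delta> = \<delta>"
  by (induction i) simp_all

lemma rr_cp: "rr x \<Longrightarrow> rr (cp i x)"
  by (induction i) (simp_all add: rr_c)

lemma rr_cipow: "rr x \<Longrightarrow> rr ((ci ^^ i) x)"
  by (induction i) (simp_all add: rr_ci)

lemma E_cp [simp]: "E (cp i x) (cp i y) = E x y"
  by (induction i) simp_all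

lemma E_cp_delta [simp]: "E (cp i x) \<delta> = E x \<delta>"
  using E_cp[of i x \<delta>] by simp

lemma cp_inj: "cp i x = cp i y \<longleftrightarrow> x = y"
proof -
  have "inj c" by (metis ci_c injI)
  then show ?thesis by (meson inj_def inj_fn)
qed

lemma c_inj: "c x = c y \<longleftrightarrow> x = y"
  by (metis ci_c)

lemma cp_cipow [simp]: "cp i ((ci ^^ i) x) = x"
  by (induction i arbitrary: x) (simp_all add: funpow_swap1)

lemma c_0 [simp]: "c 0 = 0"
  using c_linear(4)[of 0 0] by simp

lemma c_sum: "c (\<Sum>x\<in>S. f x) = (\<Sum>x\<in>S. c (f x))"
  by (induction S rule: infinite_finite_induct)
    (simp_all only: sum.infinite sum.empty sum.insert c_linear c_0 not_False_eq_True)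

section \<open>Positive roots made negative by the Coxeter element\<close>

text \<open>At the largest index whose suffix of \<open>c\<close> makes \<open>b\<close> negative, a
  single reflection turns a positive root negative, so that root is simple. All suffixes are treated
  because \<tau>_c is sensitive to the intermediate vectors.\<close>

lemma first_negative:
  assumes "rr b" "pos b" "m \<le> n" "\<not> pos (W [m..<n] b)"
  shows "\<exists>k<n. W [Suc k..<n] b = simple k \<and> m \<le> k \<and> (\<forall>l. k < l \<and> l \<le> n \<longrightarrow> pos (W [l..<n] b))"
proof -
  define X where "X = {l. l \<le> n \<and> \<not> pos (W [l..<n] b)}"
  have X: "finite X" "m \<in> X" using assms by (auto simp: X_def)
  define k where "k = Max X"
  have kX: "k \<in> X" unfolding k_def using X by (intro Max_in) auto
  have "k \<noteq> n" using kX assms(2) by (auto simp: X_def)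
  then have kn: "k < n" using kX by (auto simp: X_def)
  have big: "pos (W [l..<n] b)" if "k < l" "l \<le> n" for l
  proof (rule ccontr)
    assume "\<not> ?thesis"
    then have "l \<in> X" using that by (simp add: X_def)
    then have "l \<le> k" unfolding k_def using X by simp
    then show False using that by simp
  qed
  have "rr (W [Suc k..<n] b)" using assms(1) by (intro rr_W) auto
  moreover have "\<not> pos (rf (simple k) (W [Suc k..<n] b))" using kX kn by (simp add: X_def upt_conv_Cons)
  ultimately have "W [Suc k..<n] b = simple k" using rr_simple_neg big[of "Suc k"] kn by simp
  then show ?thesis using kn big X(1,2) by (auto simp: k_def)
qed

text \<open>These are the inversions of \<open>c\<close>, the positive roots that it makes negative.
  By \<open>yroot_E\<close> they form, up to the factors \<open>d k\<close>, the basis dual to the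
  simple roots for \<open>E\<close>; in quiver language, the dimension vectors of the indecomposable
  projectives.\<close>

definition yroot :: "nat \<Rightarrow> vec \<Rightarrow> bool" where
  "yroot k b \<longleftrightarrow> k < n \<and> W [Suc k..<n] b = simple k"

text \<open>\<open>b\<close> has no coordinates below \<open>k\<close>, and \<open>c b\<close> has
  none above \<open>k\<close>. In \<open>E v (c b)\<close>, the terms with \<open>j < k\<close> are
  moved to \<open>b\<close> by \<open>E_simple_cox\<close> and the others are read off
  \<open>c b\<close>; triangularity leaves only \<open>j = k\<close>.\<close>

lemma yroot_facts:
  assumes "yroot k b"
  shows yroot_E: "E b v = d k * v k" and yroot_coord: "b k = 1"
    and yroot_c: "c b = - W [0..<k] (simple k)" and yroot_rr: "rr b" and yroot_pos: "pos b"
    and yroot_less: "k < n" and yroot_c_neg: "\<not> pos (c b)"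
proof -
  have k: "k < n" and w: "W [Suc k..<n] b = simple k" using assms by (auto simp: yroot_def)
  have s: "set [Suc k..<n] \<subseteq> {..<n}" "set (rev [Suc k..<n]) \<subseteq> {..<n}" "set [0..<k] \<subseteq> {..<n}" using k by auto
  show "k < n" by fact
  have b: "b = W (rev [Suc k..<n]) (simple k)" using w W_rev[OF s(1), of b] by simp
  show rb: "rr b" unfolding b using s k by (intro rr_W rr_simple) auto
  have lo: "b j = simple k j" if "j \<le> k" for j
    unfolding w[symmetric] using that by (intro W_other[symmetric]) auto
  then show bk: "b k = 1" by (simp add: simple_apply)
  have "[0..<n] = [0..<k] @ k # [Suc k..<n]"
    using k by (metis less_imp_le_nat upt_conv_Cons le_add_diff_inverse plus_nat.add_0 upt_add_eq_append zero_le)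
  then have "c b = W [0..<k] (rf (simple k) (simple k))" using k by (simp add: cox_W W_append w)
  then show cb: "c b = - W [0..<k] (simple k)" using k s by (simp add: rf_self W_minus del: E_simple_simple)
  have hi: "c b j = - simple k j" if "k \<le> j" for j
    using that by (simp add: cb W_other)
  then have ck: "c b k = -1" by (simp add: simple_apply)
  show "\<not> pos (c b)" using ck by (auto simp: pos_def intro!: exI[of _ k])
  have "\<not> pos (- b)" using bk by (auto simp: pos_def intro!: exI[of _ k])
  then show "pos b" using rr_pos_or_neg[OF rb] by blast
  have "E v (c b) = (\<Sum>j<n. if j = k then - (d k * v k) else 0)"
    unfolding E_expand_left[of v]
  proof (intro sum.cong refl)
    fix j assume j: "j \<in> {..<n}"
    show "v j * E (simple j) (c b) = (if j = k then - (d k * v k) else 0)"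
    proof (cases "j < k")
      case True
      have "E b (simple j) = 0" unfolding E_simple_right[of j b, OF j[simplified]]
        by (intro sum.neutral) (use True lo in \<open>auto simp: eul_def simple_apply\<close>)
      then show ?thesis using True j by (simp add: E_simple_cox)
    next
      case False
      have "E (simple j) (c b) = (\<Sum>l<n. if l = k then (if j = k then - d k else 0) else 0)"
        unfolding E_simple_left[of j "c b", OF j[simplified]]
        by (intro sum.cong refl) (use False hi in \<open>auto simp: eul_def simple_apply\<close>)
      then show ?thesis using k by simp
    qed
  qed
  then show "E b v = d k * v k" using k E_cox[of v b] by simp
qed

lemma yroot_norm: "yroot k b \<Longrightarrow> E b b = d k"
  using yroot_E[of k b b] yroot_coord[of k b] by simp

lemma yroot_ex: "k < n \<Longrightarrow> \<exists>b. yroot k b"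
  by (rule exI[of _ "W (rev [Suc k..<n]) (simple k)"]) (auto simp: yroot_def intro!: W_rev')

lemma c_negative_yroot:
  assumes "rr b" "pos b" "\<not> pos (c b)" shows "\<exists>k. yroot k b"
  using first_negative[OF assms(1,2), of 0] assms(3) by (auto simp: yroot_def cox_W)

lemma sigma_pos: assumes "pos x" shows "sigma A n i x = refl A n i x"
proof -
  have "x \<noteq> nsimple j" for j using posD[OF assms, of j] by (auto simp: nsimple_def)
  then show ?thesis by (simp add: sigma_def)
qed

lemma foldr_sigma_pos:
  assumes "m \<le> l" "\<And>k. m < k \<Longrightarrow> k \<le> l \<Longrightarrow> pos (W [k..<l] x)"
  shows "foldr (sigma A n) [m..<l] x = W [m..<l] x"
  using assms
proof (induction m rule: inc_induct)
  case base
  then show ?case by simp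
next
  case (step m)
  then have "foldr (sigma A n) [Suc m..<l] x = W [Suc m..<l] x" by simp
  moreover have "pos (W [Suc m..<l] x)" using step by simp
  ultimately show ?case using step(2) by (simp add: upt_conv_Cons sigma_pos weyl_word_def)
qed

lemma foldr_sigma_nsimple: "k < n \<Longrightarrow> k \<notin> set ws \<Longrightarrow> foldr (sigma A n) ws (nsimple k) = nsimple k"
proof (induction ws)
  case (Cons i ws)
  then have "nsimple k \<noteq> nsimple i" by (auto simp: nsimple_def fun_eq_iff)
  then show ?case using Cons by (auto simp: sigma_def)
qed simp

text \<open>\<sigma>_i differs from the reflection only at negative simple roots, and by
  \<open>first_negative\<close> a suffix of \<open>c\<close> leading out of the positive cone would
  make \<open>b\<close> an inversion, so that \<open>c b\<close> would not be positive.\<close>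

lemma tau_c: assumes "rr b" "pos b" "pos (c b)" shows "tau A n b = c b"
proof -
  have "pos (W [k..<n] b)" if kn: "k \<le> n" for k
  proof (rule ccontr)
    assume "\<not> ?thesis"
    then obtain l where "yroot l b" using first_negative[OF assms(1,2) kn] by (auto simp: yroot_def)
    then show False using yroot_c_neg assms(3) by blast
  qed
  then show ?thesis by (simp add: tau_def cox_W foldr_sigma_pos)
qed

text \<open>The suffix of \<open>c\<close> beyond \<open>k\<close> brings \<open>b\<close> to
  \<open>simple k\<close>, which \<sigma>_k negates; the remaining \<sigma>_i with
  \<open>i < k\<close> fix the result.\<close>

lemma tau_yroot: assumes "yroot k b" shows "tau A n b = nsimple k"
proof -
  have k: "k < n" "rr b" "pos b" using yroot_less yroot_rr yroot_pos assms by blast+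
  obtain l where l: "l < n" "W [Suc l..<n] b = simple l" "\<forall>m. l < m \<and> m \<le> n \<longrightarrow> pos (W [m..<n] b)"
    using first_negative[OF k(2,3), of 0] yroot_c_neg[OF assms] by (auto simp: cox_W)
  have "E b (simple k) = d k" "E b (simple k) = d l * simple k l"
    using yroot_E[OF assms, of "simple k"] yroot_E[of l b "simple k"] l by (auto simp: yroot_def simple_apply)
  then have "l = k" using d_pos[OF k(1)] by (auto simp: simple_apply split: if_splits)
  then have "foldr (sigma A n) [Suc k..<n] b = simple k" using l k foldr_sigma_pos[of "Suc k" n b] by simp
  moreover have "[0..<n] = [0..<k] @ k # [Suc k..<n]"
    using k by (metis less_imp_le_nat upt_conv_Cons le_add_diff_inverse plus_nat.add_0 upt_add_eq_append zero_le)
  moreover have "sigma A n k (simple k) = nsimple k"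
    using k by (simp add: sigma_pos refl_rf rf_self nsimple_eq del: E_simple_simple)
  ultimately show ?thesis using k by (simp add: tau_def foldr_sigma_nsimple)
qed

text \<open>The \<sigma>_i with \<open>i > k\<close> act first and fix the root; \<sigma>_k makes it
  \<open>simple k\<close>, and the rest act as reflections on positive roots.\<close>

lemma tau_nsimple: assumes "yroot k b" shows "tau A n (nsimple k) = - c b" and "pos (- c b)"
proof -
  have k: "k < n" using yroot_less assms by blast
  have "pos (W [m..<k] (simple k))" if "m \<le> k" for m
  proof -
    have "W [m..<k] (simple k) k = 1" using that by (simp add: W_other simple_apply)
    moreover have "rr (W [m..<k] (simple k))" using k by (intro rr_W rr_simple) auto
    ultimately show ?thesis using rr_pos_or_neg posD[of "- W [m..<k] (simple k)" k] by fastforce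
  qed
  note P = this
  then have "foldr (sigma A n) [0..<k] (simple k) = W [0..<k] (simple k)" by (intro foldr_sigma_pos) auto
  moreover have "[0..<n] = [0..<k] @ k # [Suc k..<n]"
    using k by (metis less_imp_le_nat upt_conv_Cons le_add_diff_inverse plus_nat.add_0 upt_add_eq_append zero_le)
  moreover have "sigma A n k (nsimple k) = simple k"
    using k by (simp add: sigma_def refl_rf nsimple_eq rf_linear rf_self del: E_simple_simple)
  ultimately show "tau A n (nsimple k) = - c b"
    using k yroot_c[OF assms] by (simp add: tau_def foldr_sigma_nsimple)
  show "pos (- c b)" using P[of 0] by (simp add: yroot_c[OF assms])
qed

section \<open>Orbits of the Coxeter element\<close>

text \<open>Pigeonhole: modulo \<delta> the orbit lies in the finite set of
  \<open>finite_rr_fin\<close>.\<close>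

lemma orbit_period:
  assumes "rr z" obtains p m where "p > 0" "cp p z = z + m \<odot> \<delta>"
proof -
  have "range (\<lambda>i. bar (cp i z)) \<subseteq> {b. rr b \<and> b aff = 0}" using assms rr_cp rr_bar by auto
  then have "finite (range (\<lambda>i. bar (cp i z)))" using finite_rr_fin finite_subset by blast
  then have "\<not> inj (\<lambda>i. bar (cp i z))" using finite_imageD infinite_UNIV_nat by blast
  then obtain i j where ij: "i < j" "bar (cp i z) = bar (cp j z)"
    by (metis (mono_tags, lifting) injI nat_neq_iff)
  define m where "m = cp j z aff - cp i z aff"
  have "cp j z = cp i z + m \<odot> \<delta>"
    using ij(2) by (auto simp: bar_def m_def fun_eq_iff algebra_simps)
  moreover have "cp j z = cp i (cp (j - i) z)" using ij(1) by (simp flip: funpow_add comp_apply[of "cp i"])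
  ultimately have "cp i (cp (j - i) z) = cp i (z + m \<odot> \<delta>)" by (simp add: cp_linear)
  then have "cp (j - i) z = z + m \<odot> \<delta>" by (simp add: cp_inj)
  then show ?thesis using that[of "j - i"] ij by simp
qed

text \<open>\<open>c\<close> permutes the summands of \<open>T\<close> cyclically up to the excess
  \<open>m \<odot> \<delta>\<close>, and \<open>K_c\<close> converts this into the norm of
  \<open>T\<close>.\<close>

lemma orbit_sum:
  assumes "cp p z = z + m \<odot> \<delta>" "T = (\<Sum>i<p. cp i z)"
  shows "c T = T + m \<odot> \<delta>" "E T T * 2 = - m * real p * E z \<delta>" "E T \<delta> = real p * E z \<delta>"
proof -
  have "c T + z = (\<Sum>i<p. cp (Suc i) z) + cp 0 z" by (simp add: assms(2) c_sum)
  also have "\<dots> = (\<Sum>i<Suc p. cp i z)" by (subst sum.lessThan_Suc_shift) (simp only: add.commute)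
  also have "\<dots> = T + cp p z" by (simp only: sum.lessThan_Suc assms(2))
  finally have "c T + z = T + (z + m \<odot> \<delta>)" using assms(1) by simp
  then show 1: "c T = T + m \<odot> \<delta>" by (simp add: algebra_simps)
  show 2: "E T \<delta> = real p * E z \<delta>" by (simp add: assms(2) E_sum)
  show "E T T * 2 = - m * real p * E z \<delta>" using K_c[of T T] 1 2 by (simp add: K_self E_linear)
qed

lemma supp_cp: "supported n x \<Longrightarrow> supported n (cp i x)"
  by (induction i) (simp_all add: supp_c)

text \<open>\<open>T\<close> pairs nontrivially with \<delta>, so it is not a multiple of \<delta>
  and has positive norm; the norm formula then gives the sign of \<open>m\<close>.\<close>

lemma orbit_shift_pos:
  assumes "rr z" "E z \<delta> > 0" obtains p m where "p > 0" "m < 0" "cp p z = z + m \<odot> \<delta>"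
proof -
  obtain p m where pm: "p > 0" "cp p z = z + m \<odot> \<delta>" using orbit_period[OF assms(1)] .
  define T where "T = (\<Sum>i<p. cp i z)"
  note T = orbit_sum[OF pm(2) T_def]
  have "\<nexists>t. T = t \<odot> \<delta>" using T(3) pm(1) assms(2) by (auto simp: E_linear)
  moreover have "supported n T" unfolding T_def using rrD(1)[OF assms(1)] by (intro supported_sum supp_cp)
  ultimately have "E T T > 0" by (intro E_pos)
  then have "0 < (- m) * (real p * E z \<delta>)" using T(2) by (simp add: mult.assoc)
  moreover have "0 < real p * E z \<delta>" using assms(2) pm(1) by simp
  ultimately have "m < 0" by (metis neg_0_less_iff_less zero_less_mult_pos2)
  then show ?thesis using that pm by blast
qed

text \<open>Now \<open>T\<close> has norm 0, so it is a multiple of \<delta> and fixed by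
  \<open>c\<close>, which leaves no excess.\<close>

lemma orbit_periodic:
  assumes "rr z" "E z \<delta> = 0" obtains p where "p > 0" "cp p z = z"
proof -
  obtain p m where pm: "p > 0" "cp p z = z + m \<odot> \<delta>" using orbit_period[OF assms(1)] .
  define T where "T = (\<Sum>i<p. cp i z)"
  note T = orbit_sum[OF pm(2) T_def]
  have "supported n T" unfolding T_def using rrD(1)[OF assms(1)] by (intro supported_sum supp_cp)
  then have "T = T aff \<odot> \<delta>" using T(2) assms(2) by (intro E_zero_imp) auto
  then have "c T = T" by (metis c_linear(4) c_delta)
  then have "m \<odot> \<delta> = 0" using T(1) by simp
  then have "(m \<odot> \<delta>) aff = 0" by (simp only: zero_fun_apply)
  then have "m = 0" by simp
  then show ?thesis using that pm by simp
qed

lemma cp_mult: assumes "cp p z = z + m \<odot> \<delta>" shows "cp (j * p) z = z + (real j * m) \<odot> \<delta>"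
proof (induction j)
  case (Suc j)
  have "cp (Suc j * p) z = cp p (cp (j * p) z)" by (simp add: funpow_add)
  also have "\<dots> = z + (real (Suc j) * m) \<odot> \<delta>"
    unfolding Suc by (simp add: cp_linear assms fun_eq_iff algebra_simps)
  finally show ?case .
qed simp

text \<open>Only inversions of \<open>c\<close> become negative, and they have
  \<open>E b \<delta> = d k * \<delta> k > 0\<close>.\<close>

lemma pos_c: "rr b \<Longrightarrow> pos b \<Longrightarrow> E b \<delta> \<le> 0 \<Longrightarrow> pos (c b)"
proof (rule ccontr)
  assume a: "rr b" "pos b" "E b \<delta> \<le> 0" "\<not> pos (c b)"
  then obtain k where "yroot k b" using c_negative_yroot by blast
  then show False using a(3) yroot_E[of k b \<delta>] yroot_less[of k b] d_pos[of k] delta_pos[of k]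
    by (simp add: mult_le_0_iff)
qed

lemma pos_cp: "rr b \<Longrightarrow> pos b \<Longrightarrow> E b \<delta> \<le> 0 \<Longrightarrow> pos (cp i b)"
  by (induction i) (simp_all add: pos_c rr_cp)

lemma pos_ci: assumes "rr b" "pos b" "E b \<delta> \<ge> 0" shows "pos (ci b)"
proof (rule ccontr)
  assume "\<not> pos (ci b)"
  then have "pos (- ci b)" using rr_not_pos rr_ci assms by blast
  moreover have "c (- ci b) = - b" by (simp add: c_linear)
  ultimately have "pos (- b)" using pos_c[of "- ci b"] assms rr_ci rr_uminus by (simp add: E_linear)
  then show False using assms pos_neg_eq_0 rrD(6) by blast
qed

text \<open>Each period subtracts a positive multiple of \<delta>, so the orbit leaves the positive
  cone; the member just before the first exit is an inversion of \<open>c\<close>.\<close>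

lemma reach_yroot:
  assumes "rr z" "pos z" "E z \<delta> > 0"
  obtains i k where "yroot k (cp i z)" "\<And>j. j \<le> i \<Longrightarrow> pos (cp j z)"
proof -
  obtain p m where pm: "p > 0" "m < 0" "cp p z = z + m \<odot> \<delta>" using orbit_shift_pos[OF assms(1,3)] .
  obtain j :: nat where j: "z aff / (- m) < real j" using reals_Archimedean2 by blast
  then have "cp (j * p) z aff < 0" using pm(2) by (simp add: cp_mult[OF pm(3)] field_simps)
  then have ex: "\<exists>N. \<not> pos (cp N z)" using posD by (metis not_le)
  define N where "N = (LEAST N. \<not> pos (cp N z))"
  have N: "\<not> pos (cp N z)" unfolding N_def using ex by (rule LeastI_ex)
  have lt: "pos (cp j z)" if "j < N" for j using that not_less_Least N_def by blast
  have "N \<noteq> 0" using N assms(2) by (cases N) auto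
  then obtain i where i: "N = Suc i" by (cases N) auto
  have "\<not> pos (c (cp i z))" using N i by simp
  then obtain k where "yroot k (cp i z)" using c_negative_yroot[of "cp i z"] lt[of i] i assms(1) rr_cp by auto
  then show ?thesis using that lt i by simp
qed

section \<open>Positive real roots in U and the sign of the Euler form\<close>

definition S :: "vec set" where "S = {b. rr b \<and> pos b \<and> E b \<delta> = 0}"

lemma S_c: "b \<in> S \<Longrightarrow> c b \<in> S" and S_ci: "b \<in> S \<Longrightarrow> ci b \<in> S"
  by (auto simp: S_def rr_c rr_ci pos_c pos_ci)

lemma S_cp: "b \<in> S \<Longrightarrow> cp i b \<in> S"
  by (induction i) (auto simp: S_c)

text \<open>Adding a multiple of \<delta> to \<open>z\<close> does not change the pairing with
  \<open>b\<close> and makes \<open>z\<close> positive. After transport to an inversion by a power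
  of \<open>c\<close>, the pairing is \<open>d k\<close> times a coordinate of a positive
  root.\<close>

lemma E_nonneg_S:
  assumes "rr z" "E z \<delta> > 0" "b \<in> S" shows "E z b \<ge> 0"
proof -
  obtain p m where pm: "p > 0" "m < 0" "cp p z = z + m \<odot> \<delta>" using orbit_shift_pos[OF assms(1,2)] .
  obtain j :: nat where j: "- z aff / (- m) < real j" using reals_Archimedean2 by blast
  \<comment> \<open>This shift has the effect of an inverse power of \<open>c\<close>, so
    \<open>z'\<close> is again a root.\<close>
  define z' where "z' = z + (- (real j * m)) \<odot> \<delta>"
  have "cp (j * p) z' = z" by (simp add: z'_def cp_linear cp_mult[OF pm(3)] fun_eq_iff)
  then have "z' = (ci ^^ (j * p)) z" by (metis cp_cipow cp_inj)
  then have "rr z'" using assms(1) rr_cipow by simp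
  moreover have "z' aff > 0" using j pm(2) by (simp add: z'_def field_simps)
  then have "\<not> pos (- z')" by (auto simp: pos_def not_le intro!: exI[of _ aff])
  ultimately have z': "rr z'" "pos z'" using rr_pos_or_neg by blast+
  have "E z' \<delta> > 0" using assms(2) by (simp add: z'_def E_linear)
  then obtain i k where ik: "yroot k (cp i z')" using reach_yroot[OF z'] by blast
  have "E z b = E z' b" using assms(3) by (simp add: z'_def E_linear E_delta_left S_def)
  also have "\<dots> = E (cp i z') (cp i b)" by simp
  also have "\<dots> = d k * cp i b k" using yroot_E[OF ik] .
  also have "\<dots> \<ge> 0" using d_pos[OF yroot_less[OF ik]] S_cp[OF assms(3), of i] by (simp add: S_def pos_def)
  finally show ?thesis .
qed

text \<open>The same transport; \<open>b\<close> stays positive under \<open>c\<close> by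
  \<open>pos_cp\<close>, since its value at \<delta> is negative.\<close>

lemma E_nonneg_pos_neg:
  assumes "rr a" "pos a" "E a \<delta> > 0" "rr b" "pos b" "E b \<delta> < 0" shows "E a b \<ge> 0"
proof -
  obtain i k where ik: "yroot k (cp i a)" using reach_yroot[OF assms(1-3)] by blast
  have "E a b = E (cp i a) (cp i b)" by simp
  also have "\<dots> = d k * cp i b k" using yroot_E[OF ik] .
  also have "\<dots> \<ge> 0" using d_pos[OF yroot_less[OF ik]] pos_cp[OF assms(4,5), of i] assms(6) by (simp add: pos_def)
  finally show ?thesis .
qed

text \<open>The orbit sum of a root with positive value at \<delta> satisfies
  \<open>c T = T + m \<odot> \<delta>\<close> with \<open>m < 0\<close>; divide by \<open>m\<close>
  and remove the coordinate at \<open>aff\<close>.\<close>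

lemma gamma_exists:
  shows "\<exists>g. supported n g \<and> g aff = 0 \<and> c g = g + \<delta>"
proof -
  obtain z where z: "yroot aff z" using yroot_ex[OF aff_less] by blast
  have e: "E z \<delta> > 0" using yroot_E[OF z, of \<delta>] d_pos[of aff] by simp
  obtain p m where pm: "p > 0" "m < 0" "cp p z = z + m \<odot> \<delta>" using orbit_shift_pos[OF yroot_rr[OF z] e] .
  define T where "T = (\<Sum>i<p. cp i z)"
  note T = orbit_sum[OF pm(3) T_def]
  have s: "supported n T" unfolding T_def using rrD(1)[OF yroot_rr[OF z]] by (intro supported_sum supp_cp)
  let ?g = "(1 / m) \<odot> T - (T aff / m) \<odot> \<delta>"
  have "c ?g = ?g + \<delta>" using pm(2) by (simp add: c_linear T(1) fun_eq_iff algebra_simps)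
  then show ?thesis using s by (intro exI[of _ ?g]) auto
qed

lemma gamma_unique:
  assumes "supported n g" "g aff = 0" "c g = g + \<delta>" "supported n h" "h aff = 0" "c h = h + \<delta>"
  shows "g = h"
proof -
  have "c (g - h) = g - h" using assms by (simp add: c_linear)
  then have "g - h = (g - h) aff \<odot> \<delta>" using assms by (intro c_fixed) auto
  then have "g - h = 0" using assms by (simp add: fun_eq_iff)
  then show ?thesis by simp
qed

text \<open>Inserting \<open>c g\<close> into \<open>K_c\<close> identifies the hyperplane U,
  defined through \<gamma>_c, with the kernel of the pairing with \<delta>.\<close>

lemma E_delta_gamma: assumes "c g = g + \<delta>" shows "K g v = - E v \<delta>"
  using K_c[of v g] assms by (simp add: K_sym[of g] E_linear)

end

section \<open>Stabilizers in the finite Weyl group\<close>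

lemmas vec_simps = plus_fun_apply minus_apply uminus_apply sm_apply zero_fun_apply

text \<open>As default simplification rules, the pointwise rules would also unfold vectors under binders.\<close>

declare vec_simps [simp del]

definition linear_fn :: "(vec \<Rightarrow> real) \<Rightarrow> bool" where
  "linear_fn f \<longleftrightarrow> (\<forall>x y. f (x + y) = f x + f y) \<and> (\<forall>t x. f (t \<odot> x) = t * f x)"

lemma linear_fnD: assumes "linear_fn f"
  shows "f (x + y) = f x + f y" "f (t \<odot> x) = t * f x" "f (- x) = - f x" "f (x - y) = f x - f y" "f 0 = 0"
proof -
  show 1: "f (x + y) = f x + f y" "f (t \<odot> x) = t * f x" for x y t using assms by (auto simp: linear_fn_def)
  show 2: "f (- x) = - f x" for x using 1(2)[of "-1" x] by (simp add: sm_minus)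
  show "f (x - y) = f x - f y" using 1(1)[of x "- y"] 2[of y] by simp
  show "f 0 = 0" using 1(2)[of 0 0] by simp
qed

lemma linear_fn_sum: "linear_fn f \<Longrightarrow> f (\<Sum>x\<in>X. g x) = (\<Sum>x\<in>X. f (g x))"
  by (induction X rule: infinite_finite_induct)
    (simp_all only: sum.infinite sum.empty sum.insert linear_fnD not_False_eq_True)

lemma vec_expand: "supported n x \<Longrightarrow> x = (\<Sum>i<n. x i \<odot> simple i)"
proof
  fix k assume "supported n x"
  have "(\<Sum>i<n. x i \<odot> simple i) k = (\<Sum>i<n. if i = k then x k else 0)"
    unfolding sum_vec_apply by (intro sum.cong refl) (auto simp: simple_apply vec_simps)
  then show "x k = (\<Sum>i<n. x i \<odot> simple i) k" using supportedD[OF \<open>supported n x\<close>, of k] by simp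
qed

lemma linear_fn_expand: assumes "linear_fn f" "supported n x" shows "f x = (\<Sum>i<n. x i * f (simple i))"
proof -
  have "f x = f (\<Sum>i<n. x i \<odot> simple i)" using vec_expand[OF assms(2)] by simp
  also have "\<dots> = (\<Sum>i<n. x i * f (simple i))" by (simp add: linear_fn_sum linear_fnD assms)
  finally show ?thesis .
qed

context affine_data
begin

definition F :: "nat set" where "F = {i. i < n \<and> i \<noteq> aff}"

lemma F_sub: "ws \<subseteq> F \<Longrightarrow> ws \<subseteq> {..<n}"
  by (auto simp: F_def)

lemma F_less: "i \<in> F \<Longrightarrow> i < n"
  by (simp add: F_def)

text \<open>Reading the word from the right, the first letter that turns the image of
  \<open>simple i\<close> negative meets its own simple root, and by \<open>W_conj\<close> it can be
  traded for the reflection in \<open>simple i\<close> at the right end.\<close>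

lemma exchange:
  assumes "set ws \<subseteq> {..<n}" "i < n" "\<not> pos (W ws (simple i))"
  shows "\<exists>ws'. length ws' < length ws \<and> set ws' \<subseteq> set ws \<and> (\<forall>x. W ws x = W ws' (rf (simple i) x))"
  using assms
proof (induction ws)
  case (Cons j us)
  then have j: "j < n" and us: "set us \<subseteq> {..<n}" by auto
  show ?case
  proof (cases "pos (W us (simple i))")
    case False
    then obtain us' where "length us' < length us" "set us' \<subseteq> set us" "\<forall>x. W us x = W us' (rf (simple i) x)"
      using Cons us by blast
    then show ?thesis using j by (intro exI[of _ "j # us'"]) auto
  next
    case True
    have "W us (simple i) = simple j"
      using rr_simple_neg[OF rr_W[OF us rr_simple[OF Cons.prems(2)]] True j] Cons.prems(3) j by simp
    then have "W (j # us) x = W us (rf (simple i) x)" for x using j us by (simp add: W_conj)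
    then show ?thesis by (intro exI[of _ us]) auto
  qed
qed simp

lemma W_F_aff: "set ws \<subseteq> F \<Longrightarrow> W ws x aff = x aff"
  by (rule W_other) (auto simp: F_def)

text \<open>Stabilizers of dominant functionals are generated by simple reflections. If the last
  letter \<open>k\<close> cannot be cancelled by \<open>exchange\<close>, the word sends
  \<open>simple k\<close> to a negative root; invariance then gives \<open>f (simple k) = 0\<close>,
  and the letter can be split off.\<close>

lemma dominant_stabilizer:
  assumes "linear_fn f" "\<And>i. i \<in> F \<Longrightarrow> f (simple i) \<ge> 0" "set ws \<subseteq> F"
    "\<And>x. supported n x \<Longrightarrow> f (W ws x) = f x"
  shows "\<exists>ws'. set ws' \<subseteq> {i \<in> F. f (simple i) = 0} \<and> (\<forall>x. W ws x = W ws' x)"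
  using assms(3,4)
proof (induction "length ws" arbitrary: ws rule: less_induct)
  case less
  show ?case
  proof (cases ws rule: rev_cases)
    case Nil
    then show ?thesis by (intro exI[of _ "[]"]) auto
  next
    case (snoc us k)
    then have k: "k \<in> F" "k < n" and us: "set us \<subseteq> F" "set us \<subseteq> {..<n}"
      using less.prems(1) by (auto simp: F_def)
    note wsn = F_sub[OF less.prems(1)]
    have Wk: "W ws (simple k) = - W us (simple k)"
      using snoc k us by (simp add: W_append rf_self W_minus del: E_simple_simple)
    show ?thesis
    proof (cases "pos (W us (simple k))")
      case False
      then obtain us' where us': "length us' < length us" "set us' \<subseteq> set us" "\<forall>x. W us x = W us' (rf (simple k) x)"
        using exchange[OF us(2) k(2)] by blast
      have eq: "W ws x = W us' x" for x using us'(3) snoc k by (simp add: W_append rf_rf del: E_simple_simple)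
      have "\<exists>ws'. set ws' \<subseteq> {i \<in> F. f (simple i) = 0} \<and> (\<forall>x. W us' x = W ws' x)"
        using us' us snoc less.prems eq by (intro less.hyps) auto
      then show ?thesis using eq by simp
    next
      case True
      let ?v = "W us (simple k)"
      have v: "supported n ?v" "?v aff = 0"
        using us k W_supp[OF us(2)] W_F_aff[OF us(1), of "simple k"] by (auto simp: F_def simple_apply vec_simps)
      have "f ?v = (\<Sum>i<n. ?v i * f (simple i))" by (rule linear_fn_expand[OF assms(1) v(1)])
      also have "\<dots> \<ge> 0"
      proof (rule sum_nonneg)
        fix i assume "i \<in> {..<n}"
        then show "0 \<le> ?v i * f (simple i)"
          using v(2) assms(2)[of i] posD[OF True, of i] by (cases "i = aff") (auto simp: F_def)
      qed
      finally have "f ?v \<ge> 0" .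
      moreover have "f (simple k) = - f ?v" using less.prems(2)[of "simple k"] k Wk linear_fnD(3)[OF assms(1)] by auto
      ultimately have fk: "f (simple k) = 0" using assms(2)[OF k(1)] by simp
      have "f (W us x) = f x" if "supported n x" for x
      proof -
        have "W us x = W ws (rf (simple k) x)" using snoc k by (simp add: W_append rf_rf del: E_simple_simple)
        then have "f (W us x) = f (rf (simple k) x)" using less.prems(2) rf_supported that k by simp
        then show ?thesis using fk by (simp add: rf_def linear_fnD[OF assms(1)])
      qed
      then have "\<exists>ws'. set ws' \<subseteq> {i \<in> F. f (simple i) = 0} \<and> (\<forall>x. W us x = W ws' x)"
        using us snoc by (intro less.hyps) auto
      then obtain ws' where w: "set ws' \<subseteq> {i \<in> F. f (simple i) = 0}" "\<forall>x. W us x = W ws' x" by blast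
      have "W ws x = W (ws' @ [k]) x" for x using w(2) snoc by (simp add: W_append)
      then show ?thesis using w(1) k fk by (intro exI[of _ "ws' @ [k]"]) auto
    qed
  qed
qed

lemma rr_theta: assumes "j < n" "\<delta> j = 1" "d j = d aff"
  shows "rr (\<delta> - simple j)" "pos (\<delta> - simple j)" "E (\<delta> - simple j) (\<delta> - simple j) = d aff"
proof -
  have "rr (- simple j + 1 \<odot> \<delta>)"
    using assms d_pos[of j] by (intro rr_shift rr_uminus rr_simple) (auto simp: E_linear)
  moreover have "- simple j + 1 \<odot> \<delta> = \<delta> - simple j" by (simp add: fun_eq_iff vec_simps)
  ultimately show "rr (\<delta> - simple j)" by simp
  show "pos (\<delta> - simple j)" using posD[OF pos_delta] assms(2) by (auto simp: pos_def vec_simps simple_apply vec_simps)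
  show "E (\<delta> - simple j) (\<delta> - simple j) = d aff"
    using assms E_delta_left[of "simple j"] by (simp add: E_linear)
qed

text \<open>Modulo \<delta>, the reflection in \<open>simple aff\<close> is the reflection in
  \<open>\<delta> - simple aff\<close>, a root supported off \<open>aff\<close>, so each letter
  \<open>aff\<close> can be replaced by a word in the finite diagram.\<close>

lemma word_mod_delta:
  assumes "set ws \<subseteq> {..<n}"
  shows "\<exists>ws'. set ws' \<subseteq> F \<and> (\<forall>x. \<exists>t. W ws x = W ws' x + t \<odot> \<delta>)"
proof -
  let ?th = "\<delta> - simple aff"
  have th: "rr ?th" "pos ?th" "E ?th ?th = d aff" using rr_theta[of aff] by auto
  obtain us k where uk: "set us \<subseteq> {i. i < n \<and> ?th i \<noteq> 0}" "k < n" "?th k \<noteq> 0" "?th = W us (simple k)"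
    using rr_word[OF th(1,2)] by blast
  have "?th aff = 0" by (simp add: simple_apply vec_simps)
  then have F: "set us \<subseteq> F" "k \<in> F" using uk(1-3) by (auto simp only: F_def)
  then have us: "set us \<subseteq> {..<n}" using F_sub by blast
  define vs where "vs = us @ [k] @ rev us"
  have vs: "set vs \<subseteq> F" using F by (auto simp: vs_def)
  have Wvs: "W vs x = rf ?th x" for x
    using us uk(2) by (simp add: vs_def W_append W_conj W_rev' uk(4))
  have aff: "\<exists>t. rf (simple aff) x = W vs x + t \<odot> \<delta>" for x
  proof
    show "rf (simple aff) x = W vs x + (- K (simple aff) x / d aff) \<odot> \<delta>"
      unfolding Wvs rf_def[of ?th] th(3) by (simp add: rf_def K_linear fun_eq_iff vec_simps algebra_simps diff_divide_distrib)
  qed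
  show ?thesis using assms
  proof (induction ws)
    case Nil
    show ?case by (intro exI[of _ "[] :: nat list"] conjI allI exI[of _ "0 :: real"]) simp_all
  next
    case (Cons i ws)
    have i: "i < n" "set ws \<subseteq> {..<n}" using Cons.prems by auto
    obtain ws' where ws': "set ws' \<subseteq> F" "\<forall>x. \<exists>t. W ws x = W ws' x + t \<odot> \<delta>" using Cons.IH[OF i(2)] by blast
    show ?case
    proof (cases "i = aff")
      case False
      have "\<exists>t. W (i # ws) x = W (i # ws') x + t \<odot> \<delta>" for x
      proof -
        obtain t where "W ws x = W ws' x + t \<odot> \<delta>" using ws'(2) by blast
        then have "W (i # ws) x = W (i # ws') x + t \<odot> \<delta>" using i by (simp add: rf_linear)
        then show ?thesis ..
      qed
      then show ?thesis using ws'(1) i False by (intro exI[of _ "i # ws'"]) (auto simp: F_def)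
    next
      case True
      have "\<exists>t. W (i # ws) x = W (vs @ ws') x + t \<odot> \<delta>" for x
      proof -
        obtain t where t: "W ws x = W ws' x + t \<odot> \<delta>" using ws'(2) by blast
        obtain u where u: "rf (simple aff) (W ws' x) = W vs (W ws' x) + u \<odot> \<delta>" using aff by blast
        have "W (i # ws) x = W (vs @ ws') x + (t + u) \<odot> \<delta>"
          using t u True by (simp add: rf_linear W_append sm_distribs algebra_simps)
        then show ?thesis ..
      qed
      then show ?thesis using ws'(1) vs by (intro exI[of _ "vs @ ws'"]) auto
    qed
  qed
qed

text \<open>Minimize the number of positive finite roots on which \<open>f\<close> after the word is
  negative. If \<open>simple i\<close> were one of them, appending \<open>i\<close> would remove it
  from the count and permute the other positive roots.\<close>

lemma dominant_word:
  assumes "linear_fn f"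
  shows "\<exists>g. set g \<subseteq> F \<and> (\<forall>i\<in>F. f (W g (simple i)) \<ge> 0)"
proof -
  define Q where "Q = {b. rr b \<and> b aff = 0 \<and> pos b}"
  have "finite Q" unfolding Q_def by (rule finite_subset[OF _ finite_rr_fin]) auto
  define N where "N g = card {b \<in> Q. f (W g b) < 0}" for g
  have "\<exists>g. set g \<subseteq> F \<and> (\<forall>h. set h \<subseteq> F \<longrightarrow> N g \<le> N h)"
    by (rule ex_has_least_nat[of "\<lambda>g. set g \<subseteq> F" "[]"]) simp
  then obtain g where g: "set g \<subseteq> F" "\<And>h. set h \<subseteq> F \<Longrightarrow> N g \<le> N h" by blast
  have "f (W g (simple i)) \<ge> 0" if i: "i \<in> F" for i
  proof (rule ccontr)
    assume neg: "\<not> f (W g (simple i)) \<ge> 0"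
    have i': "i < n" "i \<noteq> aff" using i by (auto simp: F_def)
    let ?X = "{b \<in> Q. f (W g b) < 0}" and ?Y = "{b \<in> Q. f (W (g @ [i]) b) < 0}"
    have gn: "set g \<subseteq> {..<n}" using g(1) F_sub by blast
    have "rf (simple i) ` ?Y \<subseteq> ?X - {simple i}"
    proof
      fix y assume "y \<in> rf (simple i) ` ?Y"
      then obtain b where b: "y = rf (simple i) b" "b \<in> Q" "f (W (g @ [i]) b) < 0" by auto
      have fy: "f (W g y) < 0" using b i' by (simp add: W_append)
      have "b \<noteq> simple i"
      proof
        assume "b = simple i"
        then have "f (W g y) = - f (W g (simple i))"
          using b(1) i' gn by (simp add: rf_self W_minus linear_fnD[OF assms] del: E_simple_simple)
        then show False using fy neg by simp
      qed
      then have py: "pos y" using rr_simple_neg[of b i] b i' by (auto simp: Q_def)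
      moreover have "rr y" using b i' by (auto simp: Q_def rr_rf rr_simple)
      moreover have "y aff = 0" using b i' by (simp add: Q_def rf_def simple_apply vec_simps)
      moreover have "y \<noteq> simple i"
      proof
        assume "y = simple i"
        then have "b = - simple i" 
          using b(1) rf_rf[OF simple_norm[OF i'(1)], of b] rf_self[OF simple_norm[OF i'(1)]] by simp
        then show False using b(2) posD[of b i] by (simp add: Q_def simple_apply vec_simps)
      qed
      ultimately show "y \<in> ?X - {simple i}" using fy by (simp add: Q_def)
    qed
    moreover have "inj_on (rf (simple i)) ?Y" 
      using rf_rf[OF simple_norm[OF i'(1)]] by (intro inj_on_inverseI[where g = "rf (simple i)"])
    moreover have "finite (?X - {simple i})" using \<open>finite Q\<close> by simp
    ultimately have "card ?Y \<le> card (?X - {simple i})" by (meson card_inj_on_le)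
    also have "simple i \<in> ?X" using i' neg by (auto simp: Q_def rr_simple simple_apply vec_simps)
    then have "card (?X - {simple i}) < card ?X" using \<open>finite Q\<close> by (intro card_Diff1_less) auto
    finally have "N (g @ [i]) < N g" by (simp add: N_def)
    moreover have "set (g @ [i]) \<subseteq> F" using g(1) i by simp
    ultimately show False using g(2)[of "g @ [i]"] by simp
  qed
  then show ?thesis using g(1) by blast
qed

text \<open>Modulo \<open>\<delta>\<close>, the Coxeter element fixes the functional \<open>E(\<cdot>, \<delta>)\<close>, so it is a product of
  reflections in roots on which this functional vanishes.\<close>

lemma c_closure:
  assumes refl: "\<And>b x. rr b \<Longrightarrow> E b \<delta> = 0 \<Longrightarrow> Q x \<Longrightarrow> Q (rf b x)"
    and shift: "\<And>x t. Q x \<Longrightarrow> Q (x + t \<odot> \<delta>)" and "Q x"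
  shows "Q (c x)"
proof -
  have l0: "linear_fn (\<lambda>x. E x \<delta>)" by (simp add: linear_fn_def E_linear)
  obtain g where g: "set g \<subseteq> F" "\<forall>i\<in>F. E (W g (simple i)) \<delta> \<ge> 0" using dominant_word[OF l0] by blast
  have gn: "set g \<subseteq> {..<n}" "set (rev g) \<subseteq> {..<n}" using g(1) F_sub by auto
  obtain cw where cw: "set cw \<subseteq> F" "\<And>x. \<exists>t. W [0..<n] x = W cw x + t \<odot> \<delta>" using word_mod_delta[OF upt_sub(1)] by blast
  have l1: "linear_fn (\<lambda>x. E (W g x) \<delta>)" using gn by (simp add: linear_fn_def E_linear W_add W_sm)
  \<comment> \<open>Conjugation by \<open>g\<close> makes the functional dominant, where
    \<open>dominant_stabilizer\<close> applies; conjugating back turns the simple reflections into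
    reflections in roots \<open>W g (simple i)\<close> on which it vanishes.\<close>
  let ?w = "rev g @ cw @ g"
  have "E (W g (W ?w x)) \<delta> = E (W g x) \<delta>" for x
  proof -
    obtain t where "W [0..<n] (W g x) = W cw (W g x) + t \<odot> \<delta>" using cw(2) by blast
    then have "W cw (W g x) = c (W g x) - t \<odot> \<delta>" by (simp add: cox_W)
    moreover have "W g (W ?w x) = W cw (W g x)" using gn by (simp add: W_append W_rev')
    ultimately show ?thesis by (simp add: E_linear)
  qed
  then obtain ws where ws: "set ws \<subseteq> {i \<in> F. E (W g (simple i)) \<delta> = 0}" "\<And>x. W ?w x = W ws x"
    using dominant_stabilizer[OF l1, of ?w] g cw(1) by auto
  have step: "Q (W g (W us y))" if "set us \<subseteq> {i \<in> F. E (W g (simple i)) \<delta> = 0}" "Q (W g y)" for us y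
    using that
  proof (induction us)
    case (Cons i us)
    then have i: "i < n" "E (W g (simple i)) \<delta> = 0" by (auto simp: F_def)
    have "Q (rf (W g (simple i)) (W g (W us y)))"
      using Cons i gn by (intro refl rr_W rr_simple) auto
    then show ?case using i gn by (simp add: W_conj)
  qed simp
  have "W cw x = W g (W ws (W (rev g) x))"
    using ws(2)[of "W (rev g) x"] gn by (simp add: W_append W_rev' flip: ws(2))
  moreover have "Q (W g (W ws (W (rev g) x)))" using step[OF ws(1), of "W (rev g) x"] assms(3) gn by (simp add: W_rev')
  ultimately have "Q (W cw x)" by simp
  moreover obtain t where "c x = W cw x + t \<odot> \<delta>" using cw(2)[of x] unfolding cox_W by blast
  ultimately show ?thesis using shift by simp
qed

text \<open>Dual form of the statement that the real roots of U together with \<delta> span U. The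
  reflections behind \<open>c\<close> fix \<open>w\<close>, so \<open>c w\<close> and
  \<open>w\<close> differ by a multiple of \<delta> and \<open>w\<close> is a combination of
  \<gamma>_c and \<delta>; a contribution of \<gamma>_c is excluded because its norm would be
  0.\<close>

lemma orthogonal_to_U_roots:
  assumes "supported n w" "E w \<delta> = 0" "\<And>b. rr b \<Longrightarrow> E b \<delta> = 0 \<Longrightarrow> K b w = 0"
  shows "w = w aff \<odot> \<delta>"
proof -
  have "\<exists>t. c w = w + t \<odot> \<delta>"
  proof (rule c_closure[where Q = "\<lambda>x. \<exists>t. x = w + t \<odot> \<delta>"])
    show "\<exists>t. rf b x = w + t \<odot> \<delta>" if "rr b" "E b \<delta> = 0" "\<exists>t. x = w + t \<odot> \<delta>" for b x
      using that assms(3)[OF that(1,2)] by (auto simp: rf_def K_linear)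
    show "\<exists>s. x + t \<odot> \<delta> = w + s \<odot> \<delta>" if "\<exists>s. x = w + s \<odot> \<delta>" for x t
      using that by (auto simp: add.assoc simp flip: sm_distribs)
    show "\<exists>t. w = w + t \<odot> \<delta>" by (rule exI[of _ 0]) simp
  qed
  then obtain t where t: "c w = w + t \<odot> \<delta>" by blast
  obtain g where g: "supported n g" "g aff = 0" "c g = g + \<delta>" using gamma_exists by blast
  have "c (w - t \<odot> g) = w - t \<odot> g" using t g(3) by (simp add: c_linear sm_distribs)
  then have "w - t \<odot> g = (w - t \<odot> g) aff \<odot> \<delta>" using assms(1) g by (intro c_fixed) auto
  moreover have "(w - t \<odot> g) aff = w aff" using g(2) by (simp add: vec_simps)
  ultimately have w: "w = t \<odot> g + w aff \<odot> \<delta>" by (simp add: algebra_simps)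
  have "t = 0"
  proof (rule ccontr)
    assume "t \<noteq> 0"
    have "E w \<delta> = t * E g \<delta>" by (subst w) (simp add: E_linear)
    then have "E g \<delta> = 0" using assms(2) \<open>t \<noteq> 0\<close> by simp
    then have "E g g = 0" using E_delta_gamma[OF g(3), of g] by (simp add: K_self)
    then have "g = 0" using E_zero_imp[OF g(1)] g(2) by simp
    then have "\<delta> = 0" using g(3) by simp
    then have "\<delta> aff = 0" by (simp only: zero_fun_apply)
    then show False by simp
  qed
  then show ?thesis using w by simp
qed

section \<open>Diagram automorphisms between affine nodes\<close>

lemma height_one_simple:
  assumes "supported n v" "pos v" "\<And>i. v i \<in> \<int>" "v \<noteq> 0" "height n v \<le> 1"
  shows "\<exists>i<n. v = simple i"
proof -
  obtain i where i: "i < n" "v i \<noteq> 0" using assms(1,4) by (auto simp: fun_eq_iff vec_simps supported_def) (meson leI)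
  have "v i > 0" using i posD[OF assms(2), of i] by simp
  then have vi: "v i \<ge> 1" using assms(3)[of i] by (auto elim!: Ints_cases)
  have "height n v = v i + (\<Sum>k\<in>{..<n} - {i}. v k)" using i by (simp add: height_def sum.remove)
  moreover have "(\<Sum>k\<in>{..<n} - {i}. v k) \<ge> 0" using assms(2) by (intro sum_nonneg) (auto simp: pos_def)
  ultimately have s: "v i = 1" "(\<Sum>k\<in>{..<n} - {i}. v k) = 0" using vi assms(5) by auto
  then have "v k = 0" if "k < n" "k \<noteq> i" for k
    using that assms(2) by (subst (asm) sum_nonneg_eq_0_iff) (auto simp: pos_def)
  then have "v = simple i" using s supportedD[OF assms(1)] by (auto simp: fun_eq_iff vec_simps simple_apply vec_simps)
  then show ?thesis using i by blast
qed

lemma int_one_two: fixes x :: real assumes "x \<in> \<int>" "0 < x" "x \<le> 2" shows "x = 1 \<or> x = 2"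
proof -
  obtain z where z: "x = of_int z" using assms(1) by (auto elim: Ints_cases)
  then have "z = 1 \<or> z = 2" using assms by linarith
  then show ?thesis using z by auto
qed

lemma simple_mod_delta: assumes "k < n" "l < n" "simple k = simple l + t \<odot> \<delta>" shows "k = l"
proof -
  have hs: "height n (simple i) = 1" if "i < n" for i using that by (simp add: height_def simple_apply vec_simps)
  have hd: "height n \<delta> > 0" using delta_pos assms(1) unfolding height_def
    by (intro sum_pos) auto
  have "height n (simple k) = height n (simple l) + t * height n \<delta>" using assms(3) by (simp add: height_linear)
  then have "t = 0" using hs assms(1,2) hd by simp
  then have "simple k k = simple l k" using assms(3) by simp
  then show ?thesis by (simp add: simple_apply vec_simps split: if_splits)
qed

text \<open>The simple roots other than \<open>\<alpha>\<^sub>j\<close> and those other than \<open>\<alpha>\<^sub>a\<^sub>f\<^sub>f\<close> are, modulo \<open>\<delta>\<close>, two bases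
  of the same finite root system, hence conjugate; and \<open>\<delta> - \<alpha>\<^sub>j\<close>, \<open>\<delta> - \<alpha>\<^sub>a\<^sub>f\<^sub>f\<close> are the unique
  dominant roots of their length.\<close>

lemma affine_nodes_conjugate:
  assumes j: "j < n" "\<delta> j = 1" "d j = d aff"
  shows "\<exists>\<pi>. diagram_aut A n \<pi> \<and> \<pi> j = aff"
proof -
  \<comment> \<open>Height after removing coordinate \<open>j\<close> by a multiple of \<delta>. It
    is 1 on every simple root other than \<open>simple j\<close> and nonzero on all real roots, so
    it singles out the simple system obtained by deleting \<open>j\<close>.\<close>
  define h where "h u = height n u - u j * height n \<delta>" for u
  define bj where "bj u = u - u j \<odot> \<delta>" for u
  have h_bj: "h u = height n (bj u)" for u by (simp add: h_def bj_def height_linear)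
  have h_lin: "linear_fn h" by (simp add: linear_fn_def h_def height_linear vec_simps algebra_simps)
  have h_delta: "h \<delta> = 0" using j by (simp add: h_def)
  have h_simple: "h (simple k) = 1" if "k < n" "k \<noteq> j" for k
    using that by (simp add: h_def height_def simple_apply vec_simps)
  have rr_bj: "rr (bj b)" if "rr b" for b
  proof -
    have "rr (b + (- b j) \<odot> \<delta>)"
    proof (rule rr_shift[OF that])
      show "- b j \<in> \<int>" using rrD(2)[OF that] by simp
      have "- (d j * b j / E b b) \<in> \<int>" using rrD(5)[OF that j(1)] by (simp only: Ints_minus)
      then show "- b j * d aff / E b b \<in> \<int>" using j(3) by (simp add: mult.commute)
    qed
    moreover have "b + (- b j) \<odot> \<delta> = bj b" by (auto simp: bj_def fun_eq_iff vec_simps)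
    ultimately show ?thesis by simp
  qed
  have h_int: "h b \<in> \<int>" "h b \<noteq> 0" if "rr b" for b
  proof -
    have r: "rr (bj b)" using rr_bj that .
    show "h b \<in> \<int>" unfolding h_bj height_def using rrD(2)[OF r] by (intro Ints_sum)
    have "height n (bj b) > 0 \<or> height n (- bj b) > 0"
      using rr_pos_or_neg[OF r] height_pos rrD(1,6)[OF r] by (metis supported_simps(5) neg_equal_0_iff_equal)
    then show "h b \<noteq> 0" unfolding h_bj by (auto simp: height_def vec_simps sum_negf)
  qed
  obtain g where g: "set g \<subseteq> F" "\<And>i. i \<in> F \<Longrightarrow> h (W g (simple i)) \<ge> 0" using dominant_word[OF h_lin] by blast
  have gn: "set g \<subseteq> {..<n}" "set (rev g) \<subseteq> {..<n}" using g(1) F_sub by auto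
  have hg: "h (W g (simple i)) \<ge> 1" if "i \<in> F" for i
  proof -
    have "rr (W g (simple i))" using that gn F_less by (intro rr_W rr_simple) auto
    then show ?thesis using g(2)[OF that] h_int[of "W g (simple i)"] by (auto elim!: Ints_cases)
  qed
  \<comment> \<open>Pulled back by \<open>g\<close>, \<open>simple k\<close> becomes a finite root
    \<open>b\<close> of value 1. Each finite simple root has value at least 1, so \<open>b\<close>
    has height at most 1 and is simple.\<close>
  have ex: "\<exists>i t. i \<in> F \<and> W g (simple i) = simple k + t \<odot> \<delta>" if k: "k < n" "k \<noteq> j" for k
  proof -
    define b where "b = bar (W (rev g) (simple k))"
    have rb: "rr b" unfolding b_def using gn k by (intro rr_bar rr_W rr_simple) auto
    have b0: "b aff = 0" by (simp add: b_def)
    obtain t where t: "W g b = simple k + t \<odot> \<delta>"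
    proof
      show "W g b = simple k + (- W (rev g) (simple k) aff) \<odot> \<delta>"
        using gn by (simp add: b_def bar_def W_diff W_sm W_delta W_rev' sm_minus)
    qed
    have lin: "linear_fn (\<lambda>x. h (W g x))" using gn h_lin by (simp add: linear_fn_def W_add W_sm)
    have sum1: "(\<Sum>i<n. b i * h (W g (simple i))) = 1"
      using linear_fn_expand[OF lin rrD(1)[OF rb]] t h_simple[OF k] h_delta by (simp add: linear_fnD[OF h_lin])
    have "pos b"
    proof (rule ccontr)
      assume "\<not> pos b"
      then have nb: "pos (- b)" using rr_not_pos[OF rb] by simp
      have "(\<Sum>i<n. b i * h (W g (simple i))) \<le> 0"
      proof (rule sum_nonpos)
        fix i assume "i \<in> {..<n}"
        then show "b i * h (W g (simple i)) \<le> 0" using b0 hg[of i] posD[OF nb, of i]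
          by (cases "i = aff") (auto simp: F_def mult_le_0_iff vec_simps)
      qed
      then show False using sum1 by simp
    qed
    have "height n b \<le> (\<Sum>i<n. b i * h (W g (simple i)))" unfolding height_def
    proof (rule sum_mono)
      fix i assume "i \<in> {..<n}"
      then show "b i \<le> b i * h (W g (simple i))" using b0 hg[of i] posD[OF \<open>pos b\<close>, of i]
        by (cases "i = aff") (auto simp: F_def mult_le_cancel_left1)
    qed
    then obtain i where i: "i < n" "b = simple i"
      using height_one_simple[OF rrD(1)[OF rb] \<open>pos b\<close> rrD(2)[OF rb] rrD(6)[OF rb]] sum1 by auto
    have "i \<in> F" using i b0 by (auto simp: F_def simple_apply vec_simps)
    then show ?thesis using t i by blast
  qed
  let ?thj = "\<delta> - simple j" and ?th = "\<delta> - simple aff"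
  \<comment> \<open>The image of \<open>?th\<close>, normalized at \<open>j\<close>. It and
    \<open>?thj\<close> have equal norm and are both dominant for the nodes other than
    \<open>j\<close>; this determines them.\<close>
  define b where "b = bj (W g ?th)"
  have thj: "rr ?thj" "pos ?thj" "E ?thj ?thj = d aff" and th: "rr ?th" "E ?th ?th = d aff"
    using rr_theta[OF j] rr_theta[of aff] by auto
  have rb: "rr b" unfolding b_def using gn th by (intro rr_bj rr_W)
  have b_eq: "b = W g ?th + (- W g ?th j) \<odot> \<delta>" by (simp add: b_def bj_def sm_minus)
  have Ebb: "E b b = d aff" unfolding b_eq E_delta_shift using gn th(2) by (simp add: E_W)
  have dom: "K (simple k) b \<ge> 0" if k: "k < n" "k \<noteq> j" for k
  proof -
    obtain i t where i: "i \<in> F" "W g (simple i) = simple k + t \<odot> \<delta>" using ex[OF k] by blast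
    have "K (simple k) b = K (simple k + t \<odot> \<delta>) (W g ?th)" by (simp add: b_eq K_linear)
    also have "\<dots> = K (simple i) ?th" using gn by (simp add: K_W flip: i(2))
    also have "\<dots> = - K (simple i) (simple aff)" by (simp add: K_linear)
    also have "\<dots> = - (d i * of_int (A i aff))"
      using i(1) by (simp add: K_simple matvec_def F_def simple_apply vec_simps if_distrib cong: if_cong)
    also have "\<dots> \<ge> 0" using i(1) A_off[of i aff] d_pos[of i] by (simp add: F_def mult_le_0_iff)
    finally show ?thesis .
  qed
  have domj: "K (simple k) ?thj \<ge> 0" if "k < n" "k \<noteq> j" for k
  proof -
    have "K (simple k) ?thj = - (d k * of_int (A k j))"
      using that j by (simp add: K_linear K_simple matvec_def simple_apply vec_simps if_distrib cong: if_cong)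
    then show ?thesis using A_off[of k j] d_pos[of k] that j by (simp add: mult_le_0_iff)
  qed
  have expand: "K v w = (\<Sum>k<n. v k * K (simple k) w)" if "supported n v" for v w
    using linear_fn_expand[of "\<lambda>v. K v w" n v] that by (simp add: linear_fn_def K_linear)
  have pair: "K v w \<ge> 0" if "supported n v" "pos v" "v j = 0" "\<And>k. k < n \<Longrightarrow> k \<noteq> j \<Longrightarrow> K (simple k) w \<ge> 0" for v w
    unfolding expand[OF that(1)]
  proof (rule sum_nonneg)
    fix k assume "k \<in> {..<n}"
    then show "0 \<le> v k * K (simple k) w" using that(3) that(4)[of k] posD[OF that(2), of k] by (cases "k = j") auto
  qed
  have thj0: "?thj j = 0" using j by (simp add: simple_apply vec_simps)
  have bj0: "b j = 0" using j by (simp add: b_def bj_def vec_simps)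
  have sth: "supported n ?thj" using j by simp
  have "K ?thj b \<ge> 0" using pair[OF sth thj(2) thj0] dom by blast
  moreover have "K ?thj b \<noteq> 0"
  proof
    assume "K ?thj b = 0"
    then have "(\<Sum>k<n. ?thj k * K (simple k) b) = 0" by (simp add: expand[OF sth])
    then have z: "?thj k * K (simple k) b = 0" if "k < n" for k
    proof (subst (asm) sum_nonneg_eq_0_iff)
      show "0 \<le> ?thj k * K (simple k) b" if "k \<in> {..<n}" for k
        using dom[of k] posD[OF thj(2), of k] thj0 that by (cases "k = j") auto
    qed (use that in auto)
    have zk: "K (simple k) b = 0" if "k < n" "k \<noteq> j" for k
      using z[OF that(1)] delta_pos[OF that(1)] that(2) by (auto simp: simple_apply vec_simps)
    have "K b b = (\<Sum>k<n. b k * K (simple k) b)" using expand rrD(1)[OF rb] by blast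
    also have "\<dots> = 0" using zk bj0 by (intro sum.neutral) (metis lessThan_iff mult_eq_0_iff)
    finally show False using Ebb d_pos[of aff] by (simp add: K_self)
  qed
  ultimately have Kp: "K ?thj b / d aff > 0" using d_pos[of aff] by simp
  have "K ?thj b / d aff \<in> \<int>" using rr_rr_int(3)[OF thj(1) rb] thj(3) by simp
  moreover have "K ?thj b / d aff \<le> 2"
  proof -
    have "0 \<le> E (?thj - b) (?thj - b)" by (rule E_psd)
    also have "\<dots> = E ?thj ?thj + E b b - K ?thj b" by (simp only: E_linear K_def algebra_simps)
    finally show ?thesis using thj(3) Ebb d_pos[of aff] by (simp add: divide_simps)
  qed
  \<comment> \<open>Value 2 means that the difference has norm 0. Value 1 makes the difference a
    root, and whichever sign it has contradicts the dominance of \<open>b\<close> or of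
    \<open>?thj\<close>.\<close>
  ultimately have "K ?thj b / d aff = 1 \<or> K ?thj b / d aff = 2" using Kp int_one_two by blast
  then have "b = ?thj"
  proof
    assume "K ?thj b / d aff = 2"
    then have k2: "K ?thj b = 2 * d aff" using d_pos[of aff] by (simp add: field_simps)
    have "E (?thj - b) (?thj - b) = E ?thj ?thj + E b b - K ?thj b" by (simp only: E_linear K_def algebra_simps)
    then have "E (?thj - b) (?thj - b) = 0" using k2 thj(3) Ebb by simp
    then have e: "?thj - b = (?thj - b) aff \<odot> \<delta>" using sth rrD(1)[OF rb] by (intro E_zero_imp) auto
    have "(?thj - b) j = 0" using thj0 bj0 by (simp only: minus_apply)
    then have "(?thj - b) aff * \<delta> j = 0" by (metis e sm_apply)
    then have "(?thj - b) aff = 0" using j by simp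
    then have "?thj - b = 0" using e by simp
    then show ?thesis by simp
  next
    assume "K ?thj b / d aff = 1"
    then have k1: "K ?thj b = d aff" using d_pos[of aff] by (simp add: field_simps)
    define r where "r = ?thj - b"
    have "rf b ?thj = r" using k1 Ebb d_pos[of aff] by (simp add: rf_def r_def K_sym[of b])
    then have rr: "rr r" using rr_rf[OF rb thj(1)] by simp
    have r0: "r j = 0" using thj0 bj0 by (simp only: r_def minus_apply)
    have "K r b = - d aff" "K (- r) ?thj = - d aff"
      using k1 Ebb thj(3) K_self[of ?thj] K_self[of b] K_sym[of b ?thj] unfolding r_def
      by (simp_all only: K_linear minus_diff_eq)
    moreover have "K r b \<ge> 0 \<or> K (- r) ?thj \<ge> 0"
      using rr_pos_or_neg[OF rr] pair[of r b] pair[of "- r" ?thj] dom domj rrD(1)[OF rr] r0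
      by (auto simp: uminus_apply)
    ultimately show ?thesis using d_pos[of aff] by auto
  qed
  then obtain t where "W g ?th = ?thj + t \<odot> \<delta>"
    using b_eq that[of "W g ?th j"] by (simp add: sm_minus algebra_simps)
  moreover have "W g ?th = \<delta> - W g (simple aff)" using gn by (simp add: W_diff W_delta)
  ultimately have "\<delta> - W g (simple aff) = \<delta> - simple j + t \<odot> \<delta>" by simp
  then have gaff: "W g (simple aff) = simple j + (- t) \<odot> \<delta>" by (simp add: sm_minus algebra_simps)
  have "\<forall>k. \<exists>i. k < n \<longrightarrow> i < n \<and> (k = j \<longrightarrow> i = aff) \<and> (\<exists>t. W g (simple i) = simple k + t \<odot> \<delta>)"
  proof
    fix k show "\<exists>i. k < n \<longrightarrow> i < n \<and> (k = j \<longrightarrow> i = aff) \<and> (\<exists>t. W g (simple i) = simple k + t \<odot> \<delta>)"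
      using ex[of k] gaff F_less aff_less by (cases "k = j") blast+
  qed
  then obtain \<pi> where \<pi>: "\<And>k. k < n \<Longrightarrow> \<pi> k < n" "\<pi> j = aff" "\<And>k. k < n \<Longrightarrow> \<exists>t. W g (simple (\<pi> k)) = simple k + t \<odot> \<delta>"
    using j(1) by metis
  have inj: "inj_on \<pi> {..<n}"
  proof (rule inj_onI)
    fix k l assume kl: "k \<in> {..<n}" "l \<in> {..<n}" "\<pi> k = \<pi> l"
    obtain s t where "W g (simple (\<pi> k)) = simple k + s \<odot> \<delta>" "W g (simple (\<pi> l)) = simple l + t \<odot> \<delta>" using \<pi>(3) kl by blast
    then have "simple k = simple l + (t - s) \<odot> \<delta>" using kl(3) by (simp add: sm_distribs algebra_simps)
    then show "k = l" using simple_mod_delta kl by blast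
  qed
  have bij: "bij_betw \<pi> {..<n} {..<n}"
    unfolding bij_betw_def using inj \<pi>(1) by (metis card_image card_subset_eq finite_lessThan image_subsetI lessThan_iff)
  have Kpi: "K (simple (\<pi> k)) (simple (\<pi> l)) = K (simple k) (simple l)" if kl: "k < n" "l < n" for k l
  proof -
    obtain s t where "W g (simple (\<pi> k)) = simple k + s \<odot> \<delta>" "W g (simple (\<pi> l)) = simple l + t \<odot> \<delta>" using \<pi>(3) kl by blast
    then show ?thesis using K_W[OF gn(1), of "simple (\<pi> k)" "simple (\<pi> l)"] by (simp add: K_linear)
  qed
  have Ks: "K (simple k) (simple l) = d k * of_int (A k l)" if "k < n" "l < n" for k l
    using that by (simp add: K_simple matvec_def simple_apply vec_simps if_distrib cong: if_cong)
  \<comment> \<open>The diagonal of the preserved form recovers \<open>d\<close>, and then its other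
    entries recover \<open>A\<close>.\<close>
  have dpi: "d (\<pi> k) = d k" if "k < n" for k
    using Kpi[OF that that] Ks[OF that that] Ks[OF \<pi>(1) \<pi>(1), OF that that] A_diag[OF that] A_diag[OF \<pi>(1)[OF that]] by simp
  have "A (\<pi> k) (\<pi> l) = A k l" if "k < n" "l < n" for k l
    using Kpi[OF that] Ks[OF that] Ks[OF \<pi>(1) \<pi>(1), OF that] dpi[OF that(1)] d_pos[OF that(1)] by simp
  then show ?thesis using bij \<pi>(2) by (auto simp: diagram_aut_def)
qed

end

section \<open>Cones\<close>

inductive_set cone :: "vec set \<Rightarrow> vec set" for P where
  zero: "0 \<in> cone P"
| add: "v \<in> cone P \<Longrightarrow> p \<in> P \<Longrightarrow> a \<ge> 0 \<Longrightarrow> v + a \<odot> p \<in> cone P"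

lemma cone_base: "p \<in> P \<Longrightarrow> p \<in> cone P"
  using cone.add[OF cone.zero, of p P 1] by simp

lemma cone_add: assumes "u \<in> cone P" "v \<in> cone P" shows "u + v \<in> cone P"
  using assms(2)
proof induction
  case zero
  then show ?case using assms(1) by simp
next
  case (add v p a)
  then show ?case using cone.add[of "u + v" P p a] by (simp add: add.assoc)
qed

lemma cone_sm: assumes "u \<in> cone P" "t \<ge> 0" shows "t \<odot> u \<in> cone P"
  using assms(1)
proof induction
  case zero
  then show ?case by (simp add: cone.zero)
next
  case (add v p a)
  then show ?case using cone.add[of "t \<odot> v" P p "t * a"] assms(2) by (simp add: sm_distribs)
qed

lemma cone_sum: "(\<And>x. x \<in> X \<Longrightarrow> f x \<in> cone P) \<Longrightarrow> (\<Sum>x\<in>X. f x) \<in> cone P"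
  by (induction X rule: infinite_finite_induct) (auto simp: cone.zero cone_add)

lemma cone_pos: assumes "v \<in> cone P" "\<And>p. p \<in> P \<Longrightarrow> pos p" shows "pos v"
  using assms(1) by induction (simp_all add: assms(2) pos_add pos_sm, simp add: pos_def zero_fun_apply)

lemma cone_supported: assumes "v \<in> cone P" "\<And>p. p \<in> P \<Longrightarrow> supported n p" shows "supported n v"
  using assms(1) by induction (auto simp: assms(2))

lemma cone_fn_nonpos: assumes "v \<in> cone P" "linear_fn f" "\<And>p. p \<in> P \<Longrightarrow> f p \<le> 0" shows "f v \<le> 0"
  using assms(1) by induction (auto simp: linear_fnD[OF assms(2)] intro!: add_nonpos_nonpos mult_nonneg_nonpos assms(3))

lemma cone_fn_zero: assumes "v \<in> cone P" "linear_fn f" "\<And>p. p \<in> P \<Longrightarrow> f p = 0" shows "f v = 0"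
  using assms(1) by induction (auto simp: assms(3) linear_fnD[OF assms(2)])

lemma cone_split: assumes "v \<in> cone (X \<union> Y)" shows "\<exists>x\<in>cone X. \<exists>y\<in>cone Y. v = x + y"
  using assms
proof induction
  case zero
  then show ?case using cone.zero by (intro bexI[of _ 0]) auto
next
  case (add v p a)
  then obtain x y where xy: "x \<in> cone X" "y \<in> cone Y" "v = x + y" by blast
  show ?case
  proof (cases "p \<in> X")
    case True
    then show ?thesis using xy cone.add[of x X p a] add.hyps by (intro bexI[of _ "x + a \<odot> p"] bexI[of _ y]) (auto simp: algebra_simps)
  next
    case False
    then show ?thesis using xy cone.add[of y Y p a] add.hyps by (intro bexI[of _ x] bexI[of _ "y + a \<odot> p"]) (auto simp: algebra_simps)
  qed
qed

lemma cone_coord_zero: assumes "v \<in> cone P" "\<And>p. p \<in> P \<Longrightarrow> pos p" "v i = 0" shows "v \<in> cone {p \<in> P. p i = 0}"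
  using assms(1,3)
proof induction
  case zero
  show ?case by (rule cone.zero)
next
  case (add v p a)
  have "v i \<ge> 0" "p i \<ge> 0" using cone_pos[OF add.hyps(1) assms(2)] assms(2)[OF add.hyps(2)] by (auto simp: pos_def)
  moreover have "v i + a * p i = 0" using add.prems by (simp add: vec_simps)
  ultimately have v: "v i = 0" "a * p i = 0" using add.hyps(3) by (simp_all add: add_nonneg_eq_0_iff)
  then show ?case using add cone.add[of v "{p \<in> P. p i = 0}" p a] by (cases "a = 0") auto
qed

lemma cone_coeffs: assumes "v \<in> cone (g ` {..<k::nat})" shows "\<exists>a. (\<forall>i. a i \<ge> 0) \<and> v = (\<Sum>i<k. a i \<odot> g i)"
  using assms
proof induction
  case zero
  show ?case by (intro exI[of _ "\<lambda>_. 0"] conjI) (auto intro: sum.neutral[symmetric])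
next
  case (add v p t)
  then obtain a j where a: "\<forall>i. a i \<ge> 0" "v = (\<Sum>i<k. a i \<odot> g i)" "j < k" "p = g j" by auto
  have "(\<Sum>i<k. (a i + (if i = j then t else 0)) \<odot> g i) = v + (\<Sum>i<k. if i = j then t \<odot> g j else 0)"
    unfolding a(2) sum.distrib[symmetric] by (intro sum.cong refl) (auto simp: sm_distribs)
  also have "\<dots> = v + t \<odot> p" using a(3,4) by simp
  finally show ?case using a(1) add.hyps(3) by (intro exI[of _ "\<lambda>i. a i + (if i = j then t else 0)"]) auto
qed

lemma cone_singleton: "v \<in> cone {q} \<Longrightarrow> \<exists>t\<ge>0. v = t \<odot> q"
proof (induction rule: cone.induct)
  case zero
  show ?case by (rule exI[of _ 0]) simp
next
  case (add v p a)
  then obtain t where "t \<ge> 0" "v = t \<odot> q" by blast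
  then show ?case using add.hyps by (intro exI[of _ "t + a"]) (auto simp: sm_distribs)
qed

context affine_data
begin

section \<open>The simple roots of the tubes\<close>

text \<open>Indecomposable positive real roots of U: the two conditions exclude a real and an
  imaginary complement \<open>p - q\<close>. They are identified with \<open>Pi_c\<close> in
  \<open>Pi_c_eq\<close>; this form is directly compatible with \<open>c\<close>.\<close>

definition P0 :: "vec set" where
  "P0 = {p \<in> S. \<forall>q\<in>S. p - q \<notin> S \<and> (\<forall>m. m \<in> \<int> \<longrightarrow> m > 0 \<longrightarrow> p - q \<noteq> m \<odot> \<delta>)}"

lemma P0_S: "p \<in> P0 \<Longrightarrow> p \<in> S"
  by (simp add: P0_def)

lemma SD: "b \<in> S \<Longrightarrow> rr b" "b \<in> S \<Longrightarrow> pos b" "b \<in> S \<Longrightarrow> E b \<delta> = 0"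
  "b \<in> S \<Longrightarrow> supported n b" "b \<in> S \<Longrightarrow> E b b > 0" "b \<in> S \<Longrightarrow> b \<noteq> 0" "b \<in> S \<Longrightarrow> E \<delta> b = 0"
  using rrD by (auto simp: S_def E_delta_left)

lemma SI: "rr b \<Longrightarrow> pos b \<Longrightarrow> E b \<delta> = 0 \<Longrightarrow> b \<in> S"
  by (simp add: S_def)

lemma P0_pos: "p \<in> P0 \<Longrightarrow> pos p"
  using P0_S SD by blast

lemma S_height: assumes "b \<in> S" shows "height n b \<ge> 1"
proof -
  have "height n b > 0" using height_pos SD assms by blast
  moreover have "height n b \<in> \<int>" unfolding height_def using rrD(2)[OF SD(1)[OF assms]] by (intro Ints_sum)
  ultimately show ?thesis by (auto elim!: Ints_cases)
qed

lemma delta_height: "height n \<delta> \<ge> 1"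
proof -
  have "\<delta> \<noteq> 0" using delta_aff by (metis zero_fun_apply zero_neq_one)
  then have "height n \<delta> > 0" using height_pos[OF pos_delta delta_supp] by blast
  moreover have "height n \<delta> \<in> \<int>" unfolding height_def using delta_int by (intro Ints_sum)
  ultimately show ?thesis by (auto elim!: Ints_cases)
qed

lemma ci_linear: "ci (x - y) = ci x - ci y" "ci (t \<odot> x) = t \<odot> ci x"
proof -
  have "c (ci (x - y)) = c (ci x - ci y)" "c (ci (t \<odot> x)) = c (t \<odot> ci x)" by (simp_all add: c_linear)
  then show "ci (x - y) = ci x - ci y" "ci (t \<odot> x) = t \<odot> ci x" by (simp_all only: c_inj)
qed

lemma P0_c: assumes "p \<in> P0" shows "c p \<in> P0"
proof -
  have "c p - q \<notin> S \<and> (\<forall>m. m \<in> \<int> \<longrightarrow> m > 0 \<longrightarrow> c p - q \<noteq> m \<odot> \<delta>)" if "q \<in> S" for q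
  proof -
    have "p - ci q = ci (c p - q)" by (simp add: ci_linear)
    moreover have "p - ci q \<notin> S" "\<And>m. m \<in> \<int> \<Longrightarrow> m > 0 \<Longrightarrow> p - ci q \<noteq> m \<odot> \<delta>"
      using assms S_ci[OF that] by (auto simp: P0_def)
    ultimately show ?thesis using S_ci by (metis ci_linear(2) ci_delta)
  qed
  then show ?thesis using S_c[OF P0_S[OF assms]] by (simp add: P0_def)
qed

lemma P0_cp: "p \<in> P0 \<Longrightarrow> cp i p \<in> P0"
  by (induction i) (simp_all add: P0_c)

text \<open>If the pairing were positive, a Cartan integer equal to 1 would make the difference a
  real root, and two Cartan integers of at least 2 would make it a multiple of \<delta>;
  indecomposability excludes both.\<close>

lemma P0_K_nonpos: assumes "p \<in> P0" "q \<in> P0" "p \<noteq> q" shows "K p q \<le> 0"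
proof (rule ccontr)
  assume "\<not> K p q \<le> 0"
  then have Kp: "K p q > 0" by simp
  have S: "p \<in> S" "q \<in> S" using assms P0_S by auto
  have ge: "r \<noteq> 1 \<Longrightarrow> r \<ge> 2" if "r \<in> \<int>" "r > 0" for r :: real using that by (auto elim!: Ints_cases)
  have d: "False" if "x \<in> P0" "y \<in> P0" "rr (x - y)" for x y
  proof -
    have "E (x - y) \<delta> = 0" "E (y - x) \<delta> = 0" using that P0_S SD(3) by (auto simp: E_linear)
    then have "x - y \<in> S \<or> y - x \<in> S" using rr_pos_or_neg[OF that(3)] rr_uminus[OF that(3)] that(3) SI by auto
    then show False using that(1,2) P0_S unfolding P0_def by blast
  qed
  have s: "K p q / E p p \<in> \<int>" "K p q / E p p > 0" "K p q / E q q \<in> \<int>" "K p q / E q q > 0"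
    using rr_rr_int(3)[OF SD(1)[OF S(1)] SD(1)[OF S(2)]] rr_rr_int(4)[OF SD(1)[OF S(2)] SD(1)[OF S(1)]] Kp SD(5) S by auto
  have "K p q / E p p \<noteq> 1"
  proof
    assume "K p q / E p p = 1"
    then have "rf p q = q - p" by (simp add: rf_def)
    then show False using rr_rf[of p q] SD(1) S d assms by metis
  qed
  moreover have "K p q / E q q \<noteq> 1"
  proof
    assume "K p q / E q q = 1"
    then have "rf q p = p - q" by (simp add: rf_def K_sym[of q p])
    then show False using rr_rf[of q p] SD(1) S d assms by metis
  qed
  ultimately have "K p q / E p p \<ge> 2" "K p q / E q q \<ge> 2" using ge s by blast+
  then have "K p q \<ge> 2 * E p p" "K p q \<ge> 2 * E q q" using SD(5)[OF S(1)] SD(5)[OF S(2)] by (simp_all add: pos_le_divide_eq)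
  moreover have "E (p - q) (p - q) = E p p + E q q - K p q" by (simp only: E_linear K_def algebra_simps)
  ultimately have "E (p - q) (p - q) = 0" using E_psd[of "p - q"] by linarith
  then have e: "p - q = (p - q) aff \<odot> \<delta>" using SD(4) S by (intro E_zero_imp) auto
  define m where "m = (p - q) aff"
  have m: "m \<in> \<int>" unfolding m_def using rrD(2) SD(1) S by (simp add: minus_apply)
  have pq: "p - q = m \<odot> \<delta>" using e by (simp add: m_def)
  then have "q - p = (- m) \<odot> \<delta>" by (metis minus_diff_eq sm_minus(1))
  moreover have "m \<noteq> 0" using pq assms(3) by auto
  ultimately show False using pq m assms(1,2) S unfolding P0_def
    by (smt (verit) Ints_minus mem_Collect_eq)
qed

lemma S_decompose: assumes "b \<in> S" "b \<notin> P0"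
  obtains q where "q \<in> S" "height n q \<le> height n b - 1" "b - q \<in> S \<and> height n (b - q) \<le> height n b - 1 \<or> (\<exists>m>0. b - q = m \<odot> \<delta>)"
proof -
  obtain q where q: "q \<in> S" "b - q \<in> S \<or> (\<exists>m. m \<in> \<int> \<and> m > 0 \<and> b - q = m \<odot> \<delta>)"
    using assms by (auto simp: P0_def)
  from q(2) show ?thesis
  proof
    assume "b - q \<in> S"
    then show ?thesis using that[of q] q(1) S_height[of q] S_height[of "b - q"] by (simp add: height_linear)
  next
    assume "\<exists>m. m \<in> \<int> \<and> m > 0 \<and> b - q = m \<odot> \<delta>"
    then obtain m where m: "m \<in> \<int>" "m > 0" "b - q = m \<odot> \<delta>" by blast
    have "m \<ge> 1" using m by (auto elim!: Ints_cases)
    then have "m * height n \<delta> \<ge> 1" using delta_height by (metis mult_mono' mult_1 zero_le_one order_trans)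
    moreover have "height n b - height n q = m * height n \<delta>" using arg_cong[OF m(3), of "height n"] by (simp add: height_linear)
    ultimately show ?thesis using that[of q] q(1) m by auto
  qed
qed

lemma S_imp_P0: assumes "b \<in> S" shows "P0 \<noteq> {}"
proof -
  have "P0 \<noteq> {}" if "b \<in> S" "height n b \<le> real N" for N b
    using that
  proof (induction N arbitrary: b)
    case 0
    then show ?case using S_height[of b] by simp
  next
    case (Suc N)
    show ?case
    proof (cases "b \<in> P0")
      case False
      then obtain q where "q \<in> S" "height n q \<le> height n b - 1" using S_decompose Suc.prems by metis
      then show ?thesis using Suc by (simp add: Suc.IH[of q])
    qed auto
  qed
  then show ?thesis using assms real_arch_simple by blast
qed

section \<open>Periods and orbit sums of tube roots\<close>

definition per :: "vec \<Rightarrow> nat" where "per p = (LEAST k. k > 0 \<and> cp k p = p)"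
text \<open>The orbit sum is a multiple of \<delta> by \<open>orbit_mu\<close>, and \<delta> has
  coefficient 1 at \<open>aff\<close>, so this coordinate is the multiple.\<close>

definition mu :: "vec \<Rightarrow> real" where "mu p = (\<Sum>i<per p. cp i p) aff"
definition orb :: "vec \<Rightarrow> vec set" where "orb p = range (\<lambda>i. cp i p)"

lemma per: assumes "p \<in> S" shows per_pos: "per p > 0" and cp_per [simp]: "cp (per p) p = p"
  using LeastI_ex[of "\<lambda>k. k > 0 \<and> cp k p = p"] orbit_periodic[OF SD(1)[OF assms] SD(3)[OF assms]]
  by (auto simp: per_def)

lemma per_least: "k > 0 \<Longrightarrow> k < per p \<Longrightarrow> cp k p \<noteq> p"
  unfolding per_def using not_less_Least by blast

lemma cp_add: "cp (i + j) x = cp i (cp j x)"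
  by (simp add: funpow_add)

lemma cp_mod_per: assumes "p \<in> S" shows "cp (i mod per p) p = cp i p"
proof -
  have "cp (j * per p) p = p" for j
    by (induction j) (simp_all add: cp_add assms)
  then have "cp (i mod per p + i div per p * per p) p = cp (i mod per p) p" by (simp only: cp_add)
  then show ?thesis by simp
qed

lemma orb_eq: assumes "p \<in> S" shows "orb p = (\<lambda>i. cp i p) ` {..<per p}"
proof
  show "orb p \<subseteq> (\<lambda>i. cp i p) ` {..<per p}"
    unfolding orb_def using cp_mod_per[OF assms] per_pos[OF assms]
    by (metis (mono_tags, lifting) image_eqI image_subsetI lessThan_iff mod_less_divisor)
qed (auto simp: orb_def)

lemma orb_refl [simp]: "p \<in> orb p"
  unfolding orb_def by (rule range_eqI[of _ _ 0]) simp

lemma orb_c: "q \<in> orb p \<Longrightarrow> c q \<in> orb p"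
  unfolding orb_def by (auto intro: range_eqI[of _ _ "Suc _"])

lemma orb_cp: "q \<in> orb p \<Longrightarrow> cp i q \<in> orb p"
  by (induction i) (simp_all add: orb_c)

lemma orb_sym: assumes "p \<in> S" "q \<in> orb p" shows "p \<in> orb q"
proof -
  obtain i where i: "i < per p" "q = cp i p" using assms by (auto simp: orb_eq)
  then have "cp (per p - i) q = p" using assms(1) by (simp flip: cp_add)
  then show ?thesis unfolding orb_def by (metis rangeI)
qed

lemma orb_trans: "q \<in> orb p \<Longrightarrow> r \<in> orb q \<Longrightarrow> r \<in> orb p"
  unfolding orb_def by (auto simp flip: cp_add)

lemma orb_P0: "p \<in> P0 \<Longrightarrow> q \<in> orb p \<Longrightarrow> q \<in> P0"
  by (auto simp: orb_def P0_cp)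

lemma orb_eqI: "p \<in> S \<Longrightarrow> q \<in> orb p \<Longrightarrow> orb q = orb p"
  using orb_trans orb_sym by blast

lemma cp_distinct: assumes "p \<in> S" "i < per p" "j < per p" "cp i p = cp j p" shows "i = j"
proof -
  have "False" if "i < j" "j < per p" "cp i p = cp j p" for i j
  proof -
    have "cp i (cp (j - i) p) = cp i p" using that by (simp flip: cp_add)
    then have "cp (j - i) p = p" by (simp add: cp_inj)
    then show False using per_least[of "j - i" p] that by simp
  qed
  then show ?thesis using assms by (metis nat_neq_iff)
qed

text \<open>The orbit sum is fixed by \<open>c\<close>, hence a multiple of \<delta>; comparing
  heights gives the sign.\<close>

lemma orbit_mu: assumes "p \<in> S" shows "(\<Sum>i<per p. cp i p) = mu p \<odot> \<delta>" and mu_pos: "mu p > 0"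
proof -
  define T where "T = (\<Sum>i<per p. cp i p)"
  have "cp (per p) p = p + 0 \<odot> \<delta>" using cp_per[OF assms] by simp
  from orbit_sum(1)[OF this T_def] have "c T = T" by simp
  moreover have s: "supported n T" unfolding T_def using SD(4)[OF S_cp[OF assms]] by (intro supported_sum)
  ultimately have T: "T = T aff \<odot> \<delta>" by (intro c_fixed)
  then show 1: "(\<Sum>i<per p. cp i p) = mu p \<odot> \<delta>" by (simp add: T_def mu_def)
  have ht: "height n (\<Sum>i<k. cp i p) \<ge> real k" for k
  proof (induction k)
    case (Suc k)
    then show ?case using S_height[OF S_cp[OF assms, of k]] by (simp add: height_linear)
  qed (simp add: height_def zero_fun_apply)
  have "mu p * height n \<delta> \<ge> real (per p)" using ht[of "per p"] 1 by (simp add: height_linear)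
  moreover have "real (per p) > 0" using per_pos[OF assms] by simp
  ultimately have "mu p * height n \<delta> > 0" by linarith
  then show "mu p > 0" using delta_height by (simp add: zero_less_mult_iff)
qed

lemma delta_cone: assumes "P0 \<noteq> {}" shows "\<delta> \<in> cone P0"
proof -
  obtain p where p: "p \<in> P0" using assms by blast
  have "mu p \<odot> \<delta> \<in> cone P0" unfolding orbit_mu(1)[OF P0_S[OF p], symmetric]
    using P0_cp[OF p] by (intro cone_sum cone_base)
  then have "(1 / mu p) \<odot> mu p \<odot> \<delta> \<in> cone P0" 
    using mu_pos[OF P0_S[OF p]] cone_sm[of "mu p \<odot> \<delta>" P0 "1 / mu p"] by simp
  then show ?thesis using mu_pos[OF P0_S[OF p]] by simp
qed

lemma S_cone: assumes "b \<in> S" shows "b \<in> cone P0"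
proof -
  have "b \<in> cone P0" if "b \<in> S" "height n b \<le> real N" for N b
    using that
  proof (induction N arbitrary: b)
    case 0
    then show ?case using S_height[of b] by simp
  next
    case (Suc N)
    show ?case
    proof (cases "b \<in> P0")
      case False
      then obtain q where q: "q \<in> S" "height n q \<le> height n b - 1"
          "b - q \<in> S \<and> height n (b - q) \<le> height n b - 1 \<or> (\<exists>m>0. b - q = m \<odot> \<delta>)"
        using S_decompose Suc.prems by metis
      have qc: "q \<in> cone P0" using Suc q by (simp add: Suc.IH[of q])
      have "b - q \<in> cone P0" using q(3)
      proof
        assume "b - q \<in> S \<and> height n (b - q) \<le> height n b - 1"
        then show ?thesis using Suc by (simp add: Suc.IH[of "b - q"])
      next
        assume "\<exists>m>0. b - q = m \<odot> \<delta>"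
        then obtain m where "m > 0" "b - q = m \<odot> \<delta>" by blast
        then show ?thesis using delta_cone S_imp_P0[OF Suc.prems(1)] cone_sm[of \<delta> P0 m] by simp
      qed
      then have "q + (b - q) \<in> cone P0" using qc cone_add by blast
      then show ?thesis by simp
    qed (simp add: cone_base)
  qed
  then show ?thesis using assms real_arch_simple by blast
qed

section \<open>The cone of tube roots and reflections in its extremal rays\<close>

lemma linear_K: "linear_fn (K x)" "linear_fn (\<lambda>v. K v x)" and linear_E: "linear_fn (E x)" "linear_fn (\<lambda>v. E v x)"
  by (simp_all add: linear_fn_def K_linear E_linear)

text \<open>Write both vectors as a multiple of \<open>q\<close> plus a combination of the other
  generators. The latter pair nonpositively with \<open>q\<close>, so their total is a nonpositive
  multiple of \<open>q\<close>, and positivity forces it to be 0.\<close>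

lemma P0_extremal: assumes "q \<in> P0" "u \<in> cone P0" "v \<in> cone P0" "u + v = s \<odot> q"
  shows "\<exists>t\<ge>0. u = t \<odot> q"
proof -
  have P: "P0 = {q} \<union> (P0 - {q})" using assms(1) by auto
  obtain x u' where u: "x \<in> cone {q}" "u' \<in> cone (P0 - {q})" "u = x + u'" using cone_split[of u "{q}" "P0 - {q}"] P assms(2) by auto
  obtain y v' where v: "y \<in> cone {q}" "v' \<in> cone (P0 - {q})" "v = y + v'" using cone_split[of v "{q}" "P0 - {q}"] P assms(3) by auto
  obtain a b where ab: "a \<ge> 0" "x = a \<odot> q" "y = b \<odot> q" using cone_singleton u(1) v(1) by blast
  define r where "r = s - a - b"
  have "u' + v' = s \<odot> q - x - y" using assms(4) u(3) v(3) by (simp add: algebra_simps)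
  then have w: "u' + v' = r \<odot> q" using ab by (simp add: r_def sm_distribs)
  have "K q (u' + v') \<le> 0" by (rule cone_fn_nonpos[OF cone_add[OF u(2) v(2)] linear_K(1)]) (use P0_K_nonpos assms(1) in auto)
  then have "r * (2 * E q q) \<le> 0" using w by (simp add: K_linear K_self)
  then have "r \<le> 0" using SD(5)[OF P0_S[OF assms(1)]] by (simp add: mult_le_0_iff)
  have pu: "pos u'" "pos v'" using cone_pos[OF u(2)] cone_pos[OF v(2)] P0_pos by auto
  have "r = 0"
  proof (rule ccontr)
    assume "r \<noteq> 0"
    then have "r < 0" using \<open>r \<le> 0\<close> by simp
    have "pos ((- 1 / r) \<odot> (u' + v'))" using pu \<open>r < 0\<close> by (intro pos_sm pos_add) auto
    then have "pos (- q)" using w \<open>r < 0\<close> by (simp add: sm_minus)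
    then show False using pos_neg_eq_0 P0_pos[OF assms(1)] SD(6)[OF P0_S[OF assms(1)]] by blast
  qed
  then have "u' + v' = 0" using w by simp
  then have "v' = - u'" by (metis add.commute add_eq_0_iff)
  then have "u' = 0" using pu pos_neg_eq_0 by blast
  then show ?thesis using u(3) ab by auto
qed

text \<open>Were the reflected root negative, \<open>b\<close> and \<open>- rf q b\<close> would lie
  in the cone and add up to a multiple of \<open>q\<close>; extremality makes \<open>b\<close> a
  multiple of \<open>q\<close>, hence equal to it.\<close>

lemma rf_P0_S: assumes "q \<in> P0" "b \<in> S" "b \<noteq> q" shows "rf q b \<in> S"
proof (rule ccontr)
  assume no: "rf q b \<notin> S"
  have r: "rr (rf q b)" using rr_rf SD(1) P0_S assms by blast
  have e: "E (rf q b) \<delta> = 0" using SD(3)[OF P0_S[OF assms(1)]] SD(3)[OF assms(2)] by (simp add: rf_def E_linear)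
  have "\<not> pos (rf q b)" using no r e SI by blast
  then have "- rf q b \<in> S" using rr_not_pos[OF r] rr_uminus[OF r] e by (intro SI) (auto simp: E_linear)
  then have "- rf q b \<in> cone P0" "b \<in> cone P0" using S_cone assms by auto
  moreover have "b + - rf q b = (K q b / E q q) \<odot> q" by (simp add: rf_def)
  ultimately obtain t where t: "t \<ge> 0" "b = t \<odot> q" using P0_extremal[OF assms(1)] by blast
  then have "t = 1" using rr_multiple[of q t] SD(1,2) P0_S assms by simp
  then show False using t assms(3) by simp
qed

text \<open>\<open>K b b > 0\<close> and \<open>S_cone\<close> yield some \<open>q\<close> in
  \<open>P0\<close> with \<open>K q b > 0\<close>; reflecting in it lowers the height and stays in
  \<open>S\<close>.\<close>

lemma S_induct [consumes 1, case_names base step]: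
  assumes "b \<in> S" and base: "\<And>p. p \<in> P0 \<Longrightarrow> R p"
    and step: "\<And>b q. b \<in> S \<Longrightarrow> b \<notin> P0 \<Longrightarrow> q \<in> P0 \<Longrightarrow> K q b > 0 \<Longrightarrow> rf q b \<in> S \<Longrightarrow> R (rf q b) \<Longrightarrow> R b"
  shows "R b"
proof -
  have "R b" if "b \<in> S" "height n b \<le> real N" for N b
    using that
  proof (induction N arbitrary: b)
    case 0
    then show ?case using S_height[of b] by simp
  next
    case (Suc N)
    show ?case
    proof (cases "b \<in> P0")
      case False
      have "\<exists>q\<in>P0. K q b > 0"
      proof (rule ccontr)
        assume "\<not> ?thesis"
        then have "K b b \<le> 0" using cone_fn_nonpos[OF S_cone[OF Suc.prems(1)] linear_K(2)[of b]] by fastforce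
        then show False using SD(5)[OF Suc.prems(1)] by (simp add: K_self)
      qed
      then obtain q where q: "q \<in> P0" "K q b > 0" by blast
      then have rS: "rf q b \<in> S" using rf_P0_S Suc.prems False by blast
      have "K q b / E q q \<in> \<int>" "K q b / E q q > 0"
        using rr_rr_int(3)[of q b] SD(1,5) P0_S q Suc.prems by auto
      then have "K q b / E q q \<ge> 1" by (auto elim!: Ints_cases)
      then have "(K q b / E q q) * height n q \<ge> 1" using S_height[OF P0_S[OF q(1)]] by (metis mult_mono' mult_1 zero_le_one order_trans)
      then have "height n (rf q b) \<le> real N" using Suc.prems by (simp add: rf_def height_linear)
      then show ?thesis using step[OF Suc.prems(1) False q rS] Suc.IH rS by blast
    qed (rule base)
  qed
  then show ?thesis using assms(1) real_arch_simple by blast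
qed

text \<open>By \<open>K_c\<close>, the inequality \<open>K p (cp i q) \<le> 0\<close> says that
  \<open>E p (cp i q)\<close> is nondecreasing in \<open>i\<close>. Periodicity makes it constant,
  and its sum over the orbit is a multiple of \<open>E p \<delta> = 0\<close>.\<close>

lemma E_other_orbit: assumes "p \<in> P0" "q \<in> P0" "q \<notin> orb p" shows "E p q = 0"
proof -
  have qS: "q \<in> S" using P0_S assms by blast
  have ne: "p \<noteq> cp i q" for i
  proof
    assume "p = cp i q"
    then have "p \<in> orb q" by (auto simp: orb_def)
    then show False using orb_sym[OF qS] assms(3) by blast
  qed
  have mono: "E p (cp i q) \<le> E p (cp (Suc i) q)" for i
    using P0_K_nonpos[OF assms(1) P0_cp[OF assms(2), of i] ne] K_c[of p "cp i q"] by simp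
  have mono': "E p (cp i q) \<le> E p (cp j q)" if "i \<le> j" for i j
    using lift_Suc_mono_le[of "\<lambda>i. E p (cp i q)"] mono that by blast
  have const: "E p (cp i q) = E p q" if "i < per q" for i
    using mono'[of 0 i] mono'[of i "per q"] that cp_per[OF qS] by simp
  have "real (per q) * E p q = (\<Sum>i<per q. E p (cp i q))" using const by simp
  also have "\<dots> = E p (mu q \<odot> \<delta>)" by (simp flip: orbit_mu(1)[OF qS] E_sum(2))
  also have "\<dots> = 0" using SD(3)[OF P0_S[OF assms(1)]] by (simp add: E_linear)
  finally show ?thesis using per_pos[OF qS] by simp
qed

lemma K_other_orbit: assumes "p \<in> P0" "q \<in> P0" "q \<notin> orb p" shows "K p q = 0"
  using E_other_orbit[OF assms] E_other_orbit[of q p] assms orb_sym P0_S by (auto simp: K_def)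

text \<open>A null combination of a part of an orbit would split the tube roots into two orthogonal
  sets, each preserved by every reflection of \<open>U\<close> and hence by \<open>c\<close>.\<close>

lemma orbit_connected:
  assumes p: "p \<in> P0" and a: "\<And>i. i < per p \<Longrightarrow> a i \<ge> 0" "(\<Sum>i<per p. a i \<odot> cp i p) = u \<odot> \<delta>"
    and i0: "i0 < per p" "a i0 = 0" and i1: "i1 < per p"
  shows "a i1 = 0"
proof (rule ccontr)
  assume "a i1 \<noteq> 0"
  then have a1: "a i1 > 0" using a(1)[OF i1] by simp
  have pS: "p \<in> S" using P0_S p by blast
  define I where "I = {cp i p | i. i < per p \<and> a i > 0}"
  define J where "J = P0 - I"
  have IP: "I \<subseteq> P0" using P0_cp[OF p] by (auto simp: I_def)
  \<comment> \<open>Pairing the null combination with \<open>q\<close> outside \<open>I\<close>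
    gives nonpositive terms with sum 0.\<close>
  have IJ: "K q x = 0" if q: "q \<in> J" and x: "x \<in> I" for q x
  proof -
    obtain i where i: "i < per p" "a i > 0" "x = cp i p" using x by (auto simp: I_def)
    have np: "a j * K q (cp j p) \<le> 0" if "j < per p" for j
    proof (cases "a j = 0")
      case False
      then have "cp j p \<in> I" using a(1)[OF that] that by (auto simp: I_def)
      then have "K q (cp j p) \<le> 0" using q IP by (intro P0_K_nonpos) (auto simp: J_def)
      then show ?thesis using a(1)[OF that] by (simp add: mult_nonneg_nonpos)
    qed simp
    have "(\<Sum>j<per p. - (a j * K q (cp j p))) = - K q (\<Sum>i<per p. a i \<odot> cp i p)"
      by (simp add: K_sum K_linear sum_negf)
    also have "\<dots> = 0" unfolding a(2) by (simp add: K_linear)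
    finally have "- (a i * K q (cp i p)) = 0"
      using np i(1) by (subst (asm) sum_nonneg_eq_0_iff) auto
    then show ?thesis using i by simp
  qed
  \<comment> \<open>Every step of \<open>S_induct\<close> reflects in a root of the part to which
    the smaller root already belongs, since it pairs nontrivially with it.\<close>
  have dich: "(\<forall>q\<in>J. K q b = 0) \<or> (\<forall>q\<in>I. K q b = 0)" if "b \<in> S" for b
    using that
  proof (induction rule: S_induct)
    case (base r)
    show ?case
    proof (cases "r \<in> I")
      case False
      then have "r \<in> J" using base by (simp add: J_def)
      then show ?thesis using IJ K_sym[of _ r] by simp
    qed (use IJ in blast)
  next
    case (step b q)
    have q0: "E q q \<noteq> 0" using SD(5)[OF P0_S[OF step(3)]] by simp
    have b: "b = rf q (rf q b)" using rf_rf[OF q0] by simp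
    have nz: "K q (rf q b) \<noteq> 0" using step(4) q0 by (simp add: rf_def K_linear K_self)
    have Kb: "K x b = K x (rf q b)" if "K x q = 0" for x using that by (simp add: rf_def K_linear)
    show ?case
    proof (cases "q \<in> I")
      case True
      then have "\<forall>x\<in>J. K x (rf q b) = 0" using step(6) nz by blast
      then show ?thesis using Kb IJ True by auto
    next
      case False
      then have "q \<in> J" using step by (simp add: J_def)
      then have "\<forall>x\<in>I. K x (rf q b) = 0" using step(6) nz by blast
      then show ?thesis using Kb IJ \<open>q \<in> J\<close> K_sym by metis
    qed
  qed
  have dich': "(\<forall>q\<in>J. K q b = 0) \<or> (\<forall>q\<in>I. K q b = 0)" if "rr b" "E b \<delta> = 0" for b
  proof (cases "pos b")
    case True
    then show ?thesis using dich SI that by blast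
  next
    case False
    then have "- b \<in> S" using rr_not_pos rr_uminus that by (intro SI) (auto simp: E_linear)
    then show ?thesis using dich[of "- b"] by (simp add: K_linear)
  qed
  \<comment> \<open>The \<open>J\<close>-component of a root orthogonal to \<open>J\<close> has norm
    0, so it is a multiple of \<delta>.\<close>
  have orth: "K b' b = 0" if "b \<in> S" "\<forall>q\<in>J. K q b = 0" "\<forall>q\<in>I. K q b' = 0" for b b'
  proof -
    have "P0 = I \<union> J" using IP by (auto simp: J_def)
    then have "b \<in> cone (I \<union> J)" using S_cone[OF that(1)] by simp
    then obtain x y where xy: "x \<in> cone I" "y \<in> cone J" "b = x + y" using cone_split by blast
    have "K y b = 0" using cone_fn_zero[OF xy(2) linear_K(2)] that(2) by blast
    moreover have "K y q = 0" if "q \<in> I" for q using cone_fn_zero[OF xy(2) linear_K(2)] IJ that by blast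
    then have "K y x = 0" using cone_fn_zero[OF xy(1) linear_K(1)] by blast
    ultimately have "E y y = 0" unfolding xy(3) by (simp add: K_linear K_self)
    moreover have "supported n y" using cone_supported[OF xy(2)] SD(4) P0_S by (auto simp: J_def)
    ultimately have y: "y = y aff \<odot> \<delta>" by (intro E_zero_imp)
    have "K b' y = 0" by (subst y) (simp add: K_linear)
    moreover have "K b' x = 0" using cone_fn_zero[OF xy(1) linear_K(1)] that(3) K_sym by metis
    ultimately show ?thesis using xy(3) by (simp add: K_linear)
  qed
  have orth': "K b' b = 0" if "rr b" "E b \<delta> = 0" "\<forall>q\<in>J. K q b = 0" "\<forall>q\<in>I. K q b' = 0" for b b'
  proof (cases "pos b")
    case True
    then show ?thesis using orth SI that by blast
  next
    case False
    then have "- b \<in> S" using rr_not_pos rr_uminus that by (intro SI) (auto simp: E_linear)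
    then show ?thesis using orth[of "- b" b'] that by (simp add: K_linear)
  qed
  \<comment> \<open>Orthogonality to all real roots of U that are orthogonal to \<open>I\<close>. It
    survives \<open>c\<close>, and rotating \<open>cp i1 p\<close> to \<open>cp i0 p\<close> would
    make the latter orthogonal to itself.\<close>
  define Q where "Q x \<longleftrightarrow> (\<forall>b. rr b \<and> E b \<delta> = 0 \<and> (\<forall>q\<in>I. K q b = 0) \<longrightarrow> K b x = 0)" for x
  have Qc: "Q (c x)" if "Q x" for x
  proof (rule c_closure[where Q = Q, OF _ _ that])
    fix b y assume b: "rr b" "E b \<delta> = 0" "Q y"
    show "Q (rf b y)"
    proof (cases "\<forall>q\<in>I. K q b = 0")
      case True
      then have "K b y = 0" using b by (auto simp: Q_def)
      then show ?thesis using b by (simp add: rf_def)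
    next
      case False
      then have "\<forall>q\<in>J. K q b = 0" using dich'[OF b(1,2)] by blast
      then have "K b' b = 0" if "\<forall>q\<in>I. K q b' = 0" for b' using orth' b that by blast
      then show ?thesis using b(3) by (auto simp: Q_def rf_def K_linear)
    qed
  next
    fix y t assume "Q y"
    then show "Q (y + t \<odot> \<delta>)" by (simp add: Q_def K_linear)
  qed
  have Qcp: "Q (cp j x)" if "Q x" for j x using that by (induction j) (auto simp: Qc)
  have "cp i1 p \<in> I" using i1 a1 by (auto simp: I_def)
  then have "Q (cp i1 p)" using K_sym by (metis Q_def)
  then have "Q (cp (i0 + (per p - i1)) (cp i1 p))" by (rule Qcp)
  moreover have "cp (per p - i1) (cp i1 p) = p" using i1 pS by (simp flip: cp_add)
  then have "cp (i0 + (per p - i1)) (cp i1 p) = cp i0 p" by (simp only: cp_add)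
  ultimately have Q0: "Q (cp i0 p)" by simp
  have "cp i0 p \<notin> I"
  proof
    assume "cp i0 p \<in> I"
    then obtain i where "i < per p" "a i > 0" "cp i0 p = cp i p" by (auto simp: I_def)
    then show False using cp_distinct[OF pS i0(1), of i] i0(2) by simp
  qed
  then have "cp i0 p \<in> J" using P0_cp[OF p] by (simp add: J_def)
  then have "\<forall>q\<in>I. K q (cp i0 p) = 0" using IJ K_sym by metis
  then have "K (cp i0 p) (cp i0 p) = 0" using Q0 SD(1,3)[OF S_cp[OF pS]] by (auto simp: Q_def)
  then show False using SD(5)[OF S_cp[OF pS]] by (simp add: K_self)
qed

text \<open>Up to sign and a shift by \<open>c\<close>, the elements of \<open>Z\<close> are the roots whose two degrees with \<open>\<delta>\<close> are one.\<close>

definition Z :: "vec set" where "Z = {z. rr z \<and> E z z = d aff \<and> E z \<delta> = d aff}"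

lemma Z_ex: "Z \<noteq> {}"
proof -
  obtain z where z: "yroot aff z" using yroot_ex[OF aff_less] by blast
  then have "z \<in> Z" using yroot_rr yroot_norm yroot_E[OF z, of \<delta>] by (simp add: Z_def)
  then show ?thesis by blast
qed

lemma Z_nonneg: "z \<in> Z \<Longrightarrow> b \<in> S \<Longrightarrow> E z b \<ge> 0"
  using E_nonneg_S[of z b] d_pos[of aff] by (simp add: Z_def)

text \<open>With \<open>m = E z p / d aff\<close>, the vector \<open>m \<odot> \<delta> - p\<close>
  is a real root, positive because \<open>p\<close> is indecomposable; so
  \<open>m \<odot> \<delta>\<close> is \<open>p\<close> plus a combination of \<open>P0\<close>. Its
  part in the orbit of \<open>p\<close> has norm 0, hence is a multiple of \<delta>, with
  coefficient at least 1 at \<open>p\<close>. By \<open>orbit_connected\<close> its coefficients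
  agree, so it contains the whole orbit sum \<open>mu p \<odot> \<delta>\<close>.\<close>

lemma Z_single_aux:
  assumes z: "z \<in> Z" and p: "p \<in> P0" and e: "E z p > 0"
  shows "E z p \<ge> mu p * d aff"
proof -
  have pS: "p \<in> S" using P0_S p by blast
  have d0: "d aff > 0" by (rule d_pos) simp
  define m where "m = E z p / d aff"
  have m0: "m > 0" using e d0 by (simp add: m_def)
  have mi: "m \<in> \<int>" using rr_rr_int(1)[of z p] z SD(1)[OF pS] by (simp add: Z_def m_def)
  have "m * d aff / E p p \<in> \<int>" using rr_rr_int(2)[of p z] z SD(1)[OF pS] d0 by (simp add: Z_def m_def)
  then have "rr (- p + m \<odot> \<delta>)" using mi rr_uminus[OF SD(1)[OF pS]] by (intro rr_shift) (auto simp: E_linear)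
  moreover define b where "b = m \<odot> \<delta> - p"
  ultimately have rb: "rr b" by (simp add: add.commute)
  have eb: "E b \<delta> = 0" using SD(3)[OF pS] by (simp add: b_def E_linear)
  have "pos b"
  proof (rule ccontr)
    assume "\<not> pos b"
    then have "- b \<in> S" using rr_not_pos[OF rb] rr_uminus[OF rb] eb by (intro SI) (auto simp: E_linear)
    moreover have "p - (- b) = m \<odot> \<delta>" by (simp add: b_def)
    ultimately show False using p m0 mi unfolding P0_def by blast
  qed
  then have "b \<in> cone P0" using S_cone SI rb eb by blast
  moreover have "P0 = orb p \<union> (P0 - orb p)" using orb_P0[OF p] by auto
  ultimately obtain x y where xy: "x \<in> cone (orb p)" "y \<in> cone (P0 - orb p)" "b = x + y" using cone_split by metis
  define v where "v = p + x"
  have vo: "v \<in> cone (orb p)" unfolding v_def by (rule cone_add[OF cone_base xy(1)]) simp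
  have vy: "v = m \<odot> \<delta> - y" using xy(3) by (simp add: v_def b_def algebra_simps)
  have "K r y = 0" if "r \<in> orb p" for r
  proof (rule cone_fn_zero[OF xy(2) linear_K(1)])
    fix q assume "q \<in> P0 - orb p"
    then show "K r q = 0" using K_other_orbit[OF orb_P0[OF p that], of q] orb_eqI[OF pS that] by simp
  qed
  then have "K v y = 0" using cone_fn_zero[OF vo linear_K(2)] by blast
  moreover have "K v v = K v (m \<odot> \<delta> - y)" using vy by simp
  ultimately have "E v v = 0" by (simp add: K_linear K_self)
  moreover have "supported n v" using cone_supported[OF vo] SD(4) P0_S orb_P0[OF p] by blast
  ultimately have v: "v = v aff \<odot> \<delta>" by (intro E_zero_imp)
  have "pos y" using cone_pos[OF xy(2)] P0_pos by blast
  then have "y aff \<ge> 0" by (rule posD)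
  moreover have "v aff = m - y aff" using vy by (simp add: vec_simps)
  ultimately have vm: "v aff \<le> m" by simp
  obtain a' where a': "\<forall>i. a' i \<ge> 0" "x = (\<Sum>i<per p. a' i \<odot> cp i p)"
    using cone_coeffs[of x "\<lambda>i. cp i p" "per p"] xy(1) by (auto simp: orb_eq[OF pS])
  define a where "a i = a' i + (if i = 0 then 1 else 0)" for i :: nat
  have "(\<Sum>i<per p. a i \<odot> cp i p) = x + (\<Sum>i<per p. if i = 0 then p else 0)"
    unfolding a'(2) sum.distrib[symmetric] by (intro sum.cong refl) (auto simp: a_def sm_distribs)
  then have va: "(\<Sum>i<per p. a i \<odot> cp i p) = v" using per_pos[OF pS] by (simp add: v_def)
  \<comment> \<open>Subtracting the minimum makes one coefficient 0, which is the situation of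
    \<open>orbit_connected\<close>.\<close>
  define t where "t = Min (a ` {..<per p})"
  have ne: "finite (a ` {..<per p})" "a ` {..<per p} \<noteq> {}" using per_pos[OF pS] by auto
  have tle: "t \<le> a i" if "i < per p" for i unfolding t_def using ne that by auto
  obtain i0 where i0: "i0 < per p" "a i0 = t" using Min_in[OF ne] by (auto simp: t_def)
  have "(\<Sum>i<per p. (a i - t) \<odot> cp i p) = v - t \<odot> (\<Sum>i<per p. cp i p)"
    by (simp add: sm_distribs sum_subtractf sm_sum va)
  also have "\<dots> = (v aff - t * mu p) \<odot> \<delta>" using v unfolding orbit_mu(1)[OF pS] by (simp add: sm_distribs)
  finally have *: "(\<Sum>i<per p. (a i - t) \<odot> cp i p) = (v aff - t * mu p) \<odot> \<delta>" .
  have eq: "a i = t" if "i < per p" for i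
    using orbit_connected[OF p _ * i0(1) _ that] tle i0(2) by simp
  have t1: "t \<ge> 1" using eq[of 0] per_pos[OF pS] a'(1) by (simp add: a_def) (metis add_increasing order_refl)
  have "(\<Sum>i<per p. (a i - t) \<odot> cp i p) = 0" using eq by (intro sum.neutral) auto
  then have "((v aff - t * mu p) \<odot> \<delta>) aff = 0" unfolding * by (simp add: zero_fun_apply)
  then have "v aff = t * mu p" by (simp add: sm_apply)
  then have "mu p \<le> v aff" using t1 mu_pos[OF pS] by simp
  then have "mu p \<le> m" using vm by simp
  then show ?thesis using d0 by (simp add: m_def field_simps)
qed

section \<open>Elements of \<open>Z\<close> are located at one root of each orbit\<close>

lemma finite_orb: "p \<in> S \<Longrightarrow> finite (orb p)"
  by (simp add: orb_eq)

lemma orb_sum: assumes "p \<in> S" shows "(\<Sum>r\<in>orb p. r) = mu p \<odot> \<delta>"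
proof -
  have inj: "inj_on (\<lambda>i. cp i p) {..<per p}" using cp_distinct[OF assms] by (auto intro!: inj_onI)
  show ?thesis unfolding orb_eq[OF assms] orbit_mu(1)[OF assms, symmetric] by (simp add: sum.reindex[OF inj])
qed

lemma mu_orb: assumes "p \<in> S" "q \<in> orb p" shows "mu q = mu p"
proof -
  have qS: "q \<in> S" using assms S_cp by (auto simp: orb_def)
  have "mu q \<odot> \<delta> = mu p \<odot> \<delta>" using orb_sum[OF assms(1)] orb_sum[OF qS] orb_eqI[OF assms] by simp
  then have "(mu q \<odot> \<delta>) aff = (mu p \<odot> \<delta>) aff" by simp
  then show ?thesis by (simp add: sm_apply)
qed

lemma per_orb: assumes "p \<in> S" "q \<in> orb p" shows "per q = per p"
proof -
  have card: "card (orb x) = per x" if "x \<in> S" for x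
    unfolding orb_eq[OF that] using cp_distinct[OF that] by (subst card_image) (auto intro!: inj_onI)
  have "q \<in> S" using assms S_cp by (auto simp: orb_def)
  then show ?thesis using card[of p] card[of q] orb_eqI[OF assms] assms(1) by simp
qed

lemma E_orb_sum: assumes "p \<in> S" shows "(\<Sum>r\<in>orb p. E z r) = mu p * E z \<delta>"
  using orb_sum[OF assms] by (simp flip: E_sum(2) add: E_linear)

text \<open>The values on the orbit are nonnegative with sum \<open>mu p * d aff\<close>, and
  \<open>Z_single_aux\<close> bounds each nonzero one below by this sum.\<close>

lemma Z_single:
  assumes z: "z \<in> Z" and p: "p \<in> P0"
  shows "\<exists>q\<in>orb p. E z q = mu p * d aff \<and> (\<forall>r\<in>orb p. r \<noteq> q \<longrightarrow> E z r = 0)"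
proof -
  have pS: "p \<in> S" using P0_S p .
  have d0: "d aff > 0" by (rule d_pos) simp
  have nn: "E z r \<ge> 0" if "r \<in> orb p" for r using Z_nonneg[OF z] P0_S orb_P0[OF p that] by blast
  have sum: "(\<Sum>r\<in>orb p. E z r) = mu p * d aff" using E_orb_sum[OF pS] z by (simp add: Z_def)
  have "\<exists>q\<in>orb p. E z q > 0"
  proof (rule ccontr)
    assume "\<not> ?thesis"
    then have "(\<Sum>r\<in>orb p. E z r) \<le> 0" by (intro sum_nonpos) (auto simp: not_less)
    moreover have "mu p * d aff > 0" using mu_pos[OF pS] d0 by simp
    ultimately show False using sum by simp
  qed
  then obtain q where q: "q \<in> orb p" "E z q > 0" by blast
  have ge: "E z q \<ge> mu p * d aff" using Z_single_aux[OF z orb_P0[OF p q(1)] q(2)] mu_orb[OF pS q(1)] by simp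
  have split: "(\<Sum>r\<in>orb p. E z r) = E z q + (\<Sum>r\<in>orb p - {q}. E z r)"
    using finite_orb[OF pS] q(1) by (simp add: sum.remove)
  have "(\<Sum>r\<in>orb p - {q}. E z r) \<ge> 0" using nn by (intro sum_nonneg) auto
  then have "E z q = mu p * d aff" "(\<Sum>r\<in>orb p - {q}. E z r) = 0" using ge sum split by auto
  moreover from this(2) have "\<forall>r\<in>orb p - {q}. E z r = 0"
    using finite_orb[OF pS] nn by (subst (asm) sum_nonneg_eq_0_iff) auto
  ultimately show ?thesis using q(1) by blast
qed

lemma Z_loc:
  assumes "z \<in> Z" "p \<in> P0" "E z p \<noteq> 0"
  shows "E z p = mu p * d aff" "\<And>r. r \<in> orb p \<Longrightarrow> r \<noteq> p \<Longrightarrow> E z r = 0"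
  using Z_single[OF assms(1,2)] assms(3) orb_refl by metis+

lemma Z_cipow: "z \<in> Z \<Longrightarrow> (ci ^^ i) z \<in> Z"
proof (induction i)
  case (Suc i)
  let ?w = "(ci ^^ i) z"
  have w: "?w \<in> Z" using Suc by simp
  have "E (ci ?w) (ci ?w) = E ?w ?w" using E_c_c[of "ci ?w" "ci ?w"] by simp
  then show ?case using w by (simp add: Z_def rr_ci)
qed simp

lemma loc_ex: assumes "p \<in> P0" shows "\<exists>z\<in>Z. E z p > 0"
proof -
  obtain z q where z: "z \<in> Z" "q \<in> orb p" "E z q = mu p * d aff" using Z_ex Z_single[OF _ assms] by blast
  obtain i where i: "q = cp i p" using z(2) by (auto simp: orb_def)
  have "E ((ci ^^ i) z) p = E z q" using E_cp[of i "(ci ^^ i) z" p] i by simp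
  then have "E ((ci ^^ i) z) p > 0" using z(3) mu_pos[OF P0_S[OF assms]] d_pos[of aff] by simp
  then show ?thesis using Z_cipow[OF z(1)] by blast
qed

lemma S_c_ne: "p \<in> S \<Longrightarrow> c p \<noteq> p"
proof
  assume p: "p \<in> S" "c p = p"
  then have e: "p = p aff \<odot> \<delta>" using c_fixed SD(4) by blast
  have "E p p = 0" by (subst (1 2) e) (simp add: E_linear)
  then show False using SD(5)[OF p(1)] by simp
qed

lemma per_ge2: "p \<in> S \<Longrightarrow> per p \<ge> 2"
proof (rule ccontr)
  assume p: "p \<in> S" "\<not> per p \<ge> 2"
  then have "per p = 1" using per_pos[OF p(1)] by simp
  then show False using cp_per[OF p(1)] S_c_ne[OF p(1)] by simp
qed

lemma ci_eq_cp: assumes "q \<in> S" shows "ci q = cp (per q - 1) q"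
proof -
  obtain m where m: "per q = Suc m" using per_pos[OF assms] by (cases "per q") auto
  then have "c (cp m q) = q" using cp_per[OF assms] by simp
  then have "cp m q = ci q" by (metis ci_c)
  then show ?thesis using m by simp
qed

lemma P0_ci: "q \<in> P0 \<Longrightarrow> ci q \<in> P0"
  using ci_eq_cp[OF P0_S] P0_cp by simp

lemma Z_rf: assumes "z \<in> Z" "p \<in> S" shows "rf p z \<in> Z"
proof -
  have "rr (rf p z)" "E (rf p z) (rf p z) = d aff"
    using assms rr_rf SD(1,5)[OF assms(2)] E_rf[of p z] by (auto simp: Z_def)
  moreover have "E (rf p z) \<delta> = d aff" using assms SD(3) by (simp add: Z_def rf_def E_linear)
  ultimately show ?thesis by (simp add: Z_def)
qed

lemma Z_rf_E:
  assumes "z \<in> Z" "p \<in> P0" "E z p > 0"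
  shows "E (rf p z) r = E z r - (E z p / E p p) * E p r"
proof -
  have "E z (c p) = 0" using Z_loc(2)[OF assms(1,2)] assms(3) orb_c[OF orb_refl] S_c_ne[OF P0_S[OF assms(2)]] by auto
  then have "K p z = E z p" using K_c[of z p] by (simp add: K_sym)
  then show ?thesis by (simp add: rf_def E_linear)
qed

lemma E_c_self: "E p (c p) = - E p p"
  by (simp add: E_cox)

text \<open>The reflection subtracts a positive multiple of \<open>E p\<close>, and
  \<open>E p (c p) = - E p p\<close> moves the location from \<open>p\<close> to \<open>c p\<close>,
  while other orbits are orthogonal to \<open>p\<close>.\<close>

lemma Z_move:
  assumes "z \<in> Z" "p \<in> P0" "E z p > 0"
  shows "E (rf p z) (c p) > 0" and "\<And>r. r \<in> P0 \<Longrightarrow> r \<notin> orb p \<Longrightarrow> E (rf p z) r = E z r"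
proof -
  have "E z (c p) = 0" using Z_loc(2)[OF assms(1,2)] assms(3) orb_c[OF orb_refl] S_c_ne[OF P0_S[OF assms(2)]] by auto
  then show "E (rf p z) (c p) > 0" using Z_rf_E[OF assms] SD(5)[OF P0_S[OF assms(2)]] assms(3) by (simp add: E_c_self)
  show "E (rf p z) r = E z r" if "r \<in> P0" "r \<notin> orb p" for r
    using Z_rf_E[OF assms] E_other_orbit[OF assms(2) that] by simp
qed

text \<open>Both \<open>E z\<close> and \<open>E (rf p z)\<close>, located at \<open>p\<close> and
  at \<open>c p\<close>, vanish at any other \<open>q\<close> of the orbit, and their difference is
  a nonzero multiple of \<open>E p q\<close>. Each orbit is thus a cycle with edges from
  \<open>p\<close> to \<open>c p\<close>, as in affine type A.\<close>

lemma E_P0: assumes "p \<in> P0" "q \<in> P0"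
  shows "E p q = E p p * (if q = p then 1 else if q = c p then -1 else 0)"
proof (cases "q = p \<or> q = c p \<or> q \<notin> orb p")
  case True
  then show ?thesis using E_other_orbit[OF assms] orb_c[OF orb_refl] S_c_ne[OF P0_S[OF assms(1)]] by (auto simp: E_c_self)
next
  case False
  then have q: "q \<noteq> p" "q \<noteq> c p" "q \<in> orb p" by auto
  obtain z where z: "z \<in> Z" "E z p > 0" using loc_ex[OF assms(1)] by blast
  have "E z q = 0" using Z_loc(2)[OF z(1) assms(1)] z(2) q by auto
  moreover have "E (rf p z) q = 0"
  proof (rule Z_loc(2)[OF Z_rf[OF z(1) P0_S[OF assms(1)]] P0_c[OF assms(1)]])
    show "E (rf p z) (c p) \<noteq> 0" using Z_move(1)[OF z(1) assms(1) z(2)] by simp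
    show "q \<in> orb (c p)" using orb_eqI[OF P0_S[OF assms(1)] orb_c[OF orb_refl]] q(3) by simp
  qed (use q in auto)
  ultimately have "E p q = 0" using Z_rf_E[OF z(1) assms(1) z(2), of q] z(2) SD(5)[OF P0_S[OF assms(1)]] by simp
  then show ?thesis using q by simp
qed

text \<open>Indecomposability forbids two elements of \<open>P0\<close> that differ by a multiple of
  \<delta>, so \<open>P0\<close> embeds into the finite root system.\<close>

lemma finite_P0: "finite P0"
proof -
  have "inj_on bar P0"
  proof (rule inj_onI)
    fix p q assume pq: "p \<in> P0" "q \<in> P0" "bar p = bar q"
    define m where "m = p aff - q aff"
    have e: "p - q = m \<odot> \<delta>" using pq(3) by (simp add: bar_def m_def sm_distribs algebra_simps)
    then have e': "q - p = (- m) \<odot> \<delta>" by (metis minus_diff_eq sm_minus(1))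
    have m: "m \<in> \<int>" "- m \<in> \<int>" using rrD(2)[OF SD(1)[OF P0_S[OF pq(1)]]] rrD(2)[OF SD(1)[OF P0_S[OF pq(2)]]] by (auto simp: m_def)
    have "\<not> m > 0" using pq(1) e m(1) P0_S[OF pq(2)] unfolding P0_def by blast
    moreover have "\<not> - m > 0" using pq(2) e' m(2) P0_S[OF pq(1)] unfolding P0_def by blast
    ultimately have "m = 0" by simp
    then show "p = q" using e by simp
  qed
  moreover have "bar ` P0 \<subseteq> {b. rr b \<and> b aff = 0}" using rr_bar SD(1) P0_S by auto
  ultimately show ?thesis using finite_rr_fin by (meson finite_imageD finite_subset)
qed

lemma Z_move_to:
  assumes "z \<in> Z" "a \<in> P0"
  shows "\<exists>w\<in>Z. E w a > 0 \<and> (\<forall>r\<in>P0. r \<notin> orb a \<longrightarrow> E w r = E z r)"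
proof -
  have step: "\<exists>w\<in>Z. E w (cp j q) > 0 \<and> (\<forall>r\<in>P0. r \<notin> orb q \<longrightarrow> E w r = E z r)"
    if "q \<in> P0" "E z q > 0" for j q
  proof (induction j)
    case 0
    then show ?case using assms(1) that by auto
  next
    case (Suc j)
    then obtain w where w: "w \<in> Z" "E w (cp j q) > 0" "\<forall>r\<in>P0. r \<notin> orb q \<longrightarrow> E w r = E z r" by blast
    have q': "cp j q \<in> P0" "orb (cp j q) = orb q" using P0_cp[OF that(1)] orb_eqI[OF P0_S[OF that(1)]] by (auto simp: orb_def)
    have "rf (cp j q) w \<in> Z" using Z_rf w(1) q' P0_S by blast
    moreover have "E (rf (cp j q) w) (cp (Suc j) q) > 0" using Z_move(1)[OF w(1) q'(1) w(2)] by simp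
    moreover have "\<forall>r\<in>P0. r \<notin> orb q \<longrightarrow> E (rf (cp j q) w) r = E z r"
      using Z_move(2)[OF w(1) q'(1) w(2)] q'(2) w(3) by auto
    ultimately show ?case by blast
  qed
  obtain q where q: "q \<in> orb a" "E z q = mu a * d aff" using Z_single[OF assms] by blast
  then have qP: "q \<in> P0" "E z q > 0" using orb_P0[OF assms(2)] mu_pos[OF P0_S[OF assms(2)]] d_pos[of aff] by auto
  obtain j where j: "a = cp j q" using orb_sym[OF P0_S[OF assms(2)] q(1)] by (auto simp: orb_def)
  have "orb q = orb a" using orb_eqI[OF P0_S[OF assms(2)] q(1)] .
  then show ?thesis using step[OF qP, of j] j by simp
qed

text \<open>\<open>Z_move\<close> can be iterated in one orbit without disturbing the others, so the
  locations in the tubes can be chosen independently.\<close>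

lemma Z_locs:
  assumes "L \<subseteq> P0" "\<And>a b. a \<in> L \<Longrightarrow> b \<in> L \<Longrightarrow> b \<in> orb a \<Longrightarrow> a = b"
  shows "\<exists>z\<in>Z. \<forall>a\<in>L. E z a > 0"
proof -
  have "finite L" using assms(1) finite_P0 finite_subset by blast
  then show ?thesis using assms
  proof (induction L rule: finite_induct)
    case empty
    then show ?case using Z_ex by auto
  next
    case (insert a L)
    then obtain z where z: "z \<in> Z" "\<forall>b\<in>L. E z b > 0" by (metis insertCI insert_subset)
    obtain w where w: "w \<in> Z" "E w a > 0" "\<forall>r\<in>P0. r \<notin> orb a \<longrightarrow> E w r = E z r"
      using Z_move_to[OF z(1), of a] insert.prems(1) by blast
    have "E w b > 0" if "b \<in> L" for b
    proof -
      have "b \<notin> orb a" using insert.prems(2)[of a b] insert.hyps(2) that by auto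
      then show ?thesis using w(3) z(2) that insert.prems(1) by auto
    qed
    then show ?case using w by blast
  qed
qed

text \<open>A root whose Euler pairing with the tube roots is supported on one root of each tube
  is congruent modulo \<open>\<delta>\<close> to a multiple \<open>s\<close> of an element of \<open>Z\<close>, and the integrality of the root
  and of its co-root makes both \<open>s\<close> and \<open>1/s\<close> integral.\<close>

lemma Z_rigid:
  assumes x: "rr x" "E x \<delta> > 0" and z: "z \<in> Z" and van: "\<And>q. q \<in> P0 \<Longrightarrow> E z q = 0 \<Longrightarrow> E x q = 0"
  shows "\<exists>u. u \<in> \<int> \<and> x = z + u \<odot> \<delta>"
proof -
  have d0: "d aff > 0" by (rule d_pos) simp
  define s where "s = E x \<delta> / d aff"
  have s0: "s > 0" using x(2) d0 by (simp add: s_def)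
  \<comment> \<open>\<open>E z\<close> and \<open>E x\<close> are concentrated at the same root of
    each orbit, where the total over the orbit determines the value.\<close>
  have ratio: "E x q = s * E z q" if q: "q \<in> P0" for q
  proof (cases "E z q = 0")
    case True
    then show ?thesis using van q by simp
  next
    case False
    note loc = Z_loc[OF z q False]
    have "(\<Sum>r\<in>orb q. E x r) = (\<Sum>r\<in>orb q. if r = q then E x q else 0)"
      using van loc(2) orb_P0[OF q] by (intro sum.cong refl) auto
    then have "E x q = mu q * E x \<delta>" using E_orb_sum[OF P0_S[OF q], of x] finite_orb[OF P0_S[OF q]] by simp
    then show ?thesis using loc(1) d0 by (simp add: s_def)
  qed
  define w where "w = x - s \<odot> z"
  have wS: "E w b = 0" if "b \<in> S" for b
    using cone_fn_zero[OF S_cone[OF that] linear_E(1)[of w]] ratio by (simp add: w_def E_linear)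
  have "K b w = 0" if "rr b" "E b \<delta> = 0" for b
  proof -
    have "K w b = 0" if "b \<in> S" for b using wS[OF that] wS[OF S_c[OF that]] by (simp add: K_c)
    moreover have "b \<in> S \<or> - b \<in> S" 
      using rr_pos_or_neg[OF that(1)] SI[of b] SI[of "- b"] that rr_uminus[OF that(1)] E_linear(7)[of b \<delta>] by auto
    ultimately show ?thesis using K_sym[of b w] K_linear(8)[of w b] by auto
  qed
  moreover have "E w \<delta> = 0" using z d0 by (simp add: w_def E_linear s_def Z_def)
  moreover have "supported n w" using rrD(1) x z by (simp add: w_def Z_def)
  ultimately have w: "w = w aff \<odot> \<delta>" by (intro orthogonal_to_U_roots)
  have xz: "x = s \<odot> z + w aff \<odot> \<delta>" using w by (simp add: w_def algebra_simps)
  have "E x x = E (s \<odot> z) (s \<odot> z)" using E_delta_shift[of "s \<odot> z" "w aff"] unfolding xz[symmetric] .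
  then have Ex: "E x x = s * s * d aff" using z by (simp add: E_linear Z_def)
  \<comment> \<open>\<open>s\<close> is the Euler pairing of \<open>x\<close> with the dual
    imaginary root; below, \<open>1 / s\<close> is that of the co-root of \<open>x\<close> with
    \<delta>.\<close>
  have "s \<in> \<int>" unfolding s_def using delta_vee_int rrD(2)[OF x(1)] by (intro E_int_right)
  moreover have "E x \<delta> / E x x \<in> \<int>" using rr_E_int(1)[OF x(1), of \<delta>] delta_int by blast
  then have "1 / s \<in> \<int>" using x(2) d0 by (simp add: Ex s_def split: if_splits)
  ultimately obtain k l :: int where kl: "s = of_int k" "1 / s = of_int l" by (auto elim!: Ints_cases)
  then have "of_int (k * l) = (1::real)" using s0 by (simp add: field_simps)
  then have "k * l = 1" by linarith
  then have "s = 1" using kl(1) s0 by (auto simp: zmult_eq_1_iff)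
  then have xz1: "x = z + w aff \<odot> \<delta>" using xz by simp
  then have "x aff = z aff + w aff" by (metis plus_fun_apply sm_apply delta_aff mult.right_neutral)
  then have "w aff \<in> \<int>" using rrD(2)[OF x(1), of aff] rrD(2)[of z aff] z by (simp add: Z_def)
  then show ?thesis using xz1 by blast
qed

lemma Z_shift: assumes "z \<in> Z" "u \<in> \<int>" shows "z + u \<odot> \<delta> \<in> Z"
proof -
  have "rr (z + u \<odot> \<delta>)" using assms d_pos[of aff] by (intro rr_shift) (auto simp: Z_def)
  moreover have "E (z + u \<odot> \<delta>) (z + u \<odot> \<delta>) = d aff" using E_delta_shift assms(1) by (simp add: Z_def)
  moreover have "E (z + u \<odot> \<delta>) \<delta> = d aff" using assms(1) by (simp add: Z_def E_linear)
  ultimately show ?thesis by (simp add: Z_def)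
qed

section \<open>Arcs in the tubes\<close>

definition aset :: "vec \<Rightarrow> nat \<Rightarrow> vec set" where "aset p l = (\<lambda>i. cp i p) ` {..<l}"
definition arc :: "vec \<Rightarrow> nat \<Rightarrow> vec" where "arc p l = (\<Sum>i<l. cp i p)"

lemma aset_inj: "p \<in> S \<Longrightarrow> l \<le> per p \<Longrightarrow> inj_on (\<lambda>i. cp i p) {..<l}"
  using cp_distinct by (auto intro!: inj_onI)

lemma arc_aset: "p \<in> S \<Longrightarrow> l \<le> per p \<Longrightarrow> arc p l = (\<Sum>r\<in>aset p l. r)"
  unfolding arc_def aset_def by (simp add: sum.reindex[OF aset_inj])

lemma finite_aset [simp]: "finite (aset p l)"
  by (simp add: aset_def)

lemma aset_orb: "aset p l \<subseteq> orb p"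
  by (auto simp: aset_def orb_def)

lemma E_arc_right: assumes "q \<in> P0" "p \<in> P0" "l \<le> per p"
  shows "E q (arc p l) = E q q * ((if q \<in> aset p l then 1 else 0) - (if c q \<in> aset p l then 1 else 0))"
proof -
  have "E q (arc p l) = (\<Sum>r\<in>aset p l. E q r)" by (simp add: arc_aset P0_S assms E_sum)
  also have "\<dots> = (\<Sum>r\<in>aset p l. (if r = q then E q q else 0) - (if r = c q then E q q else 0))"
    using E_P0[OF assms(1)] orb_P0[OF assms(2)] aset_orb S_c_ne[OF P0_S[OF assms(1)]]
    by (intro sum.cong refl) (auto split: if_splits simp: subset_iff)
  also have "\<dots> = E q q * ((if q \<in> aset p l then 1 else 0) - (if c q \<in> aset p l then 1 else 0))"
    by (simp add: sum_subtractf)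
  finally show ?thesis .
qed

lemma E_arc_left: assumes "q \<in> P0" "p \<in> P0" "l \<le> per p"
  shows "E (arc p l) (c q) = E q q * ((if c q \<in> aset p l then 1 else 0) - (if q \<in> aset p l then 1 else 0))"
  using E_arc_right[OF assms] by (simp add: E_cox)

lemma K_arc: assumes "q \<in> P0" "p \<in> P0" "l \<le> per p"
  shows "K q (arc p l) = E q q * (2 * (if q \<in> aset p l then 1 else 0) - (if c q \<in> aset p l then 1 else 0)
     - (if ci q \<in> aset p l then 1 else 0))"
proof -
  have ci: "ci q \<in> P0" by (rule P0_ci[OF assms(1)])
  have "E (ci q) (ci q) = E q q" using E_c_c[of "ci q" "ci q"] by simp
  then show ?thesis using E_arc_left[OF ci assms(2,3)] E_arc_right[OF assms] by (simp add: K_def algebra_simps)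
qed

lemma arc_Suc: "arc p (Suc l) = arc p l + cp l p"
  by (simp add: arc_def)

lemma arc_1 [simp]: "arc p (Suc 0) = p"
  by (simp add: arc_def)

lemma arc_Suc_front: "arc p (Suc l) = p + arc (c p) l"
  unfolding arc_def by (simp add: sum.lessThan_Suc_shift funpow_swap1 del: sum.lessThan_Suc)

lemma cp_mem_aset: assumes "p \<in> S" "j < per p" "l \<le> per p" shows "cp j p \<in> aset p l \<longleftrightarrow> j < l"
proof
  assume "cp j p \<in> aset p l"
  then obtain i where "i < l" "cp j p = cp i p" by (auto simp: aset_def)
  then show "j < l" using cp_distinct[OF assms(1,2), of i] assms(3) by auto
qed (auto simp: aset_def)

lemma c_arc: "c (arc p l) = arc (c p) l"
  by (simp add: arc_def c_sum funpow_swap1)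

lemma cp_arc: "cp i (arc p l) = arc (cp i p) l"
  by (induction i) (simp_all add: c_arc)

text \<open>Appending the next root of the orbit is the reflection in it: it meets the arc only
  through its predecessor, as long as \<open>Suc l < per p\<close>.\<close>

lemma arc_rr: assumes "p \<in> P0" "1 \<le> l" "l < per p" shows "rr (arc p l) \<and> E (arc p l) (arc p l) = E p p"
  using assms(2,3)
proof (induction l rule: nat_induct_at_least)
  case base
  then show ?case using SD(1)[OF P0_S[OF assms(1)]] by simp
next
  case (Suc l)
  have pS: "p \<in> S" using P0_S assms by blast
  have q: "cp l p \<in> P0" using P0_cp assms by blast
  have "ci (cp l p) = cp (l - 1) p" using Suc.hyps by (cases l) auto
  then have 1: "ci (cp l p) \<in> aset p l" using Suc.hyps by (auto simp: aset_def)
  have 2: "cp l p \<notin> aset p l" "c (cp l p) \<notin> aset p l"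
    using cp_mem_aset[OF pS, of l l] cp_mem_aset[OF pS, of "Suc l" l] Suc.prems by auto
  have "K (cp l p) (arc p l) = - E (cp l p) (cp l p)" using K_arc[OF q assms(1), of l] 1 2 Suc.prems by simp
  then have "rf (cp l p) (arc p l) = arc p (Suc l)" using SD(5)[OF P0_S[OF q]] by (simp add: rf_def arc_Suc sm_minus)
  then show ?case using rr_rf[of "cp l p" "arc p l"] E_rf[of "cp l p" "arc p l"] SD(1,5)[OF P0_S[OF q]] Suc by auto
qed

lemma arc_S: assumes "p \<in> P0" "1 \<le> l" "l < per p" shows "arc p l \<in> S"
proof (rule SI)
  show "rr (arc p l)" using arc_rr assms by blast
  have "arc p l \<in> cone P0" unfolding arc_def using P0_cp assms by (intro cone_sum cone_base) auto
  then show "pos (arc p l)" using cone_pos P0_pos by blast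
  show "E (arc p l) \<delta> = 0" unfolding arc_def using SD(3)[OF P0_S[OF assms(1)]] by (simp add: E_sum)
qed

lemma arc_complement: assumes "p \<in> P0" shows "arc (c p) (per p - 1) = mu p \<odot> \<delta> - p"
proof -
  have "per p = Suc (per p - 1)" using per_pos[OF P0_S[OF assms]] by simp
  then have "mu p \<odot> \<delta> = p + arc (c p) (per p - 1)"
    using orbit_mu(1)[OF P0_S[OF assms]] arc_Suc_front[of p "per p - 1"] by (simp add: arc_def)
  then show ?thesis by simp
qed

text \<open>This is \<open>Upsilon_re\<close>, by \<open>Upsilon_re_eq\<close>: orbits in
  \<open>S\<close> are finite, so nonnegative powers of \<open>c\<close> reach the whole
  orbit.\<close>

definition UR :: "vec set" where "UR = {b \<in> S. \<exists>i. cp i b aff = 0}"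

text \<open>Up to the factor \<open>d aff\<close>, the coordinate at \<open>aff\<close> is the Euler
  pairing with the inversion of node \<open>aff\<close>, an element of \<open>Z\<close>.\<close>

lemma aff_loc: assumes "p \<in> P0" shows "\<exists>q\<in>orb p. q aff > 0 \<and> (\<forall>r\<in>orb p. r \<noteq> q \<longrightarrow> r aff = 0)"
proof -
  obtain y where y: "yroot aff y" using yroot_ex[OF aff_less] by blast
  then have "y \<in> Z" using yroot_rr yroot_norm yroot_E[OF y, of \<delta>] by (simp add: Z_def)
  then obtain q where q: "q \<in> orb p" "E y q = mu p * d aff" "\<forall>r\<in>orb p. r \<noteq> q \<longrightarrow> E y r = 0"
    using Z_single[OF _ assms] by blast
  have "q aff > 0" "\<forall>r\<in>orb p. r \<noteq> q \<longrightarrow> r aff = 0"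
    using q(2,3) yroot_E[OF y] d_pos[of aff] mu_pos[OF P0_S[OF assms]] by auto
  then show ?thesis using q(1) by blast
qed

text \<open>Rotate the arc so that it starts just after the root carrying \<open>aff\<close>; being
  shorter than the orbit, it ends before coming back to it.\<close>

lemma arc_UR: assumes "p \<in> P0" "1 \<le> l" "l < per p" shows "arc p l \<in> UR"
proof -
  have pS: "p \<in> S" using P0_S assms by blast
  obtain q where q: "q \<in> orb p" "\<forall>r\<in>orb p. r \<noteq> q \<longrightarrow> r aff = 0" using aff_loc[OF assms(1)] by blast
  have qS: "q \<in> S" using P0_S orb_P0 assms q by blast
  obtain i where i: "c q = cp i p" using orb_c[OF q(1)] by (auto simp: orb_def)
  have "cp i (arc p l) = arc (c q) l" by (simp add: cp_arc i)
  moreover have "arc (c q) l aff = (\<Sum>j<l. cp (Suc j) q aff)"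
    by (simp add: arc_def sum_vec_apply funpow_swap1)
  moreover have "cp (Suc j) q aff = 0" if "j < l" for j
  proof -
    have "cp (Suc j) q \<noteq> q" using per_least[of "Suc j" q] per_orb[OF pS q(1)] that assms(3) by simp
    then show ?thesis using q orb_cp by blast
  qed
  ultimately have "cp i (arc p l) aff = 0" by simp
  then show ?thesis using arc_S[OF assms] by (auto simp: UR_def)
qed

text \<open>\<open>S_induct\<close> adds simple roots one at a time. The sign of the pairing with an
  arc allows \<open>q\<close> only at one of its ends, and the vanishing coordinate at
  \<open>aff\<close> stops the arc before it closes up.\<close>

lemma S_aff_zero_arc:
  assumes "b \<in> S" "b aff = 0" shows "\<exists>p\<in>P0. \<exists>l. 1 \<le> l \<and> l < per p \<and> b = arc p l"
  using assms
proof (induction rule: S_induct)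
  case (base p)
  then show ?case using per_ge2[OF P0_S[OF base(1)]] by (intro bexI[of _ p] exI[of _ 1]) auto
next
  case (step b q)
  have qS: "q \<in> S" using P0_S step by blast
  have bX: "b \<in> cone {x \<in> P0. x aff = 0}" using cone_coord_zero[OF S_cone[OF step(1)]] P0_pos step.prems by blast
  have qa: "q aff = 0"
  proof (rule ccontr)
    assume "q aff \<noteq> 0"
    then have "K q b \<le> 0" using P0_K_nonpos[OF step(3)] by (intro cone_fn_nonpos[OF bX linear_K(1)]) auto
    then show False using step(4) by simp
  qed
  then have "rf q b aff = 0" using step.prems by (simp add: rf_def vec_simps)
  then obtain p l where pl: "p \<in> P0" "1 \<le> l" "l < per p" "rf q b = arc p l" using step by blast
  have pS: "p \<in> S" using P0_S pl by blast
  have b: "b = rf q (arc p l)" using rf_rf[of q b] SD(5)[OF qS] pl(4) by simp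
  have K: "K q (arc p l) < 0" using step(4) pl(4)[symmetric] SD(5)[OF qS] by (simp add: rf_def K_linear K_self)
  have in_orb: "x \<in> aset p l \<Longrightarrow> x \<in> orb p" for x using aset_orb by blast
  have KA: "K q (arc p l) = E q q * (2 * (if q \<in> aset p l then 1 else 0) - (if c q \<in> aset p l then 1 else 0)
     - (if ci q \<in> aset p l then 1 else 0))" using K_arc[OF step(3) pl(1)] pl(3) by simp
  have qA: "q \<notin> aset p l"
  proof
    assume "q \<in> aset p l"
    then have "K q (arc p l) \<ge> 0" unfolding KA using SD(5)[OF qS] by auto
    then show False using K by simp
  qed
  have at_front: "c q = p" if cq: "c q \<in> aset p l"
  proof -
    obtain i where i: "i < l" "c q = cp i p" using cq by (auto simp: aset_def)
    have "i = 0"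
    proof (rule ccontr)
      assume "i \<noteq> 0"
      then have "c q = c (cp (i - 1) p)" using i by (cases i) auto
      then have "q = cp (i - 1) p" by (simp only: c_inj)
      then show False using qA i \<open>i \<noteq> 0\<close> by (auto simp: aset_def)
    qed
    then show ?thesis using i by simp
  qed
  have at_end: "q = cp l p" if cq: "ci q \<in> aset p l"
  proof -
    obtain i where i: "i < l" "ci q = cp i p" using cq by (auto simp: aset_def)
    then have q: "q = cp (Suc i) p" using c_ci[of q] by simp
    have "\<not> Suc i < l"
    proof
      assume "Suc i < l"
      then have "cp (Suc i) p \<in> aset p l" unfolding aset_def by (intro image_eqI[of _ _ "Suc i"]) auto
      then show False using qA q by simp
    qed
    then show ?thesis using q i by (metis Suc_lessI)
  qed
  have q_orb: "q \<in> orb p"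
  proof -
    have "c q \<in> aset p l \<or> ci q \<in> aset p l" using K qA unfolding KA by (auto split: if_splits)
    then show ?thesis
    proof
      assume "c q \<in> aset p l"
      then have "p \<in> orb q" using at_front orb_c[OF orb_refl, of q] by simp
      then show ?thesis using orb_sym[OF qS] by blast
    next
      assume "ci q \<in> aset p l"
      then show ?thesis using at_end orb_cp[OF orb_refl] by simp
    qed
  qed
  \<comment> \<open>An arc missing a single root misses the one that carries \<open>aff\<close>;
    that root would be \<open>q\<close>, against \<open>qa\<close>.\<close>
  have l1: "Suc l < per p"
  proof (rule ccontr)
    assume "\<not> Suc l < per p"
    then have l: "Suc l = per p" using pl by simp
    obtain q0 where q0: "q0 \<in> orb p" "q0 aff > 0" using aff_loc[OF pl(1)] by blast
    have "arc p l aff = (\<Sum>i<l. cp i p aff)" by (simp add: arc_def sum_vec_apply)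
    then have "(\<Sum>i<l. cp i p aff) = 0" using \<open>rf q b aff = 0\<close> pl(4) by simp
    then have z: "cp i p aff = 0" if "i < l" for i
      using that P0_pos[OF P0_cp[OF pl(1)]] by (subst (asm) sum_nonneg_eq_0_iff) (auto simp: pos_def)
    obtain i where i: "i < per p" "q0 = cp i p" using q0(1) orb_eq[OF pS] by auto
    obtain j where j: "j < per p" "q = cp j p" using q_orb orb_eq[OF pS] by auto
    have "i = l" using z[of i] i q0(2) l by (cases "i < l") auto
    moreover have "j = l" using qA j l by (cases "j < l") (auto simp: aset_def)
    ultimately show False using i j q0(2) qa by simp
  qed
  have "c q \<in> aset p l \<Longrightarrow> ci q \<in> aset p l \<Longrightarrow> False"
    using at_front at_end per_least[of "Suc l" p] l1 by auto
  then consider "c q \<in> aset p l" "ci q \<notin> aset p l" | "c q \<notin> aset p l" "ci q \<in> aset p l"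
    using K qA unfolding KA by (auto split: if_splits)
  then show ?case
  proof cases
    case 1
    have "b = arc p l + q" unfolding b rf_def KA using 1 qA SD(5)[OF qS] by (simp add: sm_minus)
    also have "\<dots> = arc q (Suc l)" using at_front[OF 1(1)] by (simp add: arc_Suc_front)
    finally have "b = arc q (Suc l)" .
    moreover have "per q = per p" using per_orb[OF pS q_orb] .
    ultimately show ?thesis using step(3) l1 by (intro bexI[of _ q] exI[of _ "Suc l"]) auto
  next
    case 2
    have "b = arc p l + q" unfolding b rf_def KA using 2 qA SD(5)[OF qS] by (simp add: sm_minus)
    then have "b = arc p (Suc l)" using at_end[OF 2(2)] by (simp add: arc_Suc)
    then show ?thesis using pl(1) l1 by (intro bexI[of _ p] exI[of _ "Suc l"]) auto
  qed
qed

lemma UR_arc: assumes "b \<in> UR" obtains p l where "p \<in> P0" "1 \<le> l" "l < per p" "b = arc p l"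
proof -
  obtain i where i: "b \<in> S" "cp i b aff = 0" using assms by (auto simp: UR_def)
  obtain p l where pl: "p \<in> P0" "1 \<le> l" "l < per p" "cp i b = arc p l"
    using S_aff_zero_arc[OF S_cp[OF i(1)] i(2)] by blast
  have "b \<in> orb (cp i b)" using orb_sym[OF i(1)] by (auto simp: orb_def)
  then obtain j where j: "b = cp j (cp i b)" by (auto simp: orb_def)
  then have "b = arc (cp j p) l" using pl(4) by (simp add: cp_arc)
  moreover have "per (cp j p) = per p" using per_orb[OF P0_S[OF pl(1)]] by (simp add: orb_def)
  ultimately show ?thesis using that[of "cp j p" l] pl P0_cp by simp
qed

end

section \<open>Clusters in terms of the Euler form\<close>

locale affine_sys = affine_data +
  assumes delta_eq: "delta A n = \<delta>"
    and delta_vee_eq: "i < n \<Longrightarrow> delta_vee A n i = d i * \<delta> i / d aff"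
    and imag_eq: "pos_imag_roots A n = {m \<odot> \<delta> | m. m \<in> \<int> \<and> m \<ge> 1}"
begin

lemma delta_not_rr: "\<not> rr (m \<odot> \<delta>)"
  using rrD(3)[of "m \<odot> \<delta>"] by (auto simp: E_linear)

lemma pos_iff: "supported n b \<Longrightarrow> (\<forall>i<n. b i \<ge> 0) \<longleftrightarrow> pos b"
  by (auto simp: pos_def supported_def) (metis le_less_linear order_refl)

lemma roots_cases: "b \<in> roots A n \<longleftrightarrow> rr b \<or> (\<exists>m. m \<in> \<int> \<and> m \<ge> 1 \<and> (b = m \<odot> \<delta> \<or> b = - (m \<odot> \<delta>)))"
  unfolding roots_def imag_eq rr_real_roots by (auto simp: neg_eq)

lemma positive_roots_iff:
  "b \<in> positive_roots A n \<longleftrightarrow> rr b \<and> pos b \<or> (\<exists>m. m \<in> \<int> \<and> m \<ge> 1 \<and> b = m \<odot> \<delta>)"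
proof
  assume "b \<in> positive_roots A n"
  then have b: "b \<in> roots A n" "\<forall>i<n. b i \<ge> 0" by (auto simp: positive_roots_def)
  have "b \<noteq> - (m \<odot> \<delta>)" if "m \<ge> 1" for m
  proof
    assume "b = - (m \<odot> \<delta>)"
    then have "b aff = - m" by (simp add: vec_simps)
    moreover have "b aff \<ge> 0" using b(2) aff_less by blast
    ultimately show False using that by simp
  qed
  then show "rr b \<and> pos b \<or> (\<exists>m. m \<in> \<int> \<and> m \<ge> 1 \<and> b = m \<odot> \<delta>)"
    using b roots_cases pos_iff rrD(1) by blast
next
  assume *: "rr b \<and> pos b \<or> (\<exists>m. m \<in> \<int> \<and> m \<ge> 1 \<and> b = m \<odot> \<delta>)"
  then have "pos b" using pos_sm[OF _ pos_delta] by (metis zero_le_one order_trans)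
  then show "b \<in> positive_roots A n" using * roots_cases by (auto simp: positive_roots_def pos_def)
qed

lemma in_U_iff: "in_U A d n aff v \<longleftrightarrow> E v \<delta> = 0"
proof -
  obtain g where g: "supported n g" "g aff = 0" "c g = g + \<delta>" using gamma_exists by blast
  have "gamma_c A n aff = g"
    unfolding gamma_c_def delta_eq
  proof (rule the_equality)
    show "supported n g \<and> g aff = 0 \<and> c g = (\<lambda>k. g k + \<delta> k)" using g by (simp add: plus_fun_def)
    fix h assume h: "supported n h \<and> h aff = 0 \<and> c h = (\<lambda>k. h k + \<delta> k)"
    then have "c h = h + \<delta>" by (simp add: plus_fun_def)
    then show "h = g" using gamma_unique g h by blast
  qed
  then show ?thesis using E_delta_gamma[OF g(3), of v] by (simp add: in_U_def flip: K_Kform)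
qed

lemma Upsilon_pos_iff:
  "b \<in> Upsilon A d n aff \<inter> positive_roots A n \<longleftrightarrow> b \<in> S \<or> (\<exists>m. m \<in> \<int> \<and> m \<ge> 1 \<and> b = m \<odot> \<delta>)"
  unfolding Upsilon_def using positive_roots_iff[of b]
  by (auto simp: in_U_iff S_def E_linear positive_roots_def)

lemma orb_ci: assumes "b \<in> S" "r \<in> orb b" shows "ci r \<in> orb b"
proof -
  have "r \<in> S" using assms S_cp by (auto simp: orb_def)
  then show ?thesis using ci_eq_cp orb_cp[OF assms(2)] by simp
qed

lemma cipow_orb: "b \<in> S \<Longrightarrow> (ci ^^ j) b \<in> orb b"
  by (induction j) (simp_all add: orb_ci)

lemma Upsilon_re_eq: "Upsilon_re A d n aff = UR"
proof -
  have "(\<exists>m. cox_pow A n m b \<in> roots_fin A n aff) \<longleftrightarrow> (\<exists>i. cp i b aff = 0)" if b: "b \<in> S" for b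
  proof
    assume "\<exists>m. cox_pow A n m b \<in> roots_fin A n aff"
    then obtain m where m: "cox_pow A n m b aff = 0" by (auto simp: roots_fin_def)
    have "cox_pow A n m b \<in> orb b"
      using cipow_orb[OF b] orb_cp[OF orb_refl] by (simp add: cox_pow_def)
    then show "\<exists>i. cp i b aff = 0" using m by (auto simp: orb_def)
  next
    assume "\<exists>i. cp i b aff = 0"
    then obtain i where i: "cp i b aff = 0" by blast
    have "cox_pow A n (int i) b \<in> roots_fin A n aff"
      using i rr_cp[OF SD(1)[OF b], of i] by (auto simp: cox_pow_def roots_fin_def roots_cases)
    then show "\<exists>m. cox_pow A n m b \<in> roots_fin A n aff" by blast
  qed
  moreover have "b \<in> positive_roots A n \<inter> real_roots A n \<and> in_U A d n aff b \<longleftrightarrow> b \<in> S" for b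
    using positive_roots_iff[of b] delta_not_rr by (auto simp: rr_real_roots in_U_iff S_def)
  ultimately show ?thesis unfolding Upsilon_re_def UR_def by blast
qed

lemma Phi_c_eq: "Phi_c A d n aff = nsimple ` {..<n} \<union> {b. rr b \<and> pos b \<and> E b \<delta> \<noteq> 0} \<union> UR \<union> {\<delta>}"
proof -
  have "{\<beta> \<in> positive_roots A n. \<not> in_U A d n aff \<beta>} = {b. rr b \<and> pos b \<and> E b \<delta> \<noteq> 0}"
    using positive_roots_iff by (auto simp: in_U_iff E_linear)
  then show ?thesis by (simp add: Phi_c_def delta_eq Upsilon_re_eq)
qed

lemma nonneg_span_cone: "nonneg_span P = cone P"
proof
  show "nonneg_span P \<subseteq> cone P"
  proof
    fix v assume "v \<in> nonneg_span P"
    then obtain X f where X: "finite X" "X \<subseteq> P" "\<forall>x\<in>X. f x \<ge> 0" "v = (\<lambda>k. \<Sum>x\<in>X. f x * x k)" by (auto simp: nonneg_span_def)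
    have "v = (\<Sum>x\<in>X. f x \<odot> x)" unfolding X(4) by (rule ext) (simp add: sum_vec_apply sm_apply)
    moreover have "f x \<odot> x \<in> cone P" if "x \<in> X" for x using X that by (intro cone_sm cone_base) auto
    ultimately show "v \<in> cone P" by (simp add: cone_sum)
  qed
  show "cone P \<subseteq> nonneg_span P"
  proof
    fix v assume "v \<in> cone P"
    then have "\<exists>X f. finite X \<and> X \<subseteq> P \<and> (\<forall>x\<in>X. f x \<ge> 0) \<and> v = (\<Sum>x\<in>X. f x \<odot> x)"
    proof induction
      case zero
      show ?case by (intro exI[of _ "{}"]) auto
    next
      case (add v p a)
      then obtain X f where X: "finite X" "X \<subseteq> P" "\<forall>x\<in>X. f x \<ge> 0" "v = (\<Sum>x\<in>X. f x \<odot> x)" by blast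
      define g where "g x = (if x \<in> X then f x else 0) + (if x = p then a else 0)" for x
      have "(\<Sum>x\<in>insert p X. g x \<odot> x) = (\<Sum>x\<in>insert p X. (if x \<in> X then f x \<odot> x else 0)) + (\<Sum>x\<in>insert p X. if x = p then a \<odot> x else 0)"
        unfolding sum.distrib[symmetric] by (intro sum.cong refl) (auto simp: g_def sm_distribs)
      also have "(\<Sum>x\<in>insert p X. (if x \<in> X then f x \<odot> x else 0)) = v"
        unfolding X(4) using X(1) by (intro sum.mono_neutral_cong_right) auto
      also have "(\<Sum>x\<in>insert p X. if x = p then a \<odot> x else 0) = a \<odot> p" using X(1) by simp
      finally show ?case using X add.hyps by (intro exI[of _ "insert p X"] exI[of _ g]) (auto simp: g_def)
    qed
    then obtain X f where X: "finite X" "X \<subseteq> P" "\<forall>x\<in>X. f x \<ge> 0" "v = (\<Sum>x\<in>X. f x \<odot> x)" by blast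
    have "v = (\<lambda>k. \<Sum>x\<in>X. f x * x k)" unfolding X(4) by (rule ext) (simp add: sum_vec_apply sm_apply)
    then show "v \<in> nonneg_span P" using X by (auto simp: nonneg_span_def)
  qed
qed

text \<open>A generating set of positive roots must contain each extremal \<open>p\<close>: a
  generator used in writing \<open>p\<close> is proportional to it, and it cannot be imaginary, as
  those have norm 0.\<close>

lemma Pi_c_eq: assumes ne: "P0 \<noteq> {}" shows "Pi_c A d n aff = P0"
proof -
  let ?S = "Upsilon A d n aff \<inter> positive_roots A n"
  have sub: "P0 \<subseteq> ?S" using P0_S Upsilon_pos_iff by blast
  have gen: "?S \<subseteq> cone P0"
  proof
    fix b assume "b \<in> ?S"
    then have "b \<in> S \<or> (\<exists>m. m \<in> \<int> \<and> m \<ge> 1 \<and> b = m \<odot> \<delta>)" using Upsilon_pos_iff by blast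
    then show "b \<in> cone P0" using S_cone cone_sm[OF delta_cone[OF ne]] by (metis zero_le_one order_trans)
  qed
  have mem: "p \<in> P" if P: "P \<subseteq> ?S" "?S \<subseteq> cone P" and p: "p \<in> P0" for P p
  proof -
    have "p \<in> nonneg_span P" using that sub nonneg_span_cone by blast
    then obtain X f where X: "finite X" "X \<subseteq> P" "\<forall>x\<in>X. f x \<ge> 0" "p = (\<lambda>k. \<Sum>x\<in>X. f x * x k)" by (auto simp: nonneg_span_def)
    have pX: "p = (\<Sum>x\<in>X. f x \<odot> x)" unfolding X(4) by (rule ext) (simp add: sum_vec_apply sm_apply)
    have "\<exists>x\<in>X. f x \<noteq> 0"
    proof (rule ccontr)
      assume "\<not> ?thesis"
      then have "p = 0" unfolding pX by (intro sum.neutral) auto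
      then show False using SD(6)[OF P0_S[OF p]] by blast
    qed
    then obtain x where x: "x \<in> X" "f x > 0" using X(3) by (metis less_eq_real_def)
    have cn: "f y \<odot> y \<in> cone P0" if "y \<in> X" for y 
    proof (rule cone_sm)
      show "y \<in> cone P0" using that X(2) P(1) gen by blast
    qed (use X(3) that in blast)
    have "f x \<odot> x + (\<Sum>y\<in>X - {x}. f y \<odot> y) = 1 \<odot> p" unfolding pX using X(1) x(1) by (simp add: sum.remove)
    moreover have "(\<Sum>y\<in>X - {x}. f y \<odot> y) \<in> cone P0" using cn by (intro cone_sum) auto
    ultimately obtain t where t: "t \<ge> 0" "f x \<odot> x = t \<odot> p" using P0_extremal[OF p cn[OF x(1)]] by blast
    have "(1 / f x) \<odot> f x \<odot> x = (t / f x) \<odot> p" unfolding t(2) using x(2) by simp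
    then have xt: "x = (t / f x) \<odot> p" using x(2) by simp
    have "x \<in> S \<or> (\<exists>m. m \<in> \<int> \<and> m \<ge> 1 \<and> x = m \<odot> \<delta>)" using x X P(1) Upsilon_pos_iff by blast
    then show ?thesis
    proof
      assume "x \<in> S"
      then have "rr ((t / f x) \<odot> p)" using SD(1) xt by simp
      then have "t / f x = 1" using rr_multiple[OF SD(1)[OF P0_S[OF p]]] P0_pos[OF p] t(1) x(2) by (meson divide_nonneg_pos)
      then have "x = p" using xt by simp
      then show ?thesis using x X by blast
    next
      assume "\<exists>m. m \<in> \<int> \<and> m \<ge> 1 \<and> x = m \<odot> \<delta>"
      then obtain m where m: "m \<ge> 1" "x = m \<odot> \<delta>" by blast
      have "E x x = 0" using m by (simp add: E_linear)
      then have "(t / f x) * (t / f x) * E p p = 0" using xt by (metis E_linear(5,6) mult.assoc)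
      then have "t / f x = 0" using SD(5)[OF P0_S[OF p]] by simp
      then have "x = 0" using xt by (metis sm_simps(1))
      then have "(m \<odot> \<delta>) aff = 0" using m(2) by (simp add: zero_fun_apply)
      then show ?thesis using m(1) by (simp add: sm_apply)
    qed
  qed
  show ?thesis unfolding Pi_c_def nonneg_span_cone
  proof (rule the_equality)
    have "\<not> ?S \<subseteq> cone Q" if Q: "Q \<subset> P0" for Q
    proof
      assume a: "?S \<subseteq> cone Q"
      obtain p where p: "p \<in> P0" "p \<notin> Q" using Q by blast
      then have "p \<in> cone Q" using a sub by blast
      then have "K p p \<le> 0" by (rule cone_fn_nonpos[OF _ linear_K(1)]) (use P0_K_nonpos p Q in blast)
      then show False using SD(5)[OF P0_S[OF p(1)]] by (simp add: K_self)
    qed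
    then show "P0 \<subseteq> ?S \<and> ?S \<subseteq> cone P0 \<and> (\<forall>Q. Q \<subset> P0 \<longrightarrow> \<not> ?S \<subseteq> cone Q)" using sub gen by blast
  next
    fix P assume P: "P \<subseteq> ?S \<and> ?S \<subseteq> cone P \<and> (\<forall>Q. Q \<subset> P \<longrightarrow> \<not> ?S \<subseteq> cone Q)"
    then have "P0 \<subseteq> P" using mem by blast
    then show "P = P0" using P gen by blast
  qed
qed

lemma K_c_ne: assumes "r \<in> P0" shows "K r (c r) \<noteq> 0"
proof -
  have "E (c r) r \<le> 0"
    using E_P0[OF P0_c[OF assms] assms] S_c_ne[OF P0_S[OF assms]] SD(5)[OF P0_S[OF assms]] by auto
  then show ?thesis using SD(5)[OF P0_S[OF assms]] by (simp add: K_def E_c_self)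
qed

lemma closed_orb: assumes "\<And>r. r \<in> T \<Longrightarrow> c r \<in> T" "p \<in> T" shows "orb p \<subseteq> T"
proof -
  have "cp i p \<in> T" for i by (induction i) (auto simp: assms)
  then show ?thesis by (auto simp: orb_def)
qed

text \<open>Consecutive roots \<open>r\<close> and \<open>c r\<close> are never orthogonal, and
  different orbits always are.\<close>

lemma tube_comps_eq: assumes ne: "P0 \<noteq> {}" shows "tube_comps A d n aff = orb ` P0"
proof
  show "tube_comps A d n aff \<subseteq> orb ` P0"
  proof
    fix C assume "C \<in> tube_comps A d n aff"
    then have C: "C \<subseteq> P0" "C \<noteq> {}" "\<And>T. T \<subseteq> C \<Longrightarrow> T \<noteq> {} \<Longrightarrow> T \<noteq> C \<Longrightarrow> \<exists>p\<in>T. \<exists>q\<in>C - T. K p q \<noteq> 0"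
      "\<And>p q. p \<in> C \<Longrightarrow> q \<in> P0 - C \<Longrightarrow> K p q = 0"
      by (auto simp: tube_comps_def Pi_c_eq[OF ne] K_Kform)
    obtain p where p: "p \<in> C" using C(2) by blast
    have "c r \<in> C" if "r \<in> C" for r using C(4)[OF that, of "c r"] K_c_ne[of r] that C(1) P0_c by blast
    then have sub: "orb p \<subseteq> C" using closed_orb p by blast
    have "orb p = C"
    proof (rule ccontr)
      assume "orb p \<noteq> C"
      then obtain x y where xy: "x \<in> orb p" "y \<in> C - orb p" "K x y \<noteq> 0" using C(3)[OF sub] orb_refl by blast
      have pP: "p \<in> P0" using p C by blast
      then show False using K_other_orbit[of x y] xy orb_P0[OF pP xy(1)] orb_eqI[OF P0_S[OF pP] xy(1)] C(1) by blast
    qed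
    then show "C \<in> orb ` P0" using p C by blast
  qed
  show "orb ` P0 \<subseteq> tube_comps A d n aff"
  proof
    fix C assume "C \<in> orb ` P0"
    then obtain p where p: "p \<in> P0" "C = orb p" by blast
    have "\<exists>x\<in>T. \<exists>y\<in>orb p - T. K x y \<noteq> 0" if T: "T \<subseteq> orb p" "T \<noteq> {}" "T \<noteq> orb p" for T
    proof (rule ccontr)
      assume *: "\<not> ?thesis"
      have "c r \<in> T" if "r \<in> T" for r using * K_c_ne[of r] that T(1) orb_c orb_P0[OF p(1)] by blast
      moreover obtain t where t: "t \<in> T" using T(2) by blast
      ultimately have "orb t \<subseteq> T" using closed_orb by blast
      then show False using T t orb_eqI[OF P0_S[OF p(1)]] by blast
    qed
    moreover have "K x y = 0" if "x \<in> orb p" "y \<in> P0 - orb p" for x y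
      using K_other_orbit[of x y] orb_P0[OF p(1) that(1)] that orb_eqI[OF P0_S[OF p(1)] that(1)] by blast
    ultimately show "C \<in> tube_comps A d n aff"
      using p orb_P0[OF p(1)] orb_refl[of p] unfolding tube_comps_def Pi_c_eq[OF ne] K_Kform by blast
  qed
qed

lemma E_Z_arc: assumes "z \<in> Z" "r \<in> P0" "E z r > 0" "p \<in> P0" "l \<le> per p" "r \<in> orb p"
  shows "E z (arc p l) = (if r \<in> aset p l then E z r else 0)"
proof -
  have "E z (arc p l) = (\<Sum>q\<in>aset p l. E z q)" by (simp add: arc_aset P0_S assms E_sum)
  also have "\<dots> = (\<Sum>q\<in>aset p l. if q = r then E z r else 0)"
  proof (intro sum.cong refl)
    fix q assume "q \<in> aset p l"
    then have "q \<in> orb r" using aset_orb orb_eqI[OF P0_S[OF assms(4)] assms(6)] by blast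
    then show "E z q = (if q = r then E z r else 0)" using Z_loc(2)[OF assms(1,2)] assms(3) by auto
  qed
  finally show ?thesis by simp
qed

text \<open>The point is uniqueness of the expansion: its coefficient at \<open>r\<close> is read
  off by an element of \<open>Z\<close> located at \<open>r\<close>.\<close>

lemma tsupp_arc: assumes p: "p \<in> P0" and l: "1 \<le> l" "l < per p"
  shows "tsupp A d n aff (arc p l) = aset p l"
proof
  have pS: "p \<in> S" using P0_S p .
  have ne: "P0 \<noteq> {}" using p by blast
  show "aset p l \<subseteq> tsupp A d n aff (arc p l)"
  proof
    fix r assume r: "r \<in> aset p l"
    let ?x = "\<lambda>q. if q \<in> aset p l then 1 else 0 :: real"
    have "arc p l k = (\<Sum>q\<in>orb p. ?x q * q k)" for k
    proof -
      have "arc p l k = (\<Sum>q\<in>aset p l. q k)" using pS l by (simp add: arc_aset sum_vec_apply)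
      also have "\<dots> = (\<Sum>q\<in>orb p. ?x q * q k)"
        using finite_orb[OF pS] aset_orb by (intro sum.mono_neutral_cong_left) auto
      finally show ?thesis .
    qed
    then have "arc p l = (\<lambda>k. \<Sum>q\<in>orb p. ?x q * q k)" by (rule ext)
    moreover have "r \<in> orb p" "?x r \<noteq> 0" using r aset_orb by auto
    moreover have "orb p \<in> tube_comps A d n aff" using tube_comps_eq[OF ne] p by blast
    ultimately show "r \<in> tsupp A d n aff (arc p l)"
      unfolding tsupp_def using finite_orb[OF pS]
      by (intro CollectI bexI[of _ "orb p"] exI[of _ ?x] conjI)
  qed
  show "tsupp A d n aff (arc p l) \<subseteq> aset p l"
  proof
    fix r assume "r \<in> tsupp A d n aff (arc p l)"
    then obtain C x where C: "C \<in> tube_comps A d n aff" "arc p l = (\<lambda>k. \<Sum>q\<in>C. x q * q k)" "r \<in> C" "x r \<noteq> 0"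
      by (auto simp: tsupp_def)
    obtain p' where p': "p' \<in> P0" "C = orb p'" using C(1) tube_comps_eq[OF ne] by blast
    have aC: "arc p l = (\<Sum>q\<in>C. x q \<odot> q)" unfolding C(2) by (rule ext) (simp add: sum_vec_apply sm_apply)
    have p'o: "p' \<in> orb p"
    proof (rule ccontr)
      assume no: "p' \<notin> orb p"
      have "K s q = 0" if "s \<in> orb p" "q \<in> C" for s q
      proof -
        have "q \<notin> orb s"
        proof
          assume "q \<in> orb s"
          then have "q \<in> orb p" using that orb_eqI[OF pS] by blast
          moreover have "p' \<in> orb q" using that p' orb_sym P0_S by blast
          ultimately show False using no orb_trans by blast
        qed
        then show ?thesis using K_other_orbit orb_P0 that p p' by blast
      qed
      then have "K (arc p l) q = 0" if "q \<in> C" for q 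
        using that aset_orb[of p l] pS l by (simp add: arc_aset K_sum subset_iff)
      then have "K (arc p l) (\<Sum>q\<in>C. x q \<odot> q) = 0" by (simp add: K_sum K_linear)
      then show False using SD(5)[OF arc_S[OF p l]] unfolding aC[symmetric] by (simp add: K_self)
    qed
    have Co: "C = orb p" using p'(2) orb_eqI[OF pS p'o] by simp
    have rP: "r \<in> P0" "r \<in> orb p" using C(3) Co orb_P0[OF p] by auto
    obtain z where z: "z \<in> Z" "E z r > 0" using loc_ex[OF rP(1)] by blast
    have "E z (arc p l) = (\<Sum>q\<in>C. x q * E z q)" unfolding aC by (simp add: E_sum E_linear)
    also have "\<dots> = (\<Sum>q\<in>C. if q = r then x r * E z r else 0)"
      using Z_loc(2)[OF z(1) rP(1)] z(2) orb_eqI[OF pS rP(2)] Co by (intro sum.cong refl) auto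
    also have "\<dots> = x r * E z r" using C(3) Co finite_orb[OF pS] by simp
    finally have "E z (arc p l) \<noteq> 0" using C(4) z(2) by simp
    then show "r \<in> aset p l" using E_Z_arc[OF z(1) rP(1) z(2) p _ rP(2), of l] l by (auto split: if_splits)
  qed
qed

section \<open>Compatibility degrees\<close>

lemma corootc_rr: "rr a \<Longrightarrow> corootc A d n a i = d i * a i / E a a"
  by (simp add: corootc_def rr_real_roots K_self flip: K_Kform)

lemma corootc_delta: "i < n \<Longrightarrow> corootc A d n \<delta> i = d i * \<delta> i / d aff"
  using delta_not_rr[of 1] by (simp add: corootc_def rr_real_roots delta_eq delta_vee_eq)

text \<open>For positive vectors the truncations disappear, and each degree keeps one triangular
  half of \<open>K\<close>. The scale \<open>t\<close> is the norm for a real root and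
  \<open>d aff\<close> for \<delta>.\<close>

lemma deg_general:
  assumes cr: "\<And>i. i < n \<Longrightarrow> corootc A d n a i = d i * a i / t" and "t > 0" "pos a" "pos b"
  shows "deg_left A d n a b = - E a b / t" "deg_right A d n a b = - E b a / t"
proof -
  have pa: "posp (corootc A d n a i) = d i * a i / t" if "i < n" for i
    using cr[OF that] d_pos[OF that] posD[OF assms(3), of i] assms(2) by (simp add: posp_def)
  have pb: "posp (b i) = b i" for i using posD[OF assms(4), of i] by (simp add: posp_def)
  have diag: "(\<Sum>i<n. corootc A d n a i * b i) = (\<Sum>i<n. \<Sum>j<n. if j = i then d i * a i / t * b i else 0)"
    using cr by (intro sum.cong refl) simp
  have "deg_left A d n a b = - (\<Sum>i<n. \<Sum>j<n. eul i j * a i * b j / t)"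
    unfolding deg_left_def diag minus_add_distrib[symmetric] diff_conv_add_uminus sum.distrib[symmetric]
    by (intro arg_cong[of _ _ uminus] sum.cong refl) (auto simp: pa pb eul_def)
  then show "deg_left A d n a b = - E a b / t" by (simp add: E_def sum_divide_distrib)
  have "deg_right A d n a b = - (\<Sum>i<n. \<Sum>j<n. eul j i * b j * a i / t)"
    unfolding deg_right_def diag minus_add_distrib[symmetric] diff_conv_add_uminus sum.distrib[symmetric]
    by (intro arg_cong[of _ _ uminus] sum.cong refl) (use d_sym in \<open>auto simp: pa pb eul_def mult_ac\<close>)
  also have "(\<Sum>i<n. \<Sum>j<n. eul j i * b j * a i / t) = (\<Sum>j<n. \<Sum>i<n. eul j i * b j * a i / t)" by (rule sum.swap)
  finally show "deg_right A d n a b = - E b a / t" by (simp add: E_def sum_divide_distrib)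
qed

lemma max_div: "t > 0 \<Longrightarrow> max (x / t) (y / t) = max x y / (t::real)"
  by (auto simp: max_def divide_le_cancel)

lemma cdeg_rr:
  assumes "rr a" "pos a" "pos b" "\<not> (a \<in> UR \<and> b \<in> UR \<and> comp_full A d n aff a b)"
  shows "cdeg A d n aff a b = max (- E a b) (- E b a) / E a a"
proof -
  have "deg_left A d n a b = - E a b / E a a" "deg_right A d n a b = - E b a / E a a"
    using deg_general[of a "E a a" b] corootc_rr[OF assms(1)] rrD(3)[OF assms(1)] assms by auto
  then have "cdeg A d n aff a b = max (- E b a / E a a) (- E a b / E a a)"
    using assms(4) by (simp only: cdeg_def Upsilon_re_eq if_False)
  then show ?thesis by (simp only: max_div[OF rrD(3)[OF assms(1)]] max.commute)
qed

lemma delta_not_UR: "\<delta> \<notin> UR"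
  using delta_not_rr[of 1] by (auto simp: UR_def S_def)

lemma cdeg_delta_left: assumes "pos b" shows "cdeg A d n aff \<delta> b = \<bar>E b \<delta>\<bar> / d aff"
proof -
  have "deg_left A d n \<delta> b = - E \<delta> b / d aff" "deg_right A d n \<delta> b = - E b \<delta> / d aff"
    using deg_general[of \<delta> "d aff" b] corootc_delta d_pos[OF aff_less] pos_delta assms by auto
  then have "cdeg A d n aff \<delta> b = max (- E b \<delta> / d aff) (- E \<delta> b / d aff)"
    using delta_not_UR by (simp only: cdeg_def Upsilon_re_eq if_False simp_thms)
  also have "\<dots> = max (- E b \<delta>) (- E \<delta> b) / d aff" by (rule max_div[OF d_pos[OF aff_less]])
  also have "max (- E b \<delta>) (- E \<delta> b) = \<bar>E b \<delta>\<bar>" by (simp add: E_delta_left[of b] abs_if max_def)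
  finally show ?thesis .
qed

lemma cdeg_delta_right: assumes "rr a" "pos a" shows "cdeg A d n aff a \<delta> = \<bar>E a \<delta>\<bar> / E a a"
  using cdeg_rr[OF assms pos_delta] delta_not_UR by (simp add: E_delta_left[of a] abs_if max_def)

lemma nsimple_not_pos: "\<not> pos (nsimple k)"
  by (auto simp: pos_def nsimple_def intro!: exI[of _ k])

lemma nsimple_not_UR: "nsimple k \<notin> UR"
  using nsimple_not_pos by (auto simp: UR_def S_def)

lemma corootc_nsimple: "k < n \<Longrightarrow> corootc A d n (nsimple k) i = (if i = k then -1 else 0)"
  using corootc_rr[of "nsimple k" i] rr_uminus[OF rr_simple, of k] d_pos[of k]
  by (auto simp: nsimple_eq E_linear simple_apply vec_simps)

lemma cdeg_nsimple_left: assumes "k < n" shows "cdeg A d n aff (nsimple k) b = b k"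
proof -
  have "(\<Sum>i<n. corootc A d n (nsimple k) i * b i) = (\<Sum>i<n. if i = k then - b k else 0)"
    by (intro sum.cong refl) (simp add: corootc_nsimple[OF assms])
  then have s: "(\<Sum>i<n. corootc A d n (nsimple k) i * b i) = - b k" using assms by simp
  have z: "posp (corootc A d n (nsimple k) i) = 0" for i by (simp add: corootc_nsimple[OF assms] posp_def)
  have "deg_left A d n (nsimple k) b = b k" "deg_right A d n (nsimple k) b = b k"
    unfolding deg_left_def deg_right_def s z by (simp_all cong: if_cong)
  then show ?thesis using nsimple_not_UR by (simp add: cdeg_def Upsilon_re_eq)
qed

lemma cdeg_nsimple_right: assumes "k < n" shows "cdeg A d n aff a (nsimple k) = corootc A d n a k"
proof -
  have "(\<Sum>i<n. corootc A d n a i * nsimple k i) = (\<Sum>i<n. if i = k then - corootc A d n a k else 0)"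
    by (intro sum.cong refl) (simp add: nsimple_def)
  then have s: "(\<Sum>i<n. corootc A d n a i * nsimple k i) = - corootc A d n a k" using assms by simp
  have z: "posp (nsimple k i) = 0" for i by (simp add: nsimple_def posp_def)
  have "deg_left A d n a (nsimple k) = corootc A d n a k" "deg_right A d n a (nsimple k) = corootc A d n a k"
    unfolding deg_left_def deg_right_def s z by (simp_all cong: if_cong)
  then show ?thesis using nsimple_not_UR by (simp add: cdeg_def Upsilon_re_eq)
qed

text \<open>A conjunction, because the degree is not symmetric in its arguments while clusters test
  both orders.\<close>

abbreviation compat :: "vec \<Rightarrow> vec \<Rightarrow> bool" where
  "compat a b \<equiv> c_compatible A d n aff a b \<and> c_compatible A d n aff b a"

lemma compat_rr:
  assumes "rr a" "pos a" "rr b" "pos b" "a \<noteq> b" "\<not> (a \<in> UR \<and> b \<in> UR \<and> comp_full A d n aff a b)"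
  shows "compat a b \<longleftrightarrow> max (- E a b) (- E b a) = 0"
proof -
  have "\<not> (b \<in> UR \<and> a \<in> UR \<and> comp_full A d n aff b a)" using assms(6) by (auto simp: comp_full_def Un_commute)
  then show ?thesis using cdeg_rr[OF assms(1,2,4,6)] cdeg_rr[OF assms(3,4,2)] rrD(3)[OF assms(1)] rrD(3)[OF assms(3)] assms(5)
    by (simp add: c_compatible_def max.commute)
qed

lemma compat_nsimple: assumes "k < n" "rr b" "pos b" shows "compat (nsimple k) b \<longleftrightarrow> b k = 0" "compat b (nsimple k) \<longleftrightarrow> b k = 0"
proof -
  have ne: "nsimple k \<noteq> b" using nsimple_not_pos assms(3) by blast
  have "corootc A d n b k = 0 \<longleftrightarrow> b k = 0" using corootc_rr[OF assms(2)] d_pos[OF assms(1)] rrD(3)[OF assms(2)] by simp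
  then show "compat (nsimple k) b \<longleftrightarrow> b k = 0"
    using ne by (simp add: c_compatible_def cdeg_nsimple_left cdeg_nsimple_right assms(1))
  then show "compat b (nsimple k) \<longleftrightarrow> b k = 0" by blast
qed

lemma compat_nsimple_nsimple: assumes "k < n" "l < n" "k \<noteq> l" shows "compat (nsimple k) (nsimple l)"
proof -
  have "nsimple k \<noteq> nsimple l" using assms(3) by (auto simp: nsimple_def fun_eq_iff)
  moreover have "nsimple k l = 0" "nsimple l k = 0" using assms(3) by (auto simp: nsimple_def)
  ultimately show ?thesis using assms by (auto simp: c_compatible_def cdeg_nsimple_left)
qed

lemma compat_delta: assumes "rr b" "pos b" shows "compat \<delta> b \<longleftrightarrow> E b \<delta> = 0"
proof -
  have "\<delta> \<noteq> b" using assms(1) delta_not_rr[of 1] by auto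
  then show ?thesis using cdeg_delta_left[OF assms(2)] cdeg_delta_right[OF assms] d_pos[OF aff_less] rrD(3)[OF assms(1)]
    by (auto simp: c_compatible_def)
qed

lemma not_compat_delta_nsimple: "k < n \<Longrightarrow> \<not> compat \<delta> (nsimple k)"
  using delta_pos[of k] by (simp add: c_compatible_def cdeg_nsimple_left)

section \<open>Roots outside the tubes\<close>

text \<open>\<open>hat w x\<close> matches the roots \<open>w\<close> of \<open>\<Phi>\<^sub>c\<close> outside \<open>U\<close> with the real roots \<open>x\<close>, of either sign, such that
  \<open>E(x, \<delta>) > 0\<close>; compatibility of \<open>w\<close> with a root \<open>q\<close> of a tube becomes \<open>E(x, q) = 0\<close>.\<close>

definition hat :: "vec \<Rightarrow> vec \<Rightarrow> bool" where
  "hat w x \<longleftrightarrow> rr x \<and> E x \<delta> > 0 \<and>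
     (\<not> pos x \<and> w = - x \<or> pos x \<and> pos (c x) \<and> w = c x \<or> (\<exists>k. yroot k x \<and> w = nsimple k))"

definition off_U :: "vec \<Rightarrow> bool" where
  "off_U w \<longleftrightarrow> w \<in> nsimple ` {..<n} \<or> rr w \<and> pos w \<and> E w \<delta> \<noteq> 0"

lemma hat_cases:
  assumes "hat w x"
  obtains (neg) "rr x" "E x \<delta> > 0" "\<not> pos x" "w = - x" "rr w" "pos w" "E w \<delta> < 0"
  | (pos) "rr x" "E x \<delta> > 0" "pos x" "w = c x" "rr w" "pos w" "E w \<delta> > 0"
  | (simple) k where "rr x" "E x \<delta> > 0" "pos x" "yroot k x" "k < n" "w = nsimple k"
proof -
  have x: "rr x" "E x \<delta> > 0" using assms by (auto simp: hat_def)
  consider "\<not> pos x" "w = - x" | "pos x" "pos (c x)" "w = c x" | k where "yroot k x" "w = nsimple k"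
    using assms by (auto simp: hat_def)
  then show ?thesis
  proof cases
    case 1
    then show ?thesis using neg x rr_not_pos[OF x(1)] rr_uminus[OF x(1)] by (simp add: E_linear)
  next
    case 2
    then show ?thesis using pos x rr_c[OF x(1)] by simp
  next
    case 3
    then show ?thesis using simple x yroot_pos yroot_less by blast
  qed
qed

lemma hat_off_U: "hat w x \<Longrightarrow> off_U w"
  by (erule hat_cases) (auto simp: off_U_def)

lemma off_U_not: "off_U w \<Longrightarrow> w \<notin> UR \<and> w \<noteq> \<delta>"
  using nsimple_not_UR nsimple_not_pos pos_delta delta_not_rr[of 1] by (auto simp: off_U_def UR_def S_def)

lemma Phi_c_iff: "w \<in> Phi_c A d n aff \<longleftrightarrow> off_U w \<or> w \<in> UR \<or> w = \<delta>"
  by (auto simp: Phi_c_eq off_U_def)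

lemma hat_total: assumes "rr x" "E x \<delta> > 0" shows "\<exists>w. hat w x"
proof (cases "pos x \<and> \<not> pos (c x)")
  case True
  then obtain k where "yroot k x" using c_negative_yroot assms by blast
  then show ?thesis using assms by (auto simp: hat_def)
next
  case False
  then show ?thesis using assms by (auto simp: hat_def)
qed

lemma hat_surj: assumes "off_U w" shows "\<exists>x. hat w x"
proof -
  consider k where "k < n" "w = nsimple k" | "rr w" "pos w" "E w \<delta> > 0" | "rr w" "pos w" "E w \<delta> < 0"
    using assms unfolding off_U_def by (auto simp: image_iff) (metis linorder_neqE_linordered_idom)
  then show ?thesis
  proof cases
    case 1
    obtain x where x: "yroot k x" using yroot_ex[OF 1(1)] by blast
    have "E x \<delta> > 0" using yroot_E[OF x, of \<delta>] d_pos[OF 1(1)] delta_pos[OF 1(1)] by simp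
    then show ?thesis using x 1 yroot_rr by (auto simp: hat_def)
  next
    case 2
    then have "hat w (ci w)" using pos_ci rr_ci by (simp add: hat_def)
    then show ?thesis by blast
  next
    case 3
    then have "hat w (- w)" using rr_uminus rr_not_pos[of "- w"] by (simp add: hat_def E_linear)
    then show ?thesis by blast
  qed
qed

lemma yroot_unique: assumes "yroot k x" "yroot l x" shows "k = l"
proof -
  have "d k = d l * simple k l" using yroot_E[OF assms(1), of "simple k"] yroot_E[OF assms(2), of "simple k"]
    by (simp add: simple_apply)
  then show ?thesis using d_pos[OF yroot_less[OF assms(1)]] by (cases "l = k") (simp_all add: simple_apply)
qed

lemma hat_unique: "hat w x \<Longrightarrow> hat w' x \<Longrightarrow> w = w'"
  unfolding hat_def using yroot_unique yroot_pos yroot_c_neg by blast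

lemma UR_S: "q \<in> UR \<Longrightarrow> q \<in> S"
  by (simp add: UR_def)

text \<open>One of the two Euler pairings of \<open>w\<close> and \<open>q\<close> is
  \<open>- E x q\<close>, and the other is nonnegative by \<open>E_nonneg_S\<close>; for a negative
  simple root the degree is a coordinate of \<open>q\<close>, again a multiple of
  \<open>E x q\<close>.\<close>

lemma hat_compat_UR: assumes "hat w x" "q \<in> UR" shows "compat w q \<longleftrightarrow> E x q = 0"
proof -
  have q: "q \<in> S" "rr q" "pos q" using UR_S SD assms by blast+
  have wU: "w \<notin> UR" "w \<noteq> q" using off_U_not[OF hat_off_U[OF assms(1)]] assms(2) by auto
  from assms(1) show ?thesis
  proof (cases rule: hat_cases)
    case neg
    have "E w q = - E x q" "E q w = E x (c q)" using neg(4) by (simp_all add: E_linear E_cox)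
    moreover have "E x q \<ge> 0" "E x (c q) \<ge> 0" using E_nonneg_S[OF neg(1,2)] q(1) S_c by blast+
    ultimately show ?thesis using compat_rr[OF neg(5,6) q(2,3) wU(2)] wU(1) by (simp add: max_def)
  next
    case pos
    have "E q w = - E x q" "E w q = E x (ci q)" using pos(4) by (simp_all add: E_cox E_ci_right)
    moreover have "E x q \<ge> 0" "E x (ci q) \<ge> 0" using E_nonneg_S[OF pos(1,2)] q(1) S_ci by blast+
    ultimately show ?thesis using compat_rr[OF pos(5,6) q(2,3) wU(2)] wU(1) by (auto simp: max_def)
  next
    case (simple k)
    then show ?thesis using compat_nsimple(1)[OF simple(5) q(2,3)] yroot_E[OF simple(4), of q] d_pos[OF simple(5)] by simp
  qed
qed

lemma hat_degrees: assumes "hat w x"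
  shows "cdeg A d n aff w \<delta> = E x \<delta> / E x x" "cdeg A d n aff \<delta> w = E x \<delta> / d aff"
proof -
  show "cdeg A d n aff w \<delta> = E x \<delta> / E x x" using assms
    by (cases rule: hat_cases)
      (auto simp: cdeg_delta_right E_linear cdeg_nsimple_left yroot_norm yroot_E dest: d_pos)
  show "cdeg A d n aff \<delta> w = E x \<delta> / d aff" using assms
    by (cases rule: hat_cases)
      (auto simp: cdeg_delta_left E_linear cdeg_nsimple_right corootc_delta yroot_E)
qed

lemma hat_Z: assumes "hat w x"
  shows "cdeg A d n aff w \<delta> = 1 \<and> cdeg A d n aff \<delta> w = 1 \<longleftrightarrow> x \<in> Z"
proof -
  have x: "rr x" "E x x > 0" "d aff > 0" using assms rrD(3) d_pos[OF aff_less] by (auto simp: hat_def)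
  show ?thesis unfolding hat_degrees[OF assms] using x by (auto simp: Z_def divide_eq_1_iff)
qed

text \<open>With \<open>x' = x + u \<odot> \<delta>\<close>, the two Euler values are
  \<open>d aff * (1 + u)\<close> and \<open>d aff * (1 - u)\<close>, so the larger negated one is
  \<open>d aff * (u - 1)\<close>. The cases follow this through the signs and shifts in
  \<open>hat\<close>.\<close>

lemma hat_chain:
  assumes x: "x \<in> Z" and u: "u \<ge> 1" and w: "hat w x" and w': "hat w' (x + u \<odot> \<delta>)"
  shows "compat w w' \<longleftrightarrow> u = 1"
proof -
  define x' where "x' = x + u \<odot> \<delta>"
  have d0: "d aff > 0" by (rule d_pos) simp
  have Z: "E x x = d aff" "E x \<delta> = d aff" "E \<delta> x = - d aff" using x by (auto simp: Z_def E_delta_left)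
  have e: "E x x' = d aff * (1 + u)" "E x' x = d aff * (1 - u)" using Z by (simp_all add: x'_def E_linear algebra_simps)
  have ww: "off_U w" "off_U w'" using w w' hat_off_U by blast+
  have nUR: "\<not> (w \<in> UR \<and> w' \<in> UR \<and> comp_full A d n aff w w')" using off_U_not ww by blast
  have pp: "pos x \<Longrightarrow> pos x'" unfolding x'_def using u pos_delta by (intro pos_add pos_sm) auto
  have xx: "x \<noteq> x'" using e Z u d0 by auto
  have same: "max (- E x x') (- E x' x) = 0 \<longleftrightarrow> u = 1"
  proof -
    have "max (- E x x') (- E x' x) = d aff * (u - 1)" using u d0 unfolding e
      by (auto simp: max_def algebra_simps not_le)
    then show ?thesis using d0 by simp
  qed
  note w'' = w'[folded x'_def]
  from w show ?thesis
  proof (cases rule: hat_cases)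
    case (neg)
    note N = neg
    from w'' show ?thesis
    proof (cases rule: hat_cases)
      case neg
      have "w \<noteq> w'" using N(4) neg(4) xx by auto
      then show ?thesis using compat_rr[OF N(5,6) neg(5,6) _ nUR] same N(4) neg(4) by (simp add: E_linear)
    next
      case pos
      have ne: "w \<noteq> w'" using N(7) pos(7) by auto
      have 1: "E w w' = d aff * (1 - u)" using N(4) pos(4) e by (simp add: E_linear E_cox)
      have 2: "E w' w \<ge> 0" using E_nonneg_pos_neg[OF pos(5,6,7) N(5,6,7)] .
      have "max (- E w w') (- E w' w) = 0 \<longleftrightarrow> u = 1"
      proof
        assume "max (- E w w') (- E w' w) = 0"
        then have "- E w w' \<le> 0" by (metis max.cobounded1)
        then have "u \<le> 1" using 1 d0 by (simp add: zero_le_mult_iff)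
        then show "u = 1" using u by simp
      next
        assume "u = 1"
        then show "max (- E w w') (- E w' w) = 0" using 1 2 by (simp add: max_def)
      qed
      then show ?thesis using compat_rr[OF N(5,6) pos(5,6) ne nUR] by simp
    next
      case (simple k)
      have "d k * w k = d aff * (u - 1)" using yroot_E[OF simple(4), of w] N(4) e by (simp add: E_linear algebra_simps)
      then have "w k = 0 \<longleftrightarrow> u = 1" using d_pos[OF simple(5)] d0 by (metis mult_eq_0_iff less_irrefl eq_iff_diff_eq_0)
      then show ?thesis using compat_nsimple(2)[OF simple(5) N(5,6)] simple(6) by simp
    qed
  next
    case (pos)
    note P = pos
    from w'' show ?thesis
    proof (cases rule: hat_cases)
      case neg
      then show ?thesis using pp P(3) by blast
    next
      case pos
      have "w \<noteq> w'" using P(4) pos(4) xx by (simp add: c_inj)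
      then show ?thesis using compat_rr[OF P(5,6) pos(5,6) _ nUR] same P(4) pos(4) by simp
    next
      case (simple k)
      \<comment> \<open>This case does not occur: a positive \<open>w\<close> has no negative
        coordinate.\<close>
      have "d k * w k = - (d aff * (1 + u))" using yroot_E[OF simple(4), of w] P(4) e by (simp add: E_cox)
      moreover have "d k * w k \<ge> 0" using d_pos[OF simple(5)] posD[OF P(6)] by simp
      moreover have "d aff * (1 + u) > 0" using d0 u by simp
      ultimately show ?thesis by linarith
    qed
  next
    case (simple k)
    note Y = simple
    from w'' show ?thesis
    proof (cases rule: hat_cases)
      case neg
      then show ?thesis using pp Y(3) by blast
    next
      case pos
      have "d k * w' k = d aff * (u - 1)" using yroot_E[OF Y(4), of w'] pos(4) e by (simp add: E_cox algebra_simps)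
      then have "w' k = 0 \<longleftrightarrow> u = 1" using d_pos[OF Y(5)] d0 by (metis mult_eq_0_iff less_irrefl eq_iff_diff_eq_0)
      then show ?thesis using compat_nsimple(1)[OF Y(5) pos(5,6)] Y(6) by simp
    next
      case (simple l)
      \<comment> \<open>Positivity of \<open>x\<close> forces \<open>u = 1\<close> here, in
        agreement with the compatibility of distinct negative simple roots.\<close>
      have 1: "d l * x l = d aff * (1 - u)" using yroot_E[OF simple(4), of x] e by simp
      have "d l * x l \<ge> 0" using d_pos[OF simple(5)] posD[OF Y(3)] by simp
      then have "u \<le> 1" using 1 d0 by (simp add: zero_le_mult_iff)
      then have u1: "u = 1" using u by simp
      have "k \<noteq> l"
      proof
        assume "k = l"
        then show False using 1 u1 yroot_coord[OF Y(4)] d_pos[OF simple(5)] by simp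
      qed
      then show ?thesis using compat_nsimple_nsimple Y simple u1 by simp
    qed
  qed
qed

section \<open>Compatibility inside the tubes\<close>

text \<open>\<open>E_arc_right\<close> telescopes along the first arc, leaving its start and the
  position just after its end.\<close>

lemma E_arc_arc: assumes "p \<in> P0" "q \<in> P0" "m \<le> per q"
  shows "E (arc p l) (arc q m) = E p p * ((if p \<in> aset q m then 1 else 0) - (if cp l p \<in> aset q m then 1 else 0))"
proof -
  have "E (arc p l) (arc q m) = (\<Sum>i<l. E (cp i p) (arc q m))" by (simp add: arc_def[of p] E_sum)
  also have "\<dots> = (\<Sum>i<l. E p p * ((if cp i p \<in> aset q m then 1 else 0) - (if cp (Suc i) p \<in> aset q m then 1 else 0)))"
    by (intro sum.cong refl) (simp add: E_arc_right[OF P0_cp[OF assms(1)] assms(2,3)])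
  also have "\<dots> = E p p * (\<Sum>i<l. (if cp i p \<in> aset q m then 1 else 0) - (if cp (Suc i) p \<in> aset q m then 1 else 0))"
    by (simp only: sum_distrib_left)
  also have "(\<Sum>i<l. (if cp i p \<in> aset q m then 1 else 0) - (if cp (Suc i) p \<in> aset q m then 1 else 0))
    = (if p \<in> aset q m then 1 else 0) - (if cp l p \<in> aset q m then (1::real) else 0)"
    using sum_lessThan_telescope'[of "\<lambda>i. if cp i p \<in> aset q m then 1 else (0::real)" l] by simp
  finally show ?thesis .
qed

lemma aset_proper: assumes "p \<in> S" "l < per p" shows "cp l p \<notin> aset p l"
  using cp_mem_aset[OF assms, of l] assms by simp

text \<open>A proper arc never covers its own orbit, so covering one takes both arcs.\<close>

lemma comp_full_arcs:
  assumes p: "p \<in> P0" "1 \<le> l" "l < per p" and q: "q \<in> P0" "1 \<le> m" "m < per q"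
    and full: "comp_full A d n aff (arc p l) (arc q m)"
  shows "orb p \<subseteq> aset p l \<union> aset q m" "q \<in> orb p"
proof -
  have "P0 \<noteq> {}" using p by blast
  then obtain r where r: "r \<in> P0" "orb r \<subseteq> aset p l \<union> aset q m"
    using full by (auto simp: comp_full_def tsupp_arc[OF p] tsupp_arc[OF q] tube_comps_eq)
  have dis: "\<not> orb s \<subseteq> aset s k" if "s \<in> P0" "k < per s" for s k
    using aset_proper[OF P0_S[OF that(1)] that(2)] orb_cp[OF orb_refl] by blast
  have rpq: "r \<in> orb p \<or> r \<in> orb q" using r(2) orb_refl[of r] aset_orb by blast
  show qp: "q \<in> orb p"
  proof (rule ccontr)
    assume no: "q \<notin> orb p"
    have disj: "orb p \<inter> orb q = {}"
    proof (rule ccontr)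
      assume "orb p \<inter> orb q \<noteq> {}"
      then obtain s where "s \<in> orb p" "s \<in> orb q" by blast
      then show False using no orb_eqI[OF P0_S[OF p(1)]] orb_eqI[OF P0_S[OF q(1)]] orb_refl by metis
    qed
    from rpq show False
    proof
      assume "r \<in> orb p"
      then have "orb p \<subseteq> aset p l \<union> aset q m" using r orb_eqI[OF P0_S[OF p(1)]] by blast
      then have "orb p \<subseteq> aset p l" using disj aset_orb by blast
      then show False using dis[OF p(1,3)] by blast
    next
      assume "r \<in> orb q"
      then have "orb q \<subseteq> aset p l \<union> aset q m" using r orb_eqI[OF P0_S[OF q(1)]] by blast
      then have "orb q \<subseteq> aset q m" using disj aset_orb by blast
      then show False using dis[OF q(1,3)] by blast
    qed
  qed
  then have "orb q = orb p" using orb_eqI[OF P0_S[OF p(1)]] by blast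
  then have "orb r = orb p" using rpq orb_eqI[OF P0_S[OF p(1)]] by blast
  then show "orb p \<subseteq> aset p l \<union> aset q m" using r by simp
qed

lemma compat_arcs:
  assumes p: "p \<in> P0" "1 \<le> l" "l < per p" and q: "q \<in> P0" "1 \<le> m" "m < per q"
    and ne: "arc p l \<noteq> arc q m" and nfull: "\<not> comp_full A d n aff (arc p l) (arc q m)"
  shows "compat (arc p l) (arc q m) \<longleftrightarrow> max (- E (arc p l) (arc q m)) (- E (arc q m) (arc p l)) = 0"
  using compat_rr[OF _ _ _ _ ne] SD[OF arc_S[OF p]] SD[OF arc_S[OF q]] nfull by blast

lemma full_complement: assumes "a \<in> P0" shows "aset (c a) (per a - 1) = orb a - {a}"
proof -
  have S: "a \<in> S" using P0_S assms .
  have eq: "aset (c a) (per a - 1) = (\<lambda>i. cp (Suc i) a) ` {..<per a - 1}" by (simp add: aset_def funpow_swap1)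
  have ne: "cp (Suc i) a \<noteq> a" if "i < per a - 1" for i using per_least[of "Suc i" a] that by simp
  have "r \<in> aset (c a) (per a - 1)" if r: "r \<in> orb a" "r \<noteq> a" for r
  proof -
    obtain i where i: "i < per a" "r = cp i a" using r orb_eq[OF S] by auto
    then obtain j where "i = Suc j" using r(2) by (cases i) auto
    then show ?thesis unfolding eq using i by (intro image_eqI[of _ _ j]) auto
  qed
  moreover have "r \<in> orb a - {a}" if r: "r \<in> aset (c a) (per a - 1)" for r
  proof -
    obtain i where i: "i < per a - 1" "r = cp (Suc i) a" using r unfolding eq by blast
    then show ?thesis using ne[OF i(1)] orb_cp[OF orb_refl[of a], of "Suc i"] by (simp only: Diff_iff singleton_iff simp_thms)
  qed
  ultimately show ?thesis by blast
qed

lemma complement_arc: assumes "a \<in> P0"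
  shows "1 \<le> per a - 1" "per a - 1 < per (c a)" "c a \<in> P0" "arc (c a) (per a - 1) \<in> UR"
proof -
  have S: "a \<in> S" using P0_S assms .
  show 1: "1 \<le> per a - 1" using per_ge2[OF S] by simp
  show 2: "per a - 1 < per (c a)" using per_orb[OF S orb_c[OF orb_refl]] per_pos[OF S] by simp
  show "c a \<in> P0" using P0_c assms .
  then show "arc (c a) (per a - 1) \<in> UR" using arc_UR 1 2 by blast
qed

text \<open>The arc omitting only \<open>a\<close> is \<open>mu a \<odot> \<delta> - a\<close>, so
  its pairings are those of \<open>- a\<close>. Both are nonnegative, and they are positive together
  only if the other arc runs from \<open>c a\<close> to \<open>ci a\<close>, which is the same
  arc.\<close>

lemma compat_complement:
  assumes a: "a \<in> P0" and p: "p \<in> P0" "1 \<le> l" "l < per p" "a \<notin> aset p l" and ne: "arc p l \<noteq> arc (c a) (per a - 1)"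
  shows "compat (arc p l) (arc (c a) (per a - 1))"
proof -
  let ?B = "arc (c a) (per a - 1)"
  have pS: "p \<in> S" and aS: "a \<in> S" using P0_S a p by auto
  note ca = complement_arc[OF a]
  have nf: "\<not> comp_full A d n aff (arc p l) ?B"
  proof
    assume f: "comp_full A d n aff (arc p l) ?B"
    note cf = comp_full_arcs[OF p(1-3) ca(3,1,2) f]
    have "a \<in> orb p" using cf(2) orb_sym[OF aS orb_c[OF orb_refl]] orb_trans by blast
    then show False using cf(1) p(4) full_complement[OF a] by blast
  qed
  have B: "?B = mu a \<odot> \<delta> - a" using arc_complement[OF a] .
  have aS0: "E (arc p l) \<delta> = 0" "E \<delta> (arc p l) = 0" using SD(3,7)[OF arc_S[OF p(1-3)]] by auto
  have 1: "E ?B (arc p l) = E a a * (if c a \<in> aset p l then 1 else 0)"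
    unfolding B using E_arc_right[OF a p(1), of l] p(3,4) aS0 by (simp add: E_linear)
  have 2: "E (arc p l) ?B = E a a * (if ci a \<in> aset p l then 1 else 0)"
  proof -
    have "E (arc p l) (c (ci a)) = E (ci a) (ci a) * (0 - (if ci a \<in> aset p l then 1 else 0))"
      using E_arc_left[OF P0_ci[OF a] p(1), of l] p(3,4) by simp
    moreover have "E (ci a) (ci a) = E a a" using E_c_c[of "ci a" "ci a"] by simp
    ultimately show ?thesis unfolding B using aS0 by (simp add: E_linear)
  qed
  have "\<not> (c a \<in> aset p l \<and> ci a \<in> aset p l)"
  proof
    assume both: "c a \<in> aset p l \<and> ci a \<in> aset p l"
    then obtain i j where i: "i < l" "c a = cp i p" and j: "j < l" "ci a = cp j p" by (auto simp: aset_def)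
    have i0: "i = 0"
    proof (rule ccontr)
      assume "i \<noteq> 0"
      then have "c a = c (cp (i - 1) p)" using i by (cases i) auto
      then have "a = cp (i - 1) p" by (simp only: c_inj)
      then show False using p(4) i \<open>i \<noteq> 0\<close> by (auto simp: aset_def)
    qed
    have aj: "a = cp (Suc j) p" using j(2) c_ci[of a] by simp
    have "\<not> Suc j < l"
    proof
      assume "Suc j < l"
      then have "cp (Suc j) p \<in> aset p l" unfolding aset_def by (intro image_eqI[of _ _ "Suc j"]) auto
      then show False using p(4) aj by simp
    qed
    then have al: "a = cp l p" using aj j by (metis Suc_lessI)
    then have "cp (Suc l) p = p" using i i0 by simp
    then have "Suc l = per p" using per_least[of "Suc l" p] p(3) by (metis Suc_lessI zero_less_Suc)
    moreover have "per p = per a" using per_orb[OF pS, of a] al orb_cp[OF orb_refl] by simp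
    ultimately have "l = per a - 1" by simp
    then show False using ne i i0 by simp
  qed
  then have "max (- E (arc p l) ?B) (- E ?B (arc p l)) = 0" unfolding 1 2 using SD(5)[OF aS] by (auto simp: max_def)
  then show ?thesis using compat_arcs[OF p(1-3) ca(3,1,2) ne nf] by blast
qed

text \<open>For each chosen \<open>a\<close>, the nested arcs starting just after \<open>a\<close>;
  the longest is the whole orbit without \<open>a\<close>.\<close>

definition fan :: "vec set \<Rightarrow> vec set" where
  "fan L = {arc (c a) l | a l. a \<in> L \<and> 1 \<le> l \<and> l < per a}"

lemma fanE: assumes "b \<in> fan L" "L \<subseteq> P0"
  obtains a l where "a \<in> L" "b = arc (c a) l" "c a \<in> P0" "1 \<le> l" "l < per (c a)"
  using assms P0_c per_orb[OF P0_S orb_c[OF orb_refl]] by (auto simp: fan_def)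

lemma fan_UR: "L \<subseteq> P0 \<Longrightarrow> fan L \<subseteq> UR"
  using arc_UR by (auto elim!: fanE)

lemma compat_initial:
  assumes "p \<in> P0" "1 \<le> l" "l < m" "m < per p"
  shows "compat (arc p l) (arc p m)"
proof -
  have S: "p \<in> S" using P0_S assms by blast
  have m1: "1 \<le> m" "l < per p" using assms by auto
  have nf: "\<not> comp_full A d n aff (arc p l) (arc p m)"
  proof
    assume f: "comp_full A d n aff (arc p l) (arc p m)"
    then have "cp m p \<in> aset p l \<union> aset p m"
      using comp_full_arcs(1)[OF assms(1,2) m1(2) assms(1) m1(1) assms(4) f] orb_cp[OF orb_refl] by blast
    then show False using cp_mem_aset[OF S assms(4)] assms by auto
  qed
  have "E (arc p l) (arc p m) = 0" "E (arc p m) (arc p l) = E p p"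
    using E_arc_arc[OF assms(1,1), of m l] E_arc_arc[OF assms(1,1), of l m] assms
      cp_mem_aset[OF S, of 0] cp_mem_aset[OF S, of l] cp_mem_aset[OF S, of m] by auto
  moreover from this have "arc p l \<noteq> arc p m" using SD(5)[OF S] SD(5)[OF arc_S[OF assms(1,2) m1(2)]] by auto
  ultimately show ?thesis using compat_arcs[OF assms(1,2) m1(2) assms(1) m1(1) assms(4) _ nf] SD(5)[OF S] by simp
qed

lemma compat_other_orbits:
  assumes p: "p \<in> P0" "1 \<le> l" "l < per p" and q: "q \<in> P0" "1 \<le> m" "m < per q" and no: "q \<notin> orb p"
  shows "compat (arc p l) (arc q m)"
proof -
  have no': "p \<notin> orb q" using no orb_sym P0_S q(1) by blast
  have "x \<notin> aset q m" if "x \<in> orb p" for x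
    using that no aset_orb[of q m] orb_eqI[OF P0_S[OF p(1)]] orb_eqI[OF P0_S[OF q(1)]] orb_refl by blast
  then have e1: "E (arc p l) (arc q m) = 0" using E_arc_arc[OF p(1) q(1), of m l] q(3) orb_cp[OF orb_refl] orb_refl by simp
  have "x \<notin> aset p l" if "x \<in> orb q" for x
    using that no' aset_orb[of p l] orb_eqI[OF P0_S[OF p(1)]] orb_eqI[OF P0_S[OF q(1)]] orb_refl by blast
  then have e2: "E (arc q m) (arc p l) = 0" using E_arc_arc[OF q(1) p(1), of l m] p(3) orb_cp[OF orb_refl] orb_refl by simp
  have "arc p l \<noteq> arc q m" using e1 SD(5)[OF arc_S[OF p]] by auto
  moreover have "\<not> comp_full A d n aff (arc p l) (arc q m)" using comp_full_arcs(2)[OF p q] no by blast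
  ultimately show ?thesis using compat_arcs[OF p q] e1 e2 by simp
qed

lemma fan_pairwise:
  assumes L: "L \<subseteq> P0" "\<And>a b. a \<in> L \<Longrightarrow> b \<in> L \<Longrightarrow> b \<in> orb a \<Longrightarrow> a = b"
    and A: "X \<in> fan L" "Y \<in> fan L" "X \<noteq> Y"
  shows "compat X Y"
proof -
  obtain a l where a: "a \<in> L" "X = arc (c a) l" "c a \<in> P0" "1 \<le> l" "l < per (c a)" using fanE[OF A(1) L(1)] .
  obtain b m where b: "b \<in> L" "Y = arc (c b) m" "c b \<in> P0" "1 \<le> m" "m < per (c b)" using fanE[OF A(2) L(1)] .
  show ?thesis
  proof (cases "a = b")
    case True
    then have "l < m \<or> m < l" using a b A(3) by (metis nat_neq_iff)
    then show ?thesis using compat_initial[of "c a" l m] compat_initial[of "c a" m l] a b True by auto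
  next
    case False
    have "c b \<notin> orb (c a)"
    proof
      assume "c b \<in> orb (c a)"
      moreover have "orb (c a) = orb a" "b \<in> orb (c b)"
        using orb_eqI[OF P0_S orb_c[OF orb_refl]] orb_sym[OF P0_S orb_c[OF orb_refl]] a(1) b(1) L(1) by blast+
      ultimately have "b \<in> orb a" using orb_trans by blast
      then show False using L(2)[OF a(1) b(1)] False by blast
    qed
    then show ?thesis using compat_other_orbits a b by blast
  qed
qed

text \<open>An arc outside the fan starts \<open>j > 0\<close> places after \<open>P = c a\<close>.
  If it ends before \<open>a\<close>, the fan arc of length \<open>j\<close> ends right in front of
  it and pairs negatively with it. If it contains \<open>a\<close>, it is component-full with the
  longest fan arc, and \<open>a\<close> is counted by \<open>adj\<close>.\<close>

lemma fan_maximal: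
  assumes L: "L \<subseteq> P0" "\<And>p. p \<in> P0 \<Longrightarrow> \<exists>a\<in>L. a \<in> orb p" and B: "B \<in> UR" "B \<notin> fan L"
  shows "\<exists>X\<in>fan L. \<not> c_compatible A d n aff X B"
proof -
  obtain p l where p: "p \<in> P0" "1 \<le> l" "l < per p" "B = arc p l" using UR_arc[OF B(1)] .
  have pS: "p \<in> S" using P0_S p by blast
  obtain a where a: "a \<in> L" "a \<in> orb p" using L(2)[OF p(1)] by blast
  have aP: "a \<in> P0" and aS: "a \<in> S" using a L P0_S by auto
  define P where "P = c a"
  have PP: "P \<in> P0" and PS: "P \<in> S" unfolding P_def using P0_c P0_S aP by auto
  have oP: "orb P = orb p" "orb a = orb p"
    using orb_eqI[OF pS a(2)] orb_eqI[OF aS orb_c[OF orb_refl]] by (auto simp: P_def)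
  define k where "k = per p"
  have k: "per P = k" "per a = k" 
    using per_orb[OF pS, of P] per_orb[OF pS a(2)] oP(1) orb_refl[of P] unfolding k_def by simp_all
  have k2: "k \<ge> 2" using per_ge2[OF pS] by (simp add: k_def)
  have "p \<in> (\<lambda>i. cp i P) ` {..<k}" using oP(1) orb_refl[of p] orb_eq[OF PS] k(1) by simp
  then obtain j where j: "j < k" "p = cp j P" by auto
  have j0: "j \<noteq> 0"
  proof
    assume "j = 0"
    then have "B = arc (c a) l" using p(4) j by (simp add: P_def)
    moreover have "arc (c a) l \<in> fan L"
      unfolding fan_def using a(1) p(2,3) k(2) by (intro CollectI exI[of _ a] exI[of _ l]) (simp add: k_def)
    ultimately show False using B(2) by simp
  qed
  have aP': "cp (k - 1) P = a"
  proof -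
    have "ci P = cp (k - 1) P" using ci_eq_cp[OF PS] k by simp
    then show ?thesis by (simp add: P_def)
  qed
  have idx: "cp i P \<in> aset p l \<longleftrightarrow> j \<le> i \<and> i < j + l" if "i < k" "j + l \<le> k" for i
  proof
    assume "cp i P \<in> aset p l"
    then obtain s where s: "s < l" "cp i P = cp (s + j) P" by (auto simp: aset_def j(2) cp_add)
    then have "i = s + j" using cp_distinct[OF PS, of i "s + j"] that k by simp
    then show "j \<le> i \<and> i < j + l" using s by simp
  next
    assume i: "j \<le> i \<and> i < j + l"
    then have "cp i P = cp (i - j) p" by (simp add: j(2) flip: cp_add)
    then show "cp i P \<in> aset p l" using i by (auto simp: aset_def)
  qed
  show ?thesis
  proof (cases "j + l < k")
    case True
    let ?X = "arc P j"
    have X: "?X \<in> fan L"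
      unfolding fan_def P_def using a(1) j(1) j0 k(2) by (intro CollectI exI[of _ a] exI[of _ j]) simp
    have jP: "1 \<le> j" "j < per P" using j j0 k by auto
    have nf: "\<not> comp_full A d n aff ?X B"
    proof
      assume f: "comp_full A d n aff ?X B"
      then have "orb P \<subseteq> aset P j \<union> aset p l" using comp_full_arcs(1)[OF PP jP p(1-3)] p(4) by simp
      then have "cp (k - 1) P \<in> aset P j \<union> aset p l" using orb_cp[OF orb_refl] by blast
      then show False using idx[of "k - 1"] True cp_mem_aset[OF PS, of "k - 1" j] k k2 j j0 by auto
    qed
    have "E ?X B = - E P P"
      unfolding p(4) using E_arc_arc[OF PP p(1), of l j] idx[of 0] idx[of j] True p(2,3) j0 j by auto
    then have "E ?X B < 0" using SD(5)[OF PS] by simp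
    then have "max (- E ?X B) (- E B ?X) \<noteq> 0" by (simp add: max_def)
    moreover have "\<not> (?X \<in> UR \<and> B \<in> UR \<and> comp_full A d n aff ?X B)" using nf by blast
    ultimately have "cdeg A d n aff ?X B \<noteq> 0"
      using cdeg_rr[of ?X B] SD[OF arc_S[OF PP jP]] SD(2)[OF UR_S[OF B(1)]] by simp
    then show ?thesis using X by (auto simp: c_compatible_def)
  next
    case False
    let ?X = "arc P (k - 1)"
    have X: "?X \<in> fan L"
      unfolding fan_def P_def using a(1) k(2) k2 by (intro CollectI exI[of _ a] exI[of _ "k - 1"]) simp
    have kP: "1 \<le> k - 1" "k - 1 < per P" using k k2 by auto
    have aB: "a \<in> aset p l"
    proof -
      have "cp (k - 1) P = cp (k - 1 - j) p" using j by (simp add: j(2) flip: cp_add)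
      then show ?thesis using False j aP' by (auto simp: aset_def intro!: image_eqI[of _ _ "k - 1 - j"])
    qed
    have fX: "aset P (k - 1) = orb a - {a}" using full_complement[OF aP] k by (simp add: P_def)
    have tX: "tsupp A d n aff ?X = aset P (k - 1)" using tsupp_arc[OF PP kP] .
    have tB: "tsupp A d n aff B = aset p l" using tsupp_arc[OF p(1-3)] p(4) by simp
    have ne: "P0 \<noteq> {}" using p(1) by blast
    have full: "comp_full A d n aff ?X B"
      unfolding comp_full_def tX tB tube_comps_eq[OF ne] using fX aB aP by blast
    have cX: "c ?X = arc (c P) (k - 1)" by (rule c_arc)
    have "per (c P) = k" using per_orb[OF PS orb_c[OF orb_refl]] k by simp
    then have tcX: "tsupp A d n aff (c ?X) = aset (c P) (k - 1)"
      unfolding cX using tsupp_arc[OF P0_c[OF PP]] kP k by simp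
    have "a = cp (k - 2) (c P)"
    proof -
      have "cp (k - 2) (c P) = cp (k - 1) P" using k2
        by (metis Suc_1 Suc_diff_Suc Suc_le_lessD comp_apply diff_Suc_1 funpow_Suc_right numeral_2_eq_2 One_nat_def)
      then show ?thesis using aP' by simp
    qed
    then have "a \<in> aset (c P) (k - 1)" using k2 by (auto simp: aset_def)
    then have "a \<in> {b \<in> tsupp A d n aff B. b \<in> tsupp A d n aff (c ?X) \<union> tsupp A d n aff (ci ?X) \<and> b \<notin> tsupp A d n aff ?X}"
      using aB fX unfolding tX tB tcX by blast
    moreover have "finite {b \<in> tsupp A d n aff B. b \<in> tsupp A d n aff (c ?X) \<union> tsupp A d n aff (ci ?X) \<and> b \<notin> tsupp A d n aff ?X}"
      unfolding tB by simp
    ultimately have "adj A d n aff ?X B \<noteq> 0" unfolding adj_def by (metis (no_types, lifting) card_0_eq empty_iff)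
    moreover have "?X \<in> UR" using fan_UR[OF L(1)] X by blast
    ultimately have "cdeg A d n aff ?X B \<noteq> 0" using full B(1) by (simp add: cdeg_def Upsilon_re_eq)
    then show ?thesis using X by (auto simp: c_compatible_def)
  qed
qed

section \<open>Orbits of \<open>\<tau>\<^sub>c\<close>\<close>

lemma tau_funpow:
  assumes "rr b" "\<And>j. j \<le> i \<Longrightarrow> pos (cp j b)" shows "(tau A n ^^ i) b = cp i b"
  using assms(2)
proof (induction i)
  case (Suc i)
  then have "(tau A n ^^ i) b = cp i b" by simp
  moreover have "pos (cp i b)" "pos (c (cp i b))" using Suc.prems[of i] Suc.prems[of "Suc i"] by auto
  ultimately show ?case using tau_c[OF rr_cp[OF assms(1)]] by simp
qed simp

text \<open>In case \<open>pos\<close>, \<tau>_c acts as \<open>c\<close> up to an inversion and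
  then gives a negative simple root; in case \<open>neg\<close>, the orbit is followed backwards to
  a negative simple root. The inversion met there has norm \<open>d k\<close> and value
  \<open>d k * \<delta> k\<close> at \<delta>, and both equal \<open>d aff\<close>.\<close>

lemma hat_tau_orbit:
  assumes w: "hat w x" and x: "x \<in> Z"
  shows "\<exists>j<n. in_tau_orbit A n w (nsimple j) \<and> \<delta> j = 1 \<and> d j = d aff"
proof -
  have d0: "d aff > 0" by (rule d_pos) simp
  have Z: "E x x = d aff" "E x \<delta> = d aff" using x by (auto simp: Z_def)
  have node: "\<delta> k = 1 \<and> d k = d aff" if "yroot k y" "E y y = d aff" "E y \<delta> = d aff" for k y
    using yroot_norm[OF that(1)] yroot_E[OF that(1), of \<delta>] that d0 by simp
  from w show ?thesis
  proof (cases rule: hat_cases)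
    case (simple k)
    have "in_tau_orbit A n w (nsimple k)" unfolding in_tau_orbit_def simple(6) by (rule exI[of _ 0]) simp
    then show ?thesis using node[OF simple(4) Z] simple(5) by blast
  next
    case pos
    obtain i k where ik: "yroot k (cp i w)" "\<And>j. j \<le> i \<Longrightarrow> pos (cp j w)" using reach_yroot[OF pos(5,6,7)] by blast
    have "(tau A n ^^ Suc i) w = nsimple k" using tau_funpow[OF pos(5) ik(2)] tau_yroot[OF ik(1)] by simp
    then have "in_tau_orbit A n w (nsimple k)" unfolding in_tau_orbit_def by blast
    moreover have "\<delta> k = 1 \<and> d k = d aff" using node[OF ik(1)] Z pos(4) by simp
    ultimately show ?thesis using yroot_less[OF ik(1)] by blast
  next
    case neg
    obtain p m where pm: "p > 0" "m < 0" "cp p x = x + m \<odot> \<delta>" using orbit_shift_pos[OF neg(1,2)] .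
    obtain j :: nat where j: "- x aff / (- m) < real j" using reals_Archimedean2 by blast
    define x' where "x' = x + (- (real j * m)) \<odot> \<delta>"
    have "cp (j * p) x' = x" by (simp add: x'_def cp_linear cp_mult[OF pm(3)] add.assoc flip: sm_distribs)
    then have "cp (j * p) (- x') = w" using neg(4) by (simp add: cp_linear)
    then have x'w: "(ci ^^ (j * p)) w = - x'" by (metis cp_cipow cp_inj)
    have "x' aff > 0" using j pm(2) by (simp add: x'_def vec_simps field_simps)
    then have "\<not> pos (- x')" using posD[of "- x'" aff] by (force simp: uminus_apply)
    then have ex: "\<exists>N. \<not> pos ((ci ^^ N) w)" using x'w by metis
    define N where "N = (LEAST N. \<not> pos ((ci ^^ N) w))"
    have N: "\<not> pos ((ci ^^ N) w)" unfolding N_def using ex by (rule LeastI_ex)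
    have lt: "pos ((ci ^^ i) w)" if "i < N" for i using that not_less_Least N_def by blast
    have "N \<noteq> 0" using N neg(6) by (cases N) auto
    then obtain i where i: "N = Suc i" by (cases N) auto
    define v where "v = (ci ^^ i) w"
    define y where "y = - ci v"
    have v: "rr v" "pos v" using lt[of i] i rr_cipow[OF neg(5)] by (auto simp: v_def)
    have nv: "\<not> pos (ci v)" using N i by (simp add: v_def)
    have y: "rr y" "pos y" using rr_uminus[OF rr_ci[OF v(1)]] rr_not_pos[OF rr_ci[OF v(1)]] nv by (auto simp: y_def)
    have cy: "c y = - v" by (simp add: y_def c_linear)
    have "\<not> pos (c y)" using cy v pos_neg_eq_0 rrD(6) by metis
    then obtain k where k: "yroot k y" using c_negative_yroot[OF y] by blast
    have wv: "w = cp i v" by (simp add: v_def)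
    have Ew: "E w w = d aff" "E w \<delta> = - d aff" using neg(4) Z by (simp_all add: E_linear)
    have Ev: "E v v = d aff" "E v \<delta> = - d aff" using Ew unfolding wv by simp_all
    have Ey: "E y y = d aff" "E y \<delta> = d aff" using Ev E_c_c[of y y] E_c_delta(1)[of y] by (simp_all add: cy E_linear)
    have "tau A n (nsimple k) = v" using tau_nsimple(1)[OF k] cy by simp
    moreover have "(tau A n ^^ i) v = w" unfolding wv using pos_cp[OF v] Ev(2) d0 by (intro tau_funpow[OF v(1)]) auto
    ultimately have "(tau A n ^^ Suc i) (nsimple k) = w" by (simp add: funpow_swap1)
    then have "in_tau_orbit A n w (nsimple k)" unfolding in_tau_orbit_def by blast
    then show ?thesis using node[OF k Ey] yroot_less[OF k] by blast
  qed
qed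

section \<open>Exchangeability with the imaginary root\<close>

lemma pairwise_iff: "pairwise_compatible A d n aff C \<longleftrightarrow> (\<forall>a\<in>C. \<forall>b\<in>C. a \<noteq> b \<longrightarrow> compat a b)"
proof
  assume *: "pairwise_compatible A d n aff C"
  show "\<forall>a\<in>C. \<forall>b\<in>C. a \<noteq> b \<longrightarrow> compat a b"
  proof (intro ballI impI conjI)
    fix a b assume "a \<in> C" "b \<in> C" "a \<noteq> b"
    then show "c_compatible A d n aff a b" "c_compatible A d n aff b a"
      using *[unfolded pairwise_compatible_def, rule_format, of a b]
        *[unfolded pairwise_compatible_def, rule_format, of b a] by auto
  qed
qed (simp add: pairwise_compatible_def)

lemma compat_delta_UR: "q \<in> UR \<Longrightarrow> compat \<delta> q"
  using compat_delta SD UR_S by blast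

lemma not_compat_delta_off_U: "off_U w \<Longrightarrow> \<not> compat \<delta> w"
  using compat_delta not_compat_delta_nsimple by (auto simp: off_U_def)

lemma cluster_extend:
  assumes "c_cluster A d n aff C" "w \<in> Phi_c A d n aff" "\<And>a. a \<in> C \<Longrightarrow> a \<noteq> w \<Longrightarrow> compat a w"
  shows "w \<in> C"
proof (rule ccontr)
  assume "w \<notin> C"
  have C: "C \<subseteq> Phi_c A d n aff" "pairwise_compatible A d n aff C"
    "\<And>D. C \<subset> D \<Longrightarrow> D \<subseteq> Phi_c A d n aff \<Longrightarrow> \<not> pairwise_compatible A d n aff D"
    using assms(1) by (auto simp: c_cluster_def)
  have "pairwise_compatible A d n aff (insert w C)"
    using C(2) assms(3) unfolding pairwise_iff by blast
  moreover have "C \<subset> insert w C" "insert w C \<subseteq> Phi_c A d n aff" using \<open>w \<notin> C\<close> C(1) assms(2) by auto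
  ultimately show False using C(3) by blast
qed

lemma clusterI:
  assumes "C \<subseteq> Phi_c A d n aff" "\<And>a b. a \<in> C \<Longrightarrow> b \<in> C \<Longrightarrow> a \<noteq> b \<Longrightarrow> compat a b"
    "\<And>w. w \<in> Phi_c A d n aff \<Longrightarrow> w \<notin> C \<Longrightarrow> (\<And>a. a \<in> C \<Longrightarrow> compat a w) \<Longrightarrow> False"
  shows "c_cluster A d n aff C"
  unfolding c_cluster_def
proof (intro conjI allI impI notI)
  show "C \<subseteq> Phi_c A d n aff" by fact
  show "pairwise_compatible A d n aff C" unfolding pairwise_iff using assms(2) by blast
  fix D assume D: "C \<subset> D \<and> D \<subseteq> Phi_c A d n aff" "pairwise_compatible A d n aff D"
  then obtain w where w: "w \<in> D" "w \<notin> C" by blast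
  have "compat a w" if "a \<in> C" for a
  proof -
    have "a \<in> D" "a \<noteq> w" using that D(1) w by auto
    then show ?thesis using D(2) w(1) unfolding pairwise_iff by blast
  qed
  then show False using assms(3)[of w] w D(1) by blast
qed

lemma E_UR_zero:
  assumes "\<And>q. q \<in> S \<Longrightarrow> E x q \<ge> 0" "p \<in> P0" "l \<le> per p" "E x (arc p l) = 0" "r \<in> aset p l"
  shows "E x r = 0"
proof -
  have "(\<Sum>q\<in>aset p l. E x q) = 0" using assms(3,4) P0_S[OF assms(2)] by (simp add: arc_aset E_sum)
  moreover have "E x q \<ge> 0" if "q \<in> aset p l" for q using that assms(1) orb_P0[OF assms(2)] P0_S aset_orb by blast
  ultimately show ?thesis using assms(5) by (subst (asm) sum_nonneg_eq_0_iff) auto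
qed

text \<open>If \<open>E x a\<close> is nonzero, the arc omitting only \<open>a\<close> is compatible
  with the common part \<open>M\<close>, so maximality of \<open>C\<close> puts it into
  \<open>M\<close>; as it is then compatible with \<alpha>, \<open>E x\<close> vanishes on the rest
  of the orbit. This is the hypothesis of \<open>Z_rigid\<close>.\<close>

lemma exchangeable_imp_degrees:
  assumes exch: "exchangeable_with_delta A d n aff \<alpha> \<beta>" and \<alpha>: "\<alpha> \<in> Phi_c A d n aff"
  shows "\<exists>x. hat \<alpha> x \<and> x \<in> Z"
proof -
  obtain C C' where C: "c_cluster A d n aff C" "\<delta> \<in> C" and C': "c_cluster A d n aff C'" "\<alpha> \<in> C'" "\<beta> \<in> C'"
    and eq: "C - {\<delta>} = C' - {\<alpha>, \<beta>}" and ne: "\<alpha> \<noteq> \<beta>"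
    using exch unfolding exchangeable_with_delta_def delta_eq by blast
  define M where "M = C - {\<delta>}"
  have pw: "compat a b" if "a \<in> C" "b \<in> C" "a \<noteq> b" for a b
    using C(1) that unfolding c_cluster_def pairwise_iff by blast
  have pw': "compat a b" if "a \<in> C'" "b \<in> C'" "a \<noteq> b" for a b
    using C'(1) that unfolding c_cluster_def pairwise_iff by blast
  have CP: "C \<subseteq> Phi_c A d n aff" "C' \<subseteq> Phi_c A d n aff" using C C' by (auto simp: c_cluster_def)
  have MU: "M \<subseteq> UR"
  proof
    fix m assume m: "m \<in> M"
    then have "m \<in> Phi_c A d n aff" "compat \<delta> m" using CP pw[OF C(2)] by (auto simp: M_def)
    then show "m \<in> UR" using not_compat_delta_off_U m unfolding Phi_c_iff M_def by blast
  qed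
  have MC: "C = insert \<delta> M" using C(2) by (auto simp: M_def)
  have M': "M = C' - {\<alpha>, \<beta>}" using eq by (simp add: M_def)
  \<comment> \<open>Were \<alpha> equal to \<delta>, maximality of \<open>C\<close> would put
    \<beta> into \<open>C\<close>; were it in \<open>UR\<close>, \<alpha> itself.\<close>
  have "\<alpha> \<noteq> \<delta>"
  proof
    assume "\<alpha> = \<delta>"
    then have "\<beta> \<in> C" using cluster_extend[OF C(1), of \<beta>] pw' C' M' MC CP by blast
    then show False using MC M' \<open>\<alpha> = \<delta>\<close> ne by blast
  qed
  moreover have "\<alpha> \<notin> UR"
  proof
    assume U: "\<alpha> \<in> UR"
    have "compat a \<alpha>" if a: "a \<in> C" "a \<noteq> \<alpha>" for a
    proof (cases "a = \<delta>")
      case True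
      then show ?thesis using compat_delta_UR[OF U] by blast
    next
      case False
      then have "a \<in> C'" using a MC M' by blast
      then show ?thesis using pw' C'(2) a(2) by blast
    qed
    then have "\<alpha> \<in> C" using cluster_extend[OF C(1) \<alpha>] by blast
    then show False using MC M' \<open>\<alpha> \<noteq> \<delta>\<close> by blast
  qed
  ultimately have off: "off_U \<alpha>" using \<alpha> Phi_c_iff by blast
  then obtain x where x: "hat \<alpha> x" using hat_surj by blast
  have rx: "rr x" "E x \<delta> > 0" using x by (auto simp: hat_def)
  have nn: "E x q \<ge> 0" if "q \<in> S" for q using E_nonneg_S[OF rx that] .
  have EM: "E x m = 0" if "m \<in> M" for m
  proof -
    have "m \<in> C'" "m \<noteq> \<alpha>" using that M' by auto
    then have "compat \<alpha> m" using pw' C'(2) by blast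
    then show ?thesis using hat_compat_UR[OF x] MU that by blast
  qed
  have BM: "arc (c a) (per a - 1) \<in> M" if a: "a \<in> P0" "E x a \<noteq> 0" for a
  proof -
    let ?B = "arc (c a) (per a - 1)"
    have BU: "?B \<in> UR" using complement_arc(4)[OF a(1)] .
    have "compat m ?B" if m: "m \<in> C" "m \<noteq> ?B" for m
    proof (cases "m = \<delta>")
      case True
      then show ?thesis using compat_delta_UR[OF BU] by blast
    next
      case False
      then have mM: "m \<in> M" using m MC by blast
      obtain p l where p: "p \<in> P0" "1 \<le> l" "l < per p" "m = arc p l" using UR_arc MU mM by blast
      have "a \<notin> aset p l" using E_UR_zero[OF nn p(1), of l a] EM[OF mM] p a(2) by auto
      then show ?thesis using compat_complement[OF a(1) p(1-3)] p(4) m(2) by blast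
    qed
    then have "?B \<in> C" using cluster_extend[OF C(1)] BU Phi_c_iff by blast
    moreover have "?B \<noteq> \<delta>" using BU delta_not_UR by metis
    ultimately show ?thesis using MC by blast
  qed
  have single: "E x q = 0" if "a \<in> P0" "E x a \<noteq> 0" "q \<in> orb a" "q \<noteq> a" for a q
  proof (rule E_UR_zero[OF nn])
    show "c a \<in> P0" using P0_c that by blast
    show "per a - 1 \<le> per (c a)" using complement_arc(2)[OF that(1)] by simp
    show "E x (arc (c a) (per a - 1)) = 0" using EM BM that by blast
    show "q \<in> aset (c a) (per a - 1)" using full_complement[OF that(1)] that by blast
  qed
  define L where "L = {a \<in> P0. E x a \<noteq> 0}"
  have "\<exists>z\<in>Z. \<forall>a\<in>L. E z a > 0"
    using single by (intro Z_locs) (auto simp: L_def)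
  then obtain z where z: "z \<in> Z" "\<forall>a\<in>L. E z a > 0" by blast
  have "E x q = 0" if "q \<in> P0" "E z q = 0" for q
    using z(2) that by (force simp: L_def)
  then obtain u where "u \<in> \<int>" "x = z + u \<odot> \<delta>" using Z_rigid[OF rx z(1)] by blast
  then have "x \<in> Z" using Z_shift[OF z(1)] by simp
  then show ?thesis using x by blast
qed

lemma degrees_imp_exchangeable:
  assumes x: "hat \<alpha> x" "x \<in> Z"
  shows "\<exists>\<beta>\<in>Phi_c A d n aff. exchangeable_with_delta A d n aff \<alpha> \<beta>"
proof -
  define L where "L = {a \<in> P0. E x a \<noteq> 0}"
  have L: "L \<subseteq> P0" by (auto simp: L_def)
  have L1: "a = b" if "a \<in> L" "b \<in> L" "b \<in> orb a" for a b
    using that Z_loc(2)[OF x(2), of a b] by (auto simp: L_def)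
  have L2: "\<exists>a\<in>L. a \<in> orb p" if p: "p \<in> P0" for p
  proof -
    obtain q where "q \<in> orb p" "E x q = mu p * d aff" using Z_single[OF x(2) p] by blast
    moreover have "mu p * d aff > 0" using mu_pos[OF P0_S[OF p]] d_pos[OF aff_less] by simp
    ultimately show ?thesis using orb_P0[OF p] by (force simp: L_def)
  qed
  define M where "M = fan L"
  have MU: "M \<subseteq> UR" unfolding M_def using fan_UR[OF L] .
  have rx: "rr x" "E x \<delta> > 0" using x by (auto simp: hat_def)
  have x1: "x + 1 \<odot> \<delta> \<in> Z" using Z_shift[OF x(2), of 1] by simp
  have rx1: "rr (x + 1 \<odot> \<delta>)" "E (x + 1 \<odot> \<delta>) \<delta> > 0" using x1 d_pos[OF aff_less] by (auto simp: Z_def)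
  obtain \<beta> where \<beta>: "hat \<beta> (x + 1 \<odot> \<delta>)" using hat_total[OF rx1] by blast
  have off: "off_U \<alpha>" "off_U \<beta>" using x(1) \<beta> hat_off_U by blast+
  have nM: "\<alpha> \<notin> M" "\<beta> \<notin> M" "\<delta> \<notin> M" "\<alpha> \<noteq> \<delta>" "\<beta> \<noteq> \<delta>" using off_U_not off MU delta_not_UR by blast+
  have ab: "compat \<alpha> \<beta>" using hat_chain[OF x(2) _ x(1) \<beta>] by simp
  then have ne: "\<alpha> \<noteq> \<beta>" by (auto simp: c_compatible_def)
  have ExM: "E x m = 0" if m: "m \<in> M" for m
  proof -
    obtain a l where a: "a \<in> L" "m = arc (c a) l" "c a \<in> P0" "1 \<le> l" "l < per (c a)"
      using fanE[OF m[unfolded M_def] L] .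
    have aP: "a \<in> P0" "E x a > 0" using a(1) Z_nonneg[OF x(2) P0_S] by (force simp: L_def)+
    have aS: "a \<in> S" using P0_S aP by blast
    have "per (c a) = per a" using per_orb[OF aS orb_c[OF orb_refl]] .
    then have "aset (c a) l \<subseteq> aset (c a) (per a - 1)" using a(5) by (auto simp: aset_def)
    then have "a \<notin> aset (c a) l" using full_complement[OF aP(1)] by blast
    moreover have "a \<in> orb (c a)" using orb_sym[OF aS orb_c[OF orb_refl]] .
    ultimately show ?thesis using E_Z_arc[OF x(2) aP a(3), of l] a by simp
  qed
  have aM: "compat \<alpha> m" "compat \<beta> m" if "m \<in> M" for m
  proof -
    have U: "m \<in> UR" "m \<in> S" using that MU UR_S by auto
    show "compat \<alpha> m" using hat_compat_UR[OF x(1) U(1)] ExM[OF that] by blast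
    have "E (x + 1 \<odot> \<delta>) m = 0" using ExM[OF that] SD(7)[OF U(2)] by (simp add: E_linear)
    then show "compat \<beta> m" using hat_compat_UR[OF \<beta> U(1)] by blast
  qed
  have MM: "compat m m'" if "m \<in> M" "m' \<in> M" "m \<noteq> m'" for m m'
    using fan_pairwise[OF L L1] that unfolding M_def by blast
  have maxU: "False" if "w \<in> UR" "w \<notin> M" "\<And>a. a \<in> M \<Longrightarrow> compat a w" for w
    using fan_maximal[OF L L2 that(1)] that unfolding M_def by blast
  have C: "c_cluster A d n aff (insert \<delta> M)"
  proof (rule clusterI)
    show "insert \<delta> M \<subseteq> Phi_c A d n aff" using MU Phi_c_iff by blast
    show "compat a b" if "a \<in> insert \<delta> M" "b \<in> insert \<delta> M" "a \<noteq> b" for a b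
      using that MM compat_delta_UR MU by blast
    fix w assume w: "w \<in> Phi_c A d n aff" "w \<notin> insert \<delta> M" "\<And>a. a \<in> insert \<delta> M \<Longrightarrow> compat a w"
    then have "w \<in> UR" using Phi_c_iff not_compat_delta_off_U by blast
    then show False using maxU w by blast
  qed
  have C': "c_cluster A d n aff (insert \<alpha> (insert \<beta> M))"
  proof (rule clusterI)
    show "insert \<alpha> (insert \<beta> M) \<subseteq> Phi_c A d n aff" using MU Phi_c_iff off by blast
    show "compat a b" if "a \<in> insert \<alpha> (insert \<beta> M)" "b \<in> insert \<alpha> (insert \<beta> M)" "a \<noteq> b" for a b
      using that MM aM ab by blast
    fix w assume w: "w \<in> Phi_c A d n aff" "w \<notin> insert \<alpha> (insert \<beta> M)" "\<And>a. a \<in> insert \<alpha> (insert \<beta> M) \<Longrightarrow> compat a w"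
    have "w \<noteq> \<delta>" using w(3)[of \<alpha>] not_compat_delta_off_U[OF off(1)] by blast
    moreover have "w \<notin> UR" using maxU w by blast
    ultimately have "off_U w" using w(1) Phi_c_iff by blast
    then obtain y where y: "hat w y" using hat_surj by blast
    have ry: "rr y" "E y \<delta> > 0" using y by (auto simp: hat_def)
    have nn: "E y q \<ge> 0" if "q \<in> S" for q using E_nonneg_S[OF ry that] .
    \<comment> \<open>In each orbit the fan contains the arc omitting only the location
      \<open>a\<close> of \<open>E x\<close>; compatibility with it kills \<open>E y\<close> on the
      rest of the orbit.\<close>
    have "E y q = 0" if q: "q \<in> P0" "E x q = 0" for q
    proof -
      obtain a where a: "a \<in> L" "a \<in> orb q" using L2[OF q(1)] by blast
      have aP: "a \<in> P0" "a \<noteq> q" using a q by (auto simp: L_def)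
      have "q \<in> aset (c a) (per a - 1)" using full_complement[OF aP(1)] orb_sym[OF P0_S[OF q(1)] a(2)] aP(2) by blast
      moreover have BM: "arc (c a) (per a - 1) \<in> M"
        unfolding M_def fan_def using a(1) complement_arc(1)[OF aP(1)] by (intro CollectI exI[of _ a] exI[of _ "per a - 1"]) auto
      then have "E y (arc (c a) (per a - 1)) = 0" using hat_compat_UR[OF y] w(3) MU by blast
      moreover have "per a - 1 \<le> per (c a)" using complement_arc(2)[OF aP(1)] by simp
      ultimately show ?thesis using E_UR_zero[OF nn complement_arc(3)[OF aP(1)]] by blast
    qed
    then obtain u where u: "u \<in> \<int>" "y = x + u \<odot> \<delta>" using Z_rigid[OF ry x(2)] by blast
    have yZ: "y \<in> Z" using u Z_shift[OF x(2)] by simp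
    have yx: "x = y + (- u) \<odot> \<delta>" "x + 1 \<odot> \<delta> = y + (1 - u) \<odot> \<delta>"
      using u(2) by (simp_all add: sm_minus sm_distribs algebra_simps)
    obtain k where k: "u = of_int k" using u(1) by (elim Ints_cases)
    have "k = 0 \<or> k \<ge> 1 \<or> - k \<ge> 1" by linarith
    then have "u = 0 \<or> u \<ge> 1 \<or> - u \<ge> 1" using k by linarith
    \<comment> \<open>The values 0 and 1 give \<alpha> and \<beta>; a larger \<open>u\<close> is too
      far from \<alpha>, a negative one too far from \<beta>.\<close>
    then consider "u = 0" | "u \<ge> 1" | "- u \<ge> 1" by blast
    then show False
    proof cases
      case 1
      then have "w = \<alpha>" using u(2) hat_unique y x(1) by simp
      then show False using w(2) by blast
    next
      case 2
      have "u = 1" using hat_chain[OF x(2) 2 x(1)] y u(2) w(3)[of \<alpha>] by blast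
      then have "w = \<beta>" using u(2) hat_unique[OF y] \<beta> by simp
      then show False using w(2) by blast
    next
      case 3
      have "1 - u = 1" using hat_chain[OF yZ, of "1 - u" w \<beta>] 3 y \<beta> w(3)[of \<beta>] unfolding yx(2) by auto
      then show False using 3 by simp
    qed
  qed
  have "insert \<delta> M - {\<delta>} = insert \<alpha> (insert \<beta> M) - {\<alpha>, \<beta>}" using nM by blast
  then have "exchangeable_with_delta A d n aff \<alpha> \<beta>"
    unfolding exchangeable_with_delta_def delta_eq using C C' ne by blast
  then show ?thesis using off Phi_c_iff by blast
qed

lemma degree_one_iff_exchangeable:
  assumes \<alpha>: "\<alpha> \<in> Phi_c A d n aff"
  shows "(cdeg A d n aff \<alpha> \<delta> = 1 \<and> cdeg A d n aff \<delta> \<alpha> = 1 \<longleftrightarrow>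
       (\<exists>\<beta>\<in>Phi_c A d n aff. exchangeable_with_delta A d n aff \<alpha> \<beta>))
    \<and> (cdeg A d n aff \<alpha> \<delta> = 1 \<and> cdeg A d n aff \<delta> \<alpha> = 1 \<longrightarrow>
       (\<exists>j<n. in_tau_orbit A n \<alpha> (nsimple j) \<and> (\<exists>\<pi>. diagram_aut A n \<pi> \<and> \<pi> j = aff)))"
proof -
  have deg: "\<exists>x. hat \<alpha> x \<and> x \<in> Z" if one: "cdeg A d n aff \<alpha> \<delta> = 1" "cdeg A d n aff \<delta> \<alpha> = 1"
  proof -
    have "\<alpha> \<noteq> \<delta>" using one cdeg_delta_left[OF pos_delta] by auto
    moreover have "\<alpha> \<notin> UR" using one(2) cdeg_delta_left[of \<alpha>] SD(2,3) UR_S by force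
    ultimately have "off_U \<alpha>" using \<alpha> Phi_c_iff by blast
    then obtain x where "hat \<alpha> x" using hat_surj by blast
    then show ?thesis using hat_Z one by blast
  qed
  have gt: "cdeg A d n aff \<alpha> \<delta> = 1 \<and> cdeg A d n aff \<delta> \<alpha> = 1" if "\<exists>\<beta>\<in>Phi_c A d n aff. exchangeable_with_delta A d n aff \<alpha> \<beta>"
    using that exchangeable_imp_degrees \<alpha> hat_Z by blast
  have tau: "\<exists>j<n. in_tau_orbit A n \<alpha> (nsimple j) \<and> (\<exists>\<pi>. diagram_aut A n \<pi> \<and> \<pi> j = aff)"
    if "hat \<alpha> x" "x \<in> Z" for x
    using hat_tau_orbit[OF that] affine_nodes_conjugate by blast
  show ?thesis using deg gt tau degrees_imp_exchangeable by blast
qed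

end

section \<open>The minimal imaginary root\<close>

text \<open>A functional from the reals to the rationals, linear over the rationals and equal to 1
  at \<open>u k\<close>, preserves integral linear equations when applied to the coordinates of
  \<open>u\<close>.\<close>

lemma rational_null_vector:
  fixes B :: cmat and u :: vec
  assumes "\<And>i. i < n \<Longrightarrow> matvec B n u i = 0" "k < n" "u k \<noteq> 0"
  shows "\<exists>v :: nat \<Rightarrow> rat. v k \<noteq> 0 \<and> (\<forall>i<n. matvec B n (\<lambda>j. of_rat (v j)) i = 0)"
proof -
  interpret vector_space_pair "\<lambda>q x::real. of_rat q * x" "(*) :: rat \<Rightarrow> rat \<Rightarrow> rat"
    by unfold_locales (auto simp: algebra_simps of_rat_mult of_rat_add)
  have "vs1.independent {u k}" using assms(3) by simp
  then obtain g where g: "Vector_Spaces.linear (\<lambda>q x::real. of_rat q * x) (*) g" "\<forall>x\<in>{u k}. g x = (1::rat)"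
    using linear_independent_extend[of "{u k}" "\<lambda>_. 1"] by blast
  interpret g: Vector_Spaces.linear "\<lambda>q x::real. of_rat q * x" "(*)" g by (rule g(1))
  have gi: "g (of_int a * x) = of_int a * g x" for a x using g.scale[of "of_int a" x] by simp
  have "(\<Sum>j<n. of_int (B i j) * g (u j)) = 0" if "i < n" for i
  proof -
    have "(\<Sum>j<n. of_int (B i j) * g (u j)) = g (\<Sum>j<n. of_int (B i j) * u j)" by (simp add: g.sum gi)
    also have "\<dots> = 0" using assms(1)[OF that] by (simp add: matvec_def g.zero)
    finally show ?thesis .
  qed
  then have "matvec B n (\<lambda>j. of_rat (g (u j))) i = 0" if "i < n" for i
  proof -
    have "matvec B n (\<lambda>j. of_rat (g (u j))) i = of_rat (\<Sum>j<n. of_int (B i j) * g (u j))"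
      by (simp add: matvec_def of_rat_sum of_rat_mult)
    then show ?thesis using \<open>\<And>i. i < n \<Longrightarrow> (\<Sum>j<n. of_int (B i j) * g (u j)) = 0\<close>[OF that] by simp
  qed
  then show ?thesis using g(2) by (intro exI[of _ "\<lambda>j. g (u j)"]) auto
qed

lemma common_denominator:
  fixes v :: "nat \<Rightarrow> rat"
  shows "\<exists>N::int. N > 0 \<and> (\<forall>j<n. of_int N * (of_rat (v j) :: real) \<in> \<int>)"
proof (induction n)
  case 0
  then show ?case by (intro exI[of _ 1]) auto
next
  case (Suc n)
  then obtain N :: int where N: "N > 0" "\<forall>j<n. of_int N * (of_rat (v j) :: real) \<in> \<int>" by blast
  obtain a b where ab: "v n = Fract a b" "b > 0" by (cases "v n") auto
  have "of_int (N * b) * (of_rat (v j) :: real) \<in> \<int>" if "j < Suc n" for j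
  proof (cases "j = n")
    case True
    have "of_int (N * b) * (of_rat (v n) :: real) = of_int (N * a)" using ab by (simp add: of_rat_rat)
    then show ?thesis unfolding True by (metis Ints_of_int)
  next
    case False
    then have "of_int N * (of_rat (v j) :: real) \<in> \<int>" using N that by simp
    then have "of_int b * (of_int N * (of_rat (v j) :: real)) \<in> \<int>" using Ints_mult[OF Ints_of_int] by blast
    then show ?thesis by (simp add: mult_ac)
  qed
  then show ?case using N ab by (intro exI[of _ "N * b"]) auto
qed

text \<open>In affine type, \<open>kac_K\<close> consists of the positive integral null vectors. The
  Weyl group fixes them, and removing integral parts shows that they are multiples of the lowest
  one. The matrix is general because both \<open>A\<close> and its transpose are needed.\<close>

lemma delta_facts:
  fixes B :: cmat and u :: vec
  assumes conn: "dynkin_connected B {..<n}" and u: "\<And>i. i < n \<Longrightarrow> u i > 0" "\<And>i. i < n \<Longrightarrow> matvec B n u i = 0"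
    and ker: "\<And>v. (\<And>i. i < n \<Longrightarrow> matvec B n v i = 0) \<Longrightarrow> \<exists>t. \<forall>i<n. v i = t * u i"
    and semi: "\<And>v. (\<And>i. i < n \<Longrightarrow> matvec B n v i \<ge> 0) \<Longrightarrow> \<forall>i<n. matvec B n v i = 0"
  shows "supported n (delta B n)" "\<And>i. delta B n i \<in> \<int>" "\<And>i. i < n \<Longrightarrow> delta B n i > 0"
    "\<And>i. i < n \<Longrightarrow> matvec B n (delta B n) i = 0"
    "pos_imag_roots B n = {m \<odot> delta B n | m. m \<in> \<int> \<and> m \<ge> 1}"
proof -
  define H where "H = {v. supported n v \<and> (\<forall>i<n. v i \<in> \<int> \<and> v i > 0) \<and> (\<forall>i<n. matvec B n v i = 0)}"
  have n0: "n > 0" using conn by (auto simp: dynkin_connected_def)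
  have mv_sm: "matvec B n (t \<odot> v) i = t * matvec B n v i" for t v i
    by (simp add: matvec_def sum_distrib_left sm_apply mult_ac)
  have mv_diff: "matvec B n (v - w) i = matvec B n v i - matvec B n w i" for v w i
    by (simp add: matvec_def sum_subtractf minus_apply algebra_simps)
  have K: "kac_K B n = H"
  proof
    show "H \<subseteq> kac_K B n"
    proof
      fix v assume v: "v \<in> H"
      then have "{i. i < n \<and> v i \<noteq> 0} = {..<n}" by (force simp: H_def)
      then show "v \<in> kac_K B n" using v conn by (auto simp: kac_K_def H_def less_imp_le)
    qed
    show "kac_K B n \<subseteq> H"
    proof
      fix v assume v: "v \<in> kac_K B n"
      \<comment> \<open>The inequality in \<open>kac_K\<close> has the sign opposite to that in
        \<open>semi\<close>.\<close>
      have "\<forall>i<n. matvec B n ((-1) \<odot> v) i = 0" using v by (intro semi) (auto simp: mv_sm kac_K_def)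
      then have z: "matvec B n v i = 0" if "i < n" for i using that by (simp add: mv_sm)
      then obtain t where t: "\<forall>i<n. v i = t * u i" using ker by blast
      obtain k where k: "k < n" "v k \<noteq> 0" using v by (auto simp: kac_K_def dynkin_connected_def)
      then have "v k > 0" using v by (auto simp: kac_K_def less_eq_real_def)
      then have "t > 0" using t k(1) u(1)[OF k(1)] by (simp add: zero_less_mult_iff)
      then have "v i > 0" if "i < n" for i using t u(1)[OF that] that by simp
      then show "v \<in> H" using v z by (auto simp: H_def kac_K_def)
    qed
  qed
  have Wfix: "weyl_word B n ws v = v" if "v \<in> H" "set ws \<subseteq> {..<n}" for ws v
    using that(2)
  proof (induction ws)
    case (Cons a ws)
    then have "weyl_word B n (a # ws) v = Defs.refl B n a v" by (simp add: weyl_word_def)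
    also have "\<dots> = v" using that(1) Cons.prems by (auto simp: refl_def H_def fun_eq_iff)
    finally show ?case .
  qed (simp add: weyl_word_def)
  have imag: "pos_imag_roots B n = H"
  proof
    show "pos_imag_roots B n \<subseteq> H" unfolding pos_imag_roots_def K using Wfix by auto
    show "H \<subseteq> pos_imag_roots B n"
    proof
      fix v assume v: "v \<in> H"
      then have "v = weyl_word B n [] v" "set [] \<subseteq> {..<n}" using Wfix[of v "[]"] by auto
      then show "v \<in> pos_imag_roots B n" unfolding pos_imag_roots_def K using v by blast
    qed
  qed
  have "H \<noteq> {}"
  proof -
    obtain v :: "nat \<Rightarrow> rat" where v: "v 0 \<noteq> 0" "\<forall>i<n. matvec B n (\<lambda>j. of_rat (v j)) i = 0"
      using rational_null_vector[of n B u 0] u n0 by force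
    obtain t where t: "\<forall>i<n. (of_rat (v i) :: real) = t * u i" using ker[of "\<lambda>j. of_rat (v j)"] v(2) by blast
    have t0: "t \<noteq> 0" using t v(1) n0 by auto
    obtain N :: int where N: "N > 0" "\<forall>j<n. of_int N * (of_rat (v j) :: real) \<in> \<int>" using common_denominator by blast
    \<comment> \<open>The factor \<open>N\<close> clears denominators, and \<open>sgn t\<close>
      makes the vector positive.\<close>
    define s :: real where "s = of_int N * sgn t"
    define w where "w = (\<lambda>j. if j < n then s * of_rat (v j) else 0 :: real)"
    have "w i > 0" "w i \<in> \<int>" if "i < n" for i
    proof -
      have "w i = of_int N * \<bar>t\<bar> * u i" using that t by (simp add: w_def s_def abs_sgn mult_ac)
      then show "w i > 0" using N(1) t0 u(1)[OF that] by simp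
      have "sgn t \<in> \<int>" by (simp add: sgn_if)
      then have "sgn t * (of_int N * of_rat (v i)) \<in> \<int>" using Ints_mult[of "sgn t" "of_int N * of_rat (v i)"] N(2) that by blast
      then show "w i \<in> \<int>" using that by (simp add: w_def s_def mult_ac)
    qed
    moreover have "matvec B n w i = 0" if "i < n" for i
    proof -
      have "matvec B n w i = s * matvec B n (\<lambda>j. of_rat (v j)) i"
        by (simp add: matvec_def w_def sum_distrib_left mult_ac)
      then show ?thesis using v(2) that by simp
    qed
    moreover have "supported n w" by (simp add: supported_def w_def)
    ultimately have "w \<in> H" by (simp add: H_def)
    then show ?thesis by blast
  qed
  then obtain v0 where v0: "v0 \<in> H" by blast
  have ht_int: "height n v \<in> \<int>" "height n v > 0" if "v \<in> H" for v
  proof -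
    show "height n v \<in> \<int>" using that by (auto simp: height_def H_def intro!: Ints_sum)
    show "height n v > 0" using that n0 by (auto simp: height_def H_def intro!: sum_pos)
  qed
  obtain D where D: "D \<in> H" "\<forall>v. v \<in> H \<longrightarrow> nat \<lfloor>height n D\<rfloor> \<le> nat \<lfloor>height n v\<rfloor>"
    using ex_has_least_nat[of "\<lambda>v. v \<in> H" v0 "\<lambda>v. nat \<lfloor>height n v\<rfloor>"] v0 by blast
  have Dmin: "height n D \<le> height n v" if "v \<in> H" for v
    using D(2) that ht_int[OF that] ht_int[OF D(1)] by (auto elim!: Ints_cases)
  have prop_D: "\<exists>s>0. v = s \<odot> D" if v: "v \<in> H" for v
  proof -
    obtain a where a: "\<forall>i<n. v i = a * u i" using ker[of v] v by (auto simp: H_def)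
    obtain b where b: "\<forall>i<n. D i = b * u i" using ker[of D] D(1) by (auto simp: H_def)
    have p: "a > 0" "b > 0" using a b n0 u(1)[OF n0] v D(1) by (auto simp: H_def zero_less_mult_iff dest!: spec[of _ 0])
    have "v = (a / b) \<odot> D"
    proof
      fix i show "v i = ((a / b) \<odot> D) i"
        using a b p v D(1) by (cases "i < n") (auto simp: sm_apply H_def supported_def)
    qed
    then show ?thesis using p by (intro exI[of _ "a / b"]) auto
  qed
  have delta: "delta B n = D" unfolding delta_def imag
  proof (rule the_equality)
    show "D \<in> H \<and> (\<forall>v\<in>H. height n D \<le> height n v)" using D(1) Dmin by blast
    fix v assume v: "v \<in> H \<and> (\<forall>w\<in>H. height n v \<le> height n w)"
    then obtain s where s: "s > 0" "v = s \<odot> D" using prop_D by blast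
    have "height n v = height n D" using v D(1) Dmin by (meson order_antisym)
    then have "s * height n D = height n D" using s(2) by (simp add: height_linear)
    then have "s = 1" using ht_int(2)[OF D(1)] by simp
    then show "v = D" using s by simp
  qed
  have mult: "\<exists>m. m \<in> \<int> \<and> m \<ge> 1 \<and> v = m \<odot> D" if v: "v \<in> H" for v
  proof -
    obtain s where s: "s > 0" "v = s \<odot> D" using prop_D[OF v] by blast
    define f where "f = s - of_int \<lfloor>s\<rfloor>"
    have f: "0 \<le> f" "f < 1" unfolding f_def by linarith+
    have "f = 0"
    proof (rule ccontr)
      assume "f \<noteq> 0"
      then have "f > 0" using f by simp
      have w: "f \<odot> D = v - of_int \<lfloor>s\<rfloor> \<odot> D" using s(2) by (simp add: f_def sm_distribs)
      have "(f \<odot> D) i \<in> \<int>" if "i < n" for i unfolding w using v D(1) that by (auto simp: H_def vec_simps)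
      moreover have "(f \<odot> D) i > 0" if "i < n" for i using \<open>f > 0\<close> D(1) that by (simp add: H_def sm_apply)
      moreover have "matvec B n (f \<odot> D) i = 0" if "i < n" for i using D(1) that by (simp add: mv_sm H_def)
      moreover have "supported n (f \<odot> D)" using D(1) by (simp add: H_def)
      ultimately have "f \<odot> D \<in> H" by (simp add: H_def)
      then have "height n D \<le> f * height n D" using Dmin by (metis height_linear(3))
      then show False using f(2) ht_int(2)[OF D(1)] by simp
    qed
    then have "s = of_int \<lfloor>s\<rfloor>" by (simp add: f_def)
    then have "s \<in> \<int>" by (metis Ints_of_int)
    moreover from this have "s \<ge> 1" using s(1) by (auto elim!: Ints_cases)
    ultimately show ?thesis using s(2) by blast
  qed
  have mult': "m \<odot> D \<in> H" if "m \<in> \<int>" "m \<ge> 1" for m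
    using that D(1) by (auto simp: H_def sm_apply mv_sm)
  show "pos_imag_roots B n = {m \<odot> delta B n | m. m \<in> \<int> \<and> m \<ge> 1}"
    unfolding imag delta using mult mult' by blast
  show "supported n (delta B n)" "\<And>i. i < n \<Longrightarrow> delta B n i > 0" "\<And>i. i < n \<Longrightarrow> matvec B n (delta B n) i = 0"
    unfolding delta using D(1) by (auto simp: H_def)
  show "delta B n i \<in> \<int>" for i
    unfolding delta using D(1) by (cases "i < n") (auto simp: H_def supported_def)
qed

text \<open>By \<open>tm\<close> the transpose is \<open>A\<close> conjugated by the diagonal matrix
  of \<open>d\<close>, so its null vectors are those of \<open>A\<close> with coordinates multiplied
  by \<open>d i\<close>; the coefficients 1 at \<open>aff\<close> fix the factor
  \<open>1 / d aff\<close>.\<close>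

lemma affine_sysI:
  assumes aff_t: "affine_type A n" and sym: "symmetrizing A d n" and node: "is_affine_node A n aff"
  shows "affine_sys A d n aff (delta A n)"
proof -
  have g: "gcm A n" and conn: "dynkin_connected A {..<n}"
    and semi: "\<And>v. (\<And>i. i < n \<Longrightarrow> matvec A n v i \<ge> 0) \<Longrightarrow> \<forall>i<n. matvec A n v i = 0"
    using aff_t unfolding affine_type_def by blast+
  obtain u where u: "\<And>i. i < n \<Longrightarrow> u i > 0" "\<And>i. i < n \<Longrightarrow> matvec A n u i = 0"
    "\<And>v. (\<And>i. i < n \<Longrightarrow> matvec A n v i = 0) \<Longrightarrow> \<exists>t. \<forall>i<n. v i = t * u i"
    using aff_t unfolding affine_type_def by blast
  have dp: "\<And>i. i < n \<Longrightarrow> d i > 0" and ds: "\<And>i j. i < n \<Longrightarrow> j < n \<Longrightarrow> d i * of_int (A i j) = d j * of_int (A j i)"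
    using sym unfolding symmetrizing_def by blast+
  note D = delta_facts[OF conn u semi]
  have tm: "matvec (transp A) n v i = d i * matvec A n (\<lambda>j. v j / d j) i" if "i < n" for v i
    unfolding matvec_def sum_distrib_left transp_def
  proof (intro sum.cong refl)
    fix j assume "j \<in> {..<n}"
    then show "of_int (A j i) * v j = d i * (of_int (A i j) * (v j / d j))"
      using ds[OF that, of j] dp[of j] by (simp add: field_simps)
  qed
  have tconn: "dynkin_connected (transp A) {..<n}"
    unfolding dynkin_connected_def transp_def
  proof (intro conjI allI impI)
    show "{..<n} \<noteq> {}" using conn by (simp add: dynkin_connected_def)
    fix T assume T: "T \<subseteq> {..<n} \<and> T \<noteq> {} \<and> T \<noteq> {..<n}"
    then obtain i j where "i \<in> T" "j \<in> {..<n} - T" "A i j \<noteq> 0" using conn unfolding dynkin_connected_def by blast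
    moreover from this have "A j i \<noteq> 0" using g T by (auto simp: gcm_def)
    ultimately show "\<exists>i\<in>T. \<exists>j\<in>{..<n} - T. A j i \<noteq> 0" by blast
  qed
  have D': "supported n (delta (transp A) n)" "\<And>i. delta (transp A) n i \<in> \<int>" "\<And>i. i < n \<Longrightarrow> matvec (transp A) n (delta (transp A) n) i = 0"
  proof -
    have 1: "d i * u i > 0" if "i < n" for i using dp u(1) that by simp
    have 2: "matvec (transp A) n (\<lambda>i. d i * u i) i = 0" if "i < n" for i
    proof -
      have "matvec A n (\<lambda>j. d j * u j / d j) i = matvec A n u i"
        unfolding matvec_def using dp by (intro sum.cong refl) (auto dest!: dp)
      then show ?thesis using tm[OF that, of "\<lambda>i. d i * u i"] u(2)[OF that] by simp
    qed
    have 3: "\<exists>t. \<forall>i<n. v i = t * (d i * u i)" if "\<And>i. i < n \<Longrightarrow> matvec (transp A) n v i = 0" for v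
    proof -
      have "matvec A n (\<lambda>j. v j / d j) i = 0" if "i < n" for i
        using tm[OF that, of v] \<open>\<And>i. i < n \<Longrightarrow> matvec (transp A) n v i = 0\<close>[OF that] dp[OF that] by simp
      then obtain t where t: "\<forall>i<n. v i / d i = t * u i" using u(3)[of "\<lambda>j. v j / d j"] by blast
      have "v i = t * (d i * u i)" if "i < n" for i
      proof -
        have "v i / d i = t * u i" "d i \<noteq> 0" using t that dp[OF that] by auto
        then show ?thesis by (simp add: divide_eq_eq mult_ac)
      qed
      then show ?thesis by blast
    qed
    have 4: "\<forall>i<n. matvec (transp A) n v i = 0" if "\<And>i. i < n \<Longrightarrow> matvec (transp A) n v i \<ge> 0" for v
    proof -
      have "matvec A n (\<lambda>j. v j / d j) i \<ge> 0" if "i < n" for i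
        using tm[OF that, of v] \<open>\<And>i. i < n \<Longrightarrow> matvec (transp A) n v i \<ge> 0\<close>[OF that] dp[OF that] by (simp add: zero_le_mult_iff)
      then show ?thesis using semi[of "\<lambda>j. v j / d j"] tm by simp
    qed
    note X = delta_facts[OF tconn 1 2 3 4]
    show "supported n (delta (transp A) n)" "\<And>i. delta (transp A) n i \<in> \<int>"
      "\<And>i. i < n \<Longrightarrow> matvec (transp A) n (delta (transp A) n) i = 0" using X by blast+
  qed
  have aff: "aff < n" "delta A n aff = 1" "delta_vee A n aff = 1" using node by (auto simp: is_affine_node_def)
  have vee: "delta_vee A n i = d i * delta A n i / d aff" if i: "i < n" for i
  proof -
    have "matvec A n (\<lambda>j. delta_vee A n j / d j) i = 0" if "i < n" for i
      using tm[OF that, of "delta_vee A n"] D'(3)[OF that] dp[OF that] by (simp add: delta_vee_def)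
    then obtain s where s: "\<forall>i<n. delta_vee A n i / d i = s * u i" using u(3)[of "\<lambda>j. delta_vee A n j / d j"] by blast
    obtain t where t: "\<forall>i<n. delta A n i = t * u i" using u(3)[of "delta A n"] D(4) by blast
    have t0: "t \<noteq> 0" "s * u aff = 1 / d aff" "t * u aff = 1" using t s aff by auto
    then have "(s * d aff) * u aff = t * u aff" using dp[OF aff(1)] by (simp add: field_simps)
    then have st: "s = t / d aff" using u(1)[OF aff(1)] dp[OF aff(1)] by (simp add: eq_divide_eq)
    have "delta_vee A n i / d i = s * u i" using s i by blast
    then have "delta_vee A n i = d i * (s * u i)" using dp[OF i] by (simp add: field_simps)
    then show ?thesis using t i st by simp
  qed
  show ?thesis
  proof unfold_locales
    show "d i * delta A n i / d aff \<in> \<int>" if "i < n" for i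
      using vee[OF that] D'(2)[of i] by (simp add: delta_vee_def)
  qed (use g conn dp ds D aff vee in auto)
qed

theorem theorem7p5:
  fixes A :: "nat \<Rightarrow> nat \<Rightarrow> int" and d :: "nat \<Rightarrow> real" and n aff :: nat and \<alpha> :: "nat \<Rightarrow> real"
  assumes "affine_type A n"
    and "symmetrizing A d n"
    and "\<not> type_A2k2 A n"
    and "is_affine_node A n aff"
    and "\<alpha> \<in> Phi_c A d n aff"
  shows "((cdeg A d n aff \<alpha> (delta A n) = 1 \<and> cdeg A d n aff (delta A n) \<alpha> = 1)
           \<longleftrightarrow> (\<exists>\<beta>\<in>Phi_c A d n aff. exchangeable_with_delta A d n aff \<alpha> \<beta>))
       \<and> ((cdeg A d n aff \<alpha> (delta A n) = 1 \<and> cdeg A d n aff (delta A n) \<alpha> = 1)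
           \<longrightarrow> (\<exists>j<n. in_tau_orbit A n \<alpha> (nsimple j) \<and>
                 (\<exists>\<pi>. diagram_aut A n \<pi> \<and> \<pi> j = aff)))"
  using affine_sys.degree_one_iff_exchangeable[OF affine_sysI[OF assms(1,2,4)] assms(5)] by blast

end
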